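(* Let $c=(c_l)_{l\ge 1}$ be a sequence of positive real numbers and let $n$ be a positive integer. Then there exists a constant $K$ (depending only on $c$ and $n$) such that for all $\delta\ge 0$, all positive integers $q$ and every function $\psi:S_q\to\mathbb C$ belonging to $\mathcal F^n_{c,\delta}$, the function $\psi$ is $(\delta+q^{-1})^{1/2}$-supported by the set of Young diagrams $\lambda\in\mathcal Y_q$ satisfying $$|\chi_\lambda(\rho)-\psi(\rho)|\le K(\delta+q^{-1})^{1/4}q^{-l/2}\qquad\text{for all }\rho\in S_q\text{ with }|\rho|=l\le n/2 .$$
   Context: **Symmetric groups.** $S_q$ is the symmetric group on $\{1,\dots,q\}$. For $\sigma\in S_q$, $c(\sigma)$ is its number of cycles (fixed points included) and $|\sigma|=q-c(\sigma)$, the minimal number of transpositions whose product is $\sigma$. The support of $\sigma$ is the set of points not fixed by it. $\mathcal Y_q$ is the set of Young diagrams with $q$ boxes; for $\lambda\in\mathcal Y_q$, $\chi_\lambda$ is the normalized ($\chi_\lambda(e)=1$) irreducible character of $S_q$ associated with $\lambda$. **Positive definite functions.** Let $\psi:S_q\to\mathbb C$ be a central (constant on conjugacy classes), positive definite function, normalized by $\psi(e)=1$. Write $\psi=\sum_{\lambda\in\mathcal Y_q}p_\lambda\chi_\lambda$ with $p_\lambda\ge 0$, $\sum_\lambda p_\lambda=1$ (this expansion exists and is unique), and let $\Pi_\psi$ be the probability measure on $\mathcal Y_q$ with $\Pi_\psi(\{\lambda\})=p_\lambda$. For $\mathcal V\subset\mathcal Y_q$ and $\gamma>0$, $\psi$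 is called $\gamma$-supported on (or by) $\mathcal V$ if $\Pi_\psi(\mathcal V)>1-\gamma$. **The class $\mathcal F^n_{c,\delta}$.** For a positive integer $n$, a sequence $c=(c_l)_{l\ge1}$ of positive reals and $\delta\ge 0$, $\mathcal F^n_{c,\delta}$ is the set of all central positive definite normalized functions $\psi:S_q\to\mathbb C$, for some positive integer $q$, such that (1) $|\psi(\rho)|\le c_l q^{-l/2}$ for all $l\le n$ and all $\rho\in S_q$ with $|\rho|=l$; (2) $|\psi(\rho\sigma)-\psi(\rho)\psi(\sigma)|\le\delta q^{-l/2}$ for all $l\le n$ and all $\rho,\sigma\in S_q$ with disjoint supports such that $|\rho\sigma|=l$. (In (1), $l$ ranges over $1\le l\le n$.) *)

theory Defs
  imports
    "HOL-Probability.Probability"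
    "HOL-Combinatorics.Combinatorics"
    "HOL-Library.Function_Algebras"
    "HOL-Library.Nonpos_Ints"
begin

text \<open>
  The symmetric group \<open>S\<^sub>q\<close> is the set of all \<open>\<rho>\<close> with \<open>\<rho> permutes {1..q}\<close>; the product
  \<open>\<rho>\<sigma>\<close> is \<open>\<rho> \<circ> \<sigma>\<close>. A function on \<open>S\<^sub>q\<close> is a function of type \<open>perm \<Rightarrow> complex\<close>, of
  which only the values at permutations of \<open>{1..q}\<close> are ever used.
\<close>

type_synonym perm = "nat \<Rightarrow> nat"

definition Sym :: "nat \<Rightarrow> perm set" where
  "Sym q = {\<rho>. \<rho> permutes {1..q}}"

definition num_cycles :: "nat \<Rightarrow> perm \<Rightarrow> nat" where
  "num_cycles q \<rho> = card (orbit \<rho> ` {1..q})"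

definition perm_length :: "nat \<Rightarrow> perm \<Rightarrow> nat" where
  "perm_length q \<rho> = q - num_cycles q \<rho>"

definition perm_support :: "perm \<Rightarrow> nat set" where
  "perm_support \<rho> = {x. \<rho> x \<noteq> x}"

text \<open>A Young diagram is given by its weakly decreasing list of (positive) row lengths.\<close>

definition young_diagrams :: "nat \<Rightarrow> nat list set" where
  "young_diagrams q = {\<mu>. sorted_wrt (\<ge>) \<mu> \<and> 0 \<notin> set \<mu> \<and> sum_list \<mu> = q}"

text \<open>
  The boxes of \<open>\<mu>\<close> are numbered \<open>1, \<dots>, q\<close> row by row; this is the tableau from which the
  Young symmetrizer is built. Rows and columns are indexed from 0.
\<close>

definition box_label :: "nat list \<Rightarrow> nat \<Rightarrow> nat \<Rightarrow> nat" where
  "box_label \<mu> i j = sum_list (take i \<mu>) + j + 1"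

definition young_row :: "nat list \<Rightarrow> nat \<Rightarrow> nat set" where
  "young_row \<mu> i = {box_label \<mu> i j |j. i < length \<mu> \<and> j < \<mu> ! i}"

definition young_col :: "nat list \<Rightarrow> nat \<Rightarrow> nat set" where
  "young_col \<mu> j = {box_label \<mu> i j |i. i < length \<mu> \<and> j < \<mu> ! i}"

definition row_group :: "nat list \<Rightarrow> perm set" where
  "row_group \<mu> = {\<rho> \<in> Sym (sum_list \<mu>). \<forall>i. \<rho> ` young_row \<mu> i = young_row \<mu> i}"

definition col_group :: "nat list \<Rightarrow> perm set" where
  "col_group \<mu> = {\<rho> \<in> Sym (sum_list \<mu>). \<forall>j. \<rho> ` young_col \<mu> j = young_col \<mu> j}"

text \<open>
  The group algebra of \<open>S\<^sub>q\<close> consists of the complex functions vanishing outside \<open>S\<^sub>q\<close>, with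
  convolution as product.
\<close>

definition group_algebra :: "nat \<Rightarrow> (perm \<Rightarrow> complex) set" where
  "group_algebra q = {f. \<forall>\<rho>. \<rho> \<notin> Sym q \<longrightarrow> f \<rho> = 0}"

definition convolve :: "nat \<Rightarrow> (perm \<Rightarrow> complex) \<Rightarrow> (perm \<Rightarrow> complex) \<Rightarrow> perm \<Rightarrow> complex" where
  "convolve q f g = (\<lambda>\<rho>. \<Sum>\<pi>\<in>Sym q. f \<pi> * g (inv \<pi> \<circ> \<rho>))"

definition row_symmetrizer :: "nat list \<Rightarrow> perm \<Rightarrow> complex" where
  "row_symmetrizer \<mu> = (\<lambda>\<rho>. if \<rho> \<in> row_group \<mu> then 1 else 0)"

definition col_antisymmetrizer :: "nat list \<Rightarrow> perm \<Rightarrow> complex" where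
  "col_antisymmetrizer \<mu> = (\<lambda>\<rho>. if \<rho> \<in> col_group \<mu> then of_int (sign \<rho>) else 0)"

definition young_symmetrizer :: "nat list \<Rightarrow> perm \<Rightarrow> complex" where
  "young_symmetrizer \<mu> = convolve (sum_list \<mu>) (row_symmetrizer \<mu>) (col_antisymmetrizer \<mu>)"

text \<open>
  The irreducible representation (Specht module) associated with \<open>\<mu>\<close> is the left ideal of the
  group algebra generated by the Young symmetrizer, on which \<open>S\<^sub>q\<close> acts by left
  multiplication. With this convention a single row gives the trivial representation and a single
  column the sign representation.
\<close>

definition specht_module :: "nat list \<Rightarrow> (perm \<Rightarrow> complex) set" where
  "specht_module \<mu> =
     (\<lambda>f. convolve (sum_list \<mu>) f (young_symmetrizer \<mu>)) ` group_algebra (sum_list \<mu>)"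

definition left_mult :: "perm \<Rightarrow> (perm \<Rightarrow> complex) \<Rightarrow> perm \<Rightarrow> complex" where
  "left_mult \<rho> f = (\<lambda>\<pi>. f (inv \<rho> \<circ> \<pi>))"

definition fun_scale :: "complex \<Rightarrow> (perm \<Rightarrow> complex) \<Rightarrow> perm \<Rightarrow> complex" where
  "fun_scale a f = (\<lambda>\<rho>. a * f \<rho>)"

interpretation cfun: vector_space fun_scale
  by unfold_locales (auto simp: fun_scale_def algebra_simps)

text \<open>
  The trace of an operator mapping a finite-dimensional subspace \<open>V\<close> to itself, computed in an
  arbitrarily chosen basis of \<open>V\<close>.
\<close>

definition trace_on ::
    "(perm \<Rightarrow> complex) set \<Rightarrow> ((perm \<Rightarrow> complex) \<Rightarrow> perm \<Rightarrow> complex) \<Rightarrow> complex" where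
  "trace_on V T =
     (let B = (SOME B. cfun.independent B \<and> cfun.span B = V)
      in \<Sum>b\<in>B. cfun.representation B (T b) b)"

definition irr_char :: "nat list \<Rightarrow> perm \<Rightarrow> complex" where
  "irr_char \<mu> \<rho> = trace_on (specht_module \<mu>) (left_mult \<rho>)"

definition norm_char :: "nat list \<Rightarrow> perm \<Rightarrow> complex" where
  "norm_char \<mu> \<rho> = irr_char \<mu> \<rho> / irr_char \<mu> id"

definition central_fun :: "nat \<Rightarrow> (perm \<Rightarrow> complex) \<Rightarrow> bool" where
  "central_fun q \<psi> \<longleftrightarrow> (\<forall>\<rho>\<in>Sym q. \<forall>\<pi>\<in>Sym q. \<psi> (\<pi> \<circ> \<rho> \<circ> inv \<pi>) = \<psi> \<rho>)"

definition pos_def_fun :: "nat \<Rightarrow> (perm \<Rightarrow> complex) \<Rightarrow> bool" where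
  "pos_def_fun q \<psi> \<longleftrightarrow>
     (\<forall>z :: perm \<Rightarrow> complex.
        (\<Sum>\<rho>\<in>Sym q. \<Sum>\<sigma>\<in>Sym q. z \<rho> * cnj (z \<sigma>) * \<psi> (inv \<sigma> \<circ> \<rho>)) \<in> \<real>\<^sub>\<ge>\<^sub>0)"

text \<open>
  The probability measure \<open>\<Pi>\<^sub>\<psi>\<close> on Young diagrams with \<open>q\<close> boxes: its weights are the
  coefficients of the unique expansion of \<open>\<psi>\<close> as a convex combination of normalized irreducible
  characters. Meaningful for \<open>\<psi>\<close> central, positive definite and normalized.
\<close>

definition young_measure :: "nat \<Rightarrow> (perm \<Rightarrow> complex) \<Rightarrow> nat list pmf" where
  "young_measure q \<psi> =
     (THE M. set_pmf M \<subseteq> young_diagrams q \<and>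
        (\<forall>\<rho>\<in>Sym q. \<psi> \<rho> = (\<Sum>\<mu>\<in>young_diagrams q. of_real (pmf M \<mu>) * norm_char \<mu> \<rho>)))"

definition supported_by :: "nat \<Rightarrow> (perm \<Rightarrow> complex) \<Rightarrow> real \<Rightarrow> nat list set \<Rightarrow> bool" where
  "supported_by q \<psi> \<gamma> V \<longleftrightarrow> measure_pmf.prob (young_measure q \<psi>) V > 1 - \<gamma>"

text \<open>The class \<open>\<F>\<close>, as a set of pairs \<open>(q, \<psi>)\<close> with \<open>\<psi>\<close> a function on \<open>S\<^sub>q\<close>.\<close>

definition class_F :: "nat \<Rightarrow> (nat \<Rightarrow> real) \<Rightarrow> real \<Rightarrow> (nat \<times> (perm \<Rightarrow> complex)) set" where
  "class_F n c \<delta> = {(q, \<psi>). q \<ge> 1 \<and>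
     central_fun q \<psi> \<and> pos_def_fun q \<psi> \<and> \<psi> id = 1 \<and>
     (\<forall>l\<in>{1..n}. \<forall>\<rho>\<in>Sym q. perm_length q \<rho> = l \<longrightarrow>
        norm (\<psi> \<rho>) \<le> c l * real q powr (- real l / 2)) \<and>
     (\<forall>l\<le>n. \<forall>\<rho>\<in>Sym q. \<forall>\<sigma>\<in>Sym q.
        perm_support \<rho> \<inter> perm_support \<sigma> = {} \<longrightarrow> perm_length q (\<rho> \<circ> \<sigma>) = l \<longrightarrow>
        norm (\<psi> (\<rho> \<circ> \<sigma>) - \<psi> \<rho> * \<psi> \<sigma>) \<le> \<delta> * real q powr (- real l / 2))}"

end

theory Submission
  imports Defs
begin

text \<open>
  Concentration follows from Chebyshev's inequality for \<open>\<chi>\<^sub>\<lambda>(\<rho>)\<close> under the measure \<open>\<Pi>\<^sub>\<psi>\<close>. Its mean is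
  \<open>\<psi>(\<rho>)\<close>, and since \<open>\<chi>\<^sub>\<lambda>(\<rho>)\<^sup>2\<close> is the average of \<open>\<chi>\<^sub>\<lambda>(\<pi>\<rho>\<pi>\<inverse>\<rho>)\<close> over \<open>\<pi>\<close>, its variance is the
  average of \<open>\<psi>(\<pi>\<rho>\<pi>\<inverse>\<rho>) - \<psi>(\<rho>)\<^sup>2\<close>. When \<open>\<pi>\<rho>\<pi>\<inverse>\<close> and \<open>\<rho>\<close> have disjoint supports, condition (2)
  bounds the difference by \<open>\<delta> q\<^sup>-\<^sup>l\<close>. When the supports share \<open>m \<ge> 1\<close> points, which has probability
  \<open>O(q\<^sup>-\<^sup>m)\<close>, the product has length at least \<open>2l - 2(m - 1)\<close>, so condition (1) bounds the
  contribution by \<open>O(q\<^sup>-\<^sup>l\<^sup>-\<^sup>1)\<close>. A union bound over the finitely many conjugacy classes with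
  \<open>l \<le> n/2\<close>, all of which meet \<open>S\<^sub>n\<close>, finishes the argument.

  The normalized character of the Specht module is the class average of the Young symmetrizer \<open>c\<close>:
  the trace of left multiplication on the left ideal of \<open>c\<close> is that of an operator on the whole
  group algebra because \<open>c\<^sup>2\<close> is a nonzero multiple of \<open>c\<close>. Multiplicativity and
  orthogonality of these averages come from the fact that a function invariant under the row group
  and alternating under the column group is a multiple of \<open>c\<close>.
\<close>

section \<open>Sums over the symmetric group\<close>

text \<open>The statement speaks of a trace in a basis picked by \<open>SOME\<close> and of a
  measure picked by \<open>THE\<close>. Both choices must be eliminated before any estimate can
  start: a closed formula for the normalized character removes the first, existence and uniqueness
  of the expansion of a central function remove the second.

  Origin of the exponents: the second moment is O((\<delta> + 1/q) q^(-l)), while the squared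
  threshold is K^2 (\<delta> + 1/q)^(1/2) q^(-l). Each class therefore fails with probability
  O((\<delta> + 1/q)^(1/2)), which explains the powers 1/4 and 1/2. The range l <= n/2 is forced
  because a product of two permutations of length l can have length 2l, and the hypotheses reach
  only up to n.

  Overlaps are not treated one size at a time. An overlap of m points costs a factor q^m in the
  bound on \<psi>, and the average of q^m over all conjugating permutations is bounded independently
  of q.\<close>

lemma Sym_permutes: "\<pi> \<in> Sym q \<Longrightarrow> \<pi> permutes {1..q}"
  by (simp add: Sym_def)

lemma id_in_Sym [simp]: "id \<in> Sym q" "(\<lambda>x. x) \<in> Sym q"
  by (simp_all add: Sym_def permutes_id flip: id_def)

lemma comp_in_Sym [simp]: "\<pi> \<in> Sym q \<Longrightarrow> \<sigma> \<in> Sym q \<Longrightarrow> \<pi> \<circ> \<sigma> \<in> Sym q"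
  by (simp add: Sym_def permutes_compose)

lemma inv_in_Sym [simp]: "\<pi> \<in> Sym q \<Longrightarrow> inv \<pi> \<in> Sym q"
  by (simp add: Sym_def permutes_inv)

lemma finite_Sym [simp]: "finite (Sym q)"
  by (simp add: Sym_def finite_permutations)

lemma card_Sym: "card (Sym q) = fact q"
  by (simp add: Sym_def card_permutations)

lemma Sym_comp_inv:
  assumes "\<pi> \<in> Sym q"
  shows "inv \<pi> \<circ> \<pi> = id" "\<pi> \<circ> inv \<pi> = id" "inv (inv \<pi>) = \<pi>"
    "inv \<pi> \<circ> (\<pi> \<circ> f) = f" "\<pi> \<circ> (inv \<pi> \<circ> f) = f"
proof -
  have p: "\<pi> permutes {1..q}" using assms by (rule Sym_permutes)
  show 1: "inv \<pi> \<circ> \<pi> = id" "\<pi> \<circ> inv \<pi> = id"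
    using permutes_inv_o[OF p] by auto
  show "inv (inv \<pi>) = \<pi>" using p by (rule permutes_inv_inv)
  show "inv \<pi> \<circ> (\<pi> \<circ> f) = f" "\<pi> \<circ> (inv \<pi> \<circ> f) = f"
    using 1 by (simp_all add: o_assoc)
qed

lemma Sym_inv_comp:
  "\<pi> \<in> Sym q \<Longrightarrow> \<sigma> \<in> Sym q \<Longrightarrow> inv (\<pi> \<circ> \<sigma>) = inv \<sigma> \<circ> inv \<pi>"
  by (meson Sym_permutes o_inv_distrib permutes_bij)

lemmas Sym_simps = Sym_comp_inv Sym_inv_comp comp_assoc

lemma sum_Sym_comp_left:
  assumes "\<tau> \<in> Sym q"
  shows "(\<Sum>\<pi>\<in>Sym q. f (\<tau> \<circ> \<pi>)) = (\<Sum>\<pi>\<in>Sym q. f \<pi>)"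
  by (rule sum.reindex_bij_witness[of _ "\<lambda>\<pi>. inv \<tau> \<circ> \<pi>" "\<lambda>\<pi>. \<tau> \<circ> \<pi>"])
     (use assms in \<open>auto simp: Sym_simps\<close>)

lemma sum_Sym_comp_right:
  assumes "\<tau> \<in> Sym q"
  shows "(\<Sum>\<pi>\<in>Sym q. f (\<pi> \<circ> \<tau>)) = (\<Sum>\<pi>\<in>Sym q. f \<pi>)"
  by (rule sum.reindex_bij_witness[of _ "\<lambda>\<pi>. \<pi> \<circ> inv \<tau>" "\<lambda>\<pi>. \<pi> \<circ> \<tau>"])
     (use assms in \<open>auto simp: Sym_simps\<close>)

lemma sum_Sym_inv: "(\<Sum>\<pi>\<in>Sym q. f (inv \<pi>)) = (\<Sum>\<pi>\<in>Sym q. f \<pi>)"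
  by (rule sum.reindex_bij_witness[of _ inv inv]) (auto simp: Sym_comp_inv)

lemma sum_Sym_conj:
  assumes "\<tau> \<in> Sym q"
  shows "(\<Sum>\<pi>\<in>Sym q. f (\<tau> \<circ> \<pi> \<circ> inv \<tau>)) = (\<Sum>\<pi>\<in>Sym q. f \<pi>)"
  using sum_Sym_comp_left[OF assms, of "\<lambda>\<pi>. f (\<pi> \<circ> inv \<tau>)"]
    sum_Sym_comp_right[of "inv \<tau>" q f] assms by simp

text \<open>The projection onto class functions, normalized so that a central function is reproduced
  on \<open>Sym q\<close>.\<close>

definition conj_avg :: "nat \<Rightarrow> (perm \<Rightarrow> complex) \<Rightarrow> perm \<Rightarrow> complex" where
  "conj_avg q f \<rho> = (\<Sum>\<pi>\<in>Sym q. f (\<pi> \<circ> \<rho> \<circ> inv \<pi>)) / fact q"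

lemma conj_avg_conj:
  assumes "\<tau> \<in> Sym q" "\<rho> \<in> Sym q"
  shows "conj_avg q f (\<tau> \<circ> \<rho> \<circ> inv \<tau>) = conj_avg q f \<rho>"
  using sum_Sym_comp_right[OF assms(1), of "\<lambda>\<pi>. f (\<pi> \<circ> \<rho> \<circ> inv \<pi>)"] assms
  by (simp add: conj_avg_def Sym_simps cong: sum.cong)

lemma central_conj_avg: "central_fun q (conj_avg q f)"
  by (simp add: central_fun_def conj_avg_conj)

section \<open>Row and column groups of a tableau\<close>

definition boxes :: "nat list \<Rightarrow> (nat \<times> nat) set" where
  "boxes \<mu> = {(i, j). i < length \<mu> \<and> j < \<mu> ! i}"

lemma boxes_Cons:
  "boxes (m # \<mu>) = Pair 0 ` {..<m} \<union> (\<lambda>(i, j). (Suc i, j)) ` boxes \<mu>"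
proof (intro set_eqI iffI)
  fix x assume x: "x \<in> boxes (m # \<mu>)"
  obtain i j where [simp]: "x = (i, j)" by force
  show "x \<in> Pair 0 ` {..<m} \<union> (\<lambda>(i, j). (Suc i, j)) ` boxes \<mu>"
    using x by (cases i) (force simp: boxes_def)+
qed (auto simp: boxes_def)

lemma box_label_Cons [simp]:
  "box_label (m # \<mu>) 0 j = Suc j" "box_label (m # \<mu>) (Suc i) j = m + box_label \<mu> i j"
  by (simp_all add: box_label_def)

text \<open>Induction on the list of rows: a new first row takes the labels 1..m and shifts all
  later labels by m.\<close>

lemma bij_betw_box_label:
  "bij_betw (\<lambda>(i, j). box_label \<mu> i j) (boxes \<mu>) {1..sum_list \<mu>}"
proof (induction \<mu>)
  case Nil
  then show ?case by (simp add: boxes_def bij_betw_def)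
next
  case (Cons m \<mu>)
  have 1: "bij_betw (\<lambda>(i, j). box_label (m # \<mu>) i j) (Pair 0 ` {..<m}) {1..m}"
    by (rule bij_betw_byWitness[where f' = "\<lambda>x. (0, x - 1)"]) auto
  have "bij_betw ((\<lambda>(i, j). box_label (m # \<mu>) i j) \<circ> (\<lambda>(i, j). (Suc i, j))) (boxes \<mu>)
      {m + 1..m + sum_list \<mu>}"
  proof -
    have "(\<lambda>(i, j). box_label (m # \<mu>) i j) \<circ> (\<lambda>(i, j). (Suc i, j))
        = (+) m \<circ> (\<lambda>(i, j). box_label \<mu> i j)"
      by auto
    moreover have "bij_betw ((+) m) {1..sum_list \<mu>} {m + 1..m + sum_list \<mu>}"
      by (simp add: bij_betw_def)
    ultimately show ?thesis using Cons bij_betw_trans by metis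
  qed
  moreover have "bij_betw (\<lambda>(i, j). (Suc i, j)) (boxes \<mu>) ((\<lambda>(i, j). (Suc i, j)) ` boxes \<mu>)"
    by (rule inj_on_imp_bij_betw) (auto simp: inj_on_def)
  ultimately have 2: "bij_betw (\<lambda>(i, j). box_label (m # \<mu>) i j)
      ((\<lambda>(i, j). (Suc i, j)) ` boxes \<mu>) {m + 1..m + sum_list \<mu>}"
    using bij_betw_comp_iff by blast
  have "{1..m} \<union> {m + 1..m + sum_list \<mu>} = {1..sum_list (m # \<mu>)}" by auto
  with bij_betw_combine[OF 1 2] show ?case by (auto simp: boxes_Cons)
qed

lemma box_label_inj:
  assumes "(i, j) \<in> boxes \<mu>" "(i', j') \<in> boxes \<mu>" "box_label \<mu> i j = box_label \<mu> i' j'"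
  shows "i = i' \<and> j = j'"
  using bij_betw_box_label[of \<mu>] assms unfolding bij_betw_def inj_on_def by fastforce

lemma box_label_ex:
  assumes "x \<in> {1..sum_list \<mu>}"
  obtains i j where "(i, j) \<in> boxes \<mu>" "x = box_label \<mu> i j"
proof -
  have "x \<in> (\<lambda>(i, j). box_label \<mu> i j) ` boxes \<mu>"
    using bij_betw_box_label[of \<mu>] assms unfolding bij_betw_def by simp
  then show thesis using that by auto
qed

lemma box_label_in: "(i, j) \<in> boxes \<mu> \<Longrightarrow> box_label \<mu> i j \<in> {1..sum_list \<mu>}"
  using bij_betw_box_label[of \<mu>] unfolding bij_betw_def by blast

lemma young_row_boxes: "young_row \<mu> i = {box_label \<mu> i j |j. (i, j) \<in> boxes \<mu>}"
  by (simp add: young_row_def boxes_def)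

lemma young_col_boxes: "young_col \<mu> j = {box_label \<mu> i j |i. (i, j) \<in> boxes \<mu>}"
  by (simp add: young_col_def boxes_def)

lemma young_row_subset: "young_row \<mu> i \<subseteq> {1..sum_list \<mu>}"
  using box_label_in by (auto simp: young_row_boxes)

lemma young_col_subset: "young_col \<mu> j \<subseteq> {1..sum_list \<mu>}"
  using box_label_in by (auto simp: young_col_boxes)

lemma finite_young_row [simp]: "finite (young_row \<mu> i)"
  using young_row_subset by (rule finite_subset) simp

lemma finite_young_col [simp]: "finite (young_col \<mu> j)"
  using young_col_subset by (rule finite_subset) simp

lemma young_rowE:
  assumes "x \<in> young_row \<mu> i"
  obtains j where "(i, j) \<in> boxes \<mu>" "x = box_label \<mu> i j"
  using assms unfolding young_row_boxes by blast

lemma young_colE: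
  assumes "x \<in> young_col \<mu> j"
  obtains i where "(i, j) \<in> boxes \<mu>" "x = box_label \<mu> i j"
  using assms unfolding young_col_boxes by blast

lemma young_row_disjoint: "x \<in> young_row \<mu> i \<Longrightarrow> x \<in> young_row \<mu> i' \<Longrightarrow> i = i'"
  by (elim young_rowE) (metis box_label_inj)

lemma young_col_disjoint: "x \<in> young_col \<mu> j \<Longrightarrow> x \<in> young_col \<mu> j' \<Longrightarrow> j = j'"
  by (elim young_colE) (metis box_label_inj)

lemma young_row_col_label:
  assumes "x \<in> young_row \<mu> i" "x \<in> young_col \<mu> j"
  shows "(i, j) \<in> boxes \<mu>" "x = box_label \<mu> i j"
proof -
  from assms(1) obtain j' where 1: "(i, j') \<in> boxes \<mu>" "x = box_label \<mu> i j'" by (rule young_rowE)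
  from assms(2) obtain i' where 2: "(i', j) \<in> boxes \<mu>" "x = box_label \<mu> i' j" by (rule young_colE)
  have "i = i' \<and> j' = j" using box_label_inj[OF 1(1) 2(1)] 1(2) 2(2) by simp
  with 1 show "(i, j) \<in> boxes \<mu>" "x = box_label \<mu> i j" by simp_all
qed

lemma box_label_in_row_col:
  "(i, j) \<in> boxes \<mu> \<Longrightarrow> box_label \<mu> i j \<in> young_row \<mu> i"
  "(i, j) \<in> boxes \<mu> \<Longrightarrow> box_label \<mu> i j \<in> young_col \<mu> j"
  by (auto simp: young_row_boxes young_col_boxes)

lemma young_row_col_ex:
  assumes "x \<in> {1..sum_list \<mu>}"
  obtains i j where "(i, j) \<in> boxes \<mu>" "x \<in> young_row \<mu> i" "x \<in> young_col \<mu> j"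
proof -
  obtain i j where "(i, j) \<in> boxes \<mu>" "x = box_label \<mu> i j"
    using assms by (rule box_label_ex)
  then show thesis using that[of i j] box_label_in_row_col by simp
qed

lemma sum_list_young_diagram: "\<mu> \<in> young_diagrams q \<Longrightarrow> sum_list \<mu> = q"
  by (simp add: young_diagrams_def)

lemma row_group_Sym: "p \<in> row_group \<mu> \<Longrightarrow> p \<in> Sym (sum_list \<mu>)"
  by (simp add: row_group_def)

lemma col_group_Sym: "p \<in> col_group \<mu> \<Longrightarrow> p \<in> Sym (sum_list \<mu>)"
  by (simp add: col_group_def)

lemma id_in_row_col_group [simp]: "id \<in> row_group \<mu>" "id \<in> col_group \<mu>"
  by (simp_all add: row_group_def col_group_def)

lemma row_group_comp [simp]: "p \<in> row_group \<mu> \<Longrightarrow> r \<in> row_group \<mu> \<Longrightarrow> p \<circ> r \<in> row_group \<mu>"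
  using comp_in_Sym unfolding row_group_def by (simp add: image_image[symmetric])

lemma col_group_comp [simp]: "p \<in> col_group \<mu> \<Longrightarrow> r \<in> col_group \<mu> \<Longrightarrow> p \<circ> r \<in> col_group \<mu>"
  using comp_in_Sym unfolding col_group_def by (simp add: image_image[symmetric])

lemma Sym_image_inv: "p \<in> Sym q \<Longrightarrow> p ` A = A \<Longrightarrow> inv p ` A = A"
  using image_comp[of "inv p" p A] by (simp add: Sym_comp_inv(1))

lemma row_group_inv [simp]:
  assumes "p \<in> row_group \<mu>"
  shows "inv p \<in> row_group \<mu>"
proof -
  have p: "p \<in> Sym (sum_list \<mu>)" "p ` young_row \<mu> i = young_row \<mu> i" for i
    using assms by (simp_all only: row_group_def mem_Collect_eq simp_thms)
  show ?thesis
    using Sym_image_inv[OF p(1) p(2)] p(1) by (simp add: row_group_def)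
qed

lemma col_group_inv [simp]:
  assumes "p \<in> col_group \<mu>"
  shows "inv p \<in> col_group \<mu>"
proof -
  have p: "p \<in> Sym (sum_list \<mu>)" "p ` young_col \<mu> i = young_col \<mu> i" for i
    using assms by (simp_all only: col_group_def mem_Collect_eq simp_thms)
  show ?thesis
    using Sym_image_inv[OF p(1) p(2)] p(1) by (simp add: col_group_def)
qed

text \<open>The row and the column of a point determine the point, and both are preserved. This is
  what normalizes the symmetrizer to 1 at the identity.\<close>

lemma row_col_group_trivial:
  assumes "p \<in> row_group \<mu>" "p \<in> col_group \<mu>"
  shows "p = id"
proof
  fix x
  have p: "p permutes {1..sum_list \<mu>}" by (intro Sym_permutes row_group_Sym assms)
  show "p x = id x"
  proof (cases "x \<in> {1..sum_list \<mu>}")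
    case True
    then obtain i j where ij: "x \<in> young_row \<mu> i" "x \<in> young_col \<mu> j"
      by (rule young_row_col_ex)
    moreover have "p ` young_row \<mu> i = young_row \<mu> i" "p ` young_col \<mu> j = young_col \<mu> j"
      using assms by (simp_all add: row_group_def col_group_def)
    ultimately have "p x \<in> young_row \<mu> i" "p x \<in> young_col \<mu> j"
      by (metis imageI)+
    with ij show ?thesis using young_row_col_label(2) by (metis id_apply)
  next
    case False
    then show ?thesis using p by (simp add: permutes_not_in)
  qed
qed

lemma transpose_in_Sym:
  "x \<in> {1..q} \<Longrightarrow> y \<in> {1..q} \<Longrightarrow> Transposition.transpose x y \<in> Sym q"
  unfolding Sym_def by (simp only: permutes_swap_id mem_Collect_eq)

lemma transpose_in_row_group:
  assumes "x \<in> young_row \<mu> i" "y \<in> young_row \<mu> i"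
  shows "Transposition.transpose x y \<in> row_group \<mu>"
proof -
  have "x \<in> {1..sum_list \<mu>}" "y \<in> {1..sum_list \<mu>}" using assms young_row_subset by blast+
  moreover have "Transposition.transpose x y ` young_row \<mu> i' = young_row \<mu> i'" for i'
  proof (cases "i' = i")
    case False
    then have "x \<notin> young_row \<mu> i'" "y \<notin> young_row \<mu> i'" using assms young_row_disjoint by blast+
    then show ?thesis by simp
  qed (use assms in simp)
  ultimately show ?thesis
    by (simp only: row_group_def transpose_in_Sym mem_Collect_eq simp_thms)
qed

lemma transpose_in_col_group:
  assumes "x \<in> young_col \<mu> j" "y \<in> young_col \<mu> j"
  shows "Transposition.transpose x y \<in> col_group \<mu>"
proof -
  have "x \<in> {1..sum_list \<mu>}" "y \<in> {1..sum_list \<mu>}" using assms young_col_subset by blast+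
  moreover have "Transposition.transpose x y ` young_col \<mu> j' = young_col \<mu> j'" for j'
  proof (cases "j' = j")
    case False
    then have "x \<notin> young_col \<mu> j'" "y \<notin> young_col \<mu> j'" using assms young_col_disjoint by blast+
    then show ?thesis by simp
  qed (use assms in simp)
  ultimately show ?thesis
    by (simp only: col_group_def transpose_in_Sym mem_Collect_eq simp_thms)
qed

section \<open>Column heights, dominance, and the combinatorics of two tableaux\<close>

definition col_height :: "nat list \<Rightarrow> nat \<Rightarrow> nat" where
  "col_height \<mu> j = card {i. (i, j) \<in> boxes \<mu>}"

lemma finite_boxes_col [simp]: "finite {i. (i, j) \<in> boxes \<mu>}"
  by (rule finite_subset[of _ "{..<length \<mu>}"]) (auto simp: boxes_def)

lemma card_young_row: "card (young_row \<mu> i) = (if i < length \<mu> then \<mu> ! i else 0)"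
proof (cases "i < length \<mu>")
  case True
  have "young_row \<mu> i = box_label \<mu> i ` {..<\<mu> ! i}"
    using True by (auto simp: young_row_def)
  moreover have "inj_on (box_label \<mu> i) {..<\<mu> ! i}"
    by (auto simp: inj_on_def box_label_def)
  ultimately show ?thesis using True by (simp add: card_image)
qed (simp add: young_row_def)

lemma card_young_col: "card (young_col \<mu> j) = col_height \<mu> j"
proof -
  have "young_col \<mu> j = (\<lambda>i. box_label \<mu> i j) ` {i. (i, j) \<in> boxes \<mu>}"
    by (auto simp: young_col_boxes)
  moreover have "inj_on (\<lambda>i. box_label \<mu> i j) {i. (i, j) \<in> boxes \<mu>}"
    by (rule inj_onI) (metis box_label_inj mem_Collect_eq)
  ultimately show ?thesis by (simp add: card_image col_height_def)
qed

lemma young_diagram_antimono: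
  assumes "\<mu> \<in> young_diagrams q" "i \<le> i'" "i' < length \<mu>"
  shows "\<mu> ! i' \<le> \<mu> ! i"
proof (cases "i = i'")
  case False
  then show ?thesis
    using assms by (auto simp: young_diagrams_def sorted_wrt_iff_nth_less)
qed simp

text \<open>Weakly decreasing rows make every column an initial segment of row indices, so a column
  is known from its height. The heights are the parts of the conjugate partition.\<close>

lemma boxes_iff_col_height:
  assumes "\<mu> \<in> young_diagrams q"
  shows "(i, j) \<in> boxes \<mu> \<longleftrightarrow> i < col_height \<mu> j"
proof -
  have down: "i' \<in> {i. (i, j) \<in> boxes \<mu>}" if "i \<in> {i. (i, j) \<in> boxes \<mu>}" "i' \<le> i" for i i'
    using that young_diagram_antimono[OF assms that(2)] by (auto simp: boxes_def)
  have "{i. (i, j) \<in> boxes \<mu>} = {..<col_height \<mu> j}"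
  proof (cases "{i. (i, j) \<in> boxes \<mu>} = {}")
    case False
    define M where "M = Max {i. (i, j) \<in> boxes \<mu>}"
    have M: "M \<in> {i. (i, j) \<in> boxes \<mu>}" unfolding M_def using False by (intro Max_in) auto
    have "{i. (i, j) \<in> boxes \<mu>} = {..M}"
    proof (rule set_eqI, rule iffI)
      fix i assume "i \<in> {i. (i, j) \<in> boxes \<mu>}"
      then show "i \<in> {..M}" unfolding M_def by (simp add: Max_ge)
    next
      fix i assume "i \<in> {..M}"
      then show "i \<in> {i. (i, j) \<in> boxes \<mu>}" using down[OF M] by simp
    qed
    moreover from this have "col_height \<mu> j = Suc M" by (simp add: col_height_def)
    ultimately show ?thesis by (simp add: lessThan_Suc_atMost)
  qed (simp add: col_height_def)
  then show ?thesis by blast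
qed

lemma sum_list_take: "sum_list (take k \<mu>) = (\<Sum>i<k. if i < length \<mu> then \<mu> ! i else (0::nat))"
proof -
  have "sum_list (take k \<mu>) = (\<Sum>i<min k (length \<mu>). \<mu> ! i)"
    by (simp add: sum_list_sum_nth atLeast0LessThan min.commute)
  also have "\<dots> = (\<Sum>i<k. if i < length \<mu> then \<mu> ! i else 0)"
    by (rule sum.mono_neutral_cong_left) auto
  finally show ?thesis .
qed

definition top_rows :: "nat list \<Rightarrow> nat \<Rightarrow> nat set" where
  "top_rows \<mu> k = (\<Union>i<k. young_row \<mu> i)"

lemma top_rows_subset: "top_rows \<mu> k \<subseteq> {1..sum_list \<mu>}"
  using young_row_subset unfolding top_rows_def by blast

lemma finite_top_rows [simp]: "finite (top_rows \<mu> k)"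
  by (simp add: top_rows_def)

lemma top_rows_Suc: "top_rows \<mu> (Suc k) = top_rows \<mu> k \<union> young_row \<mu> k"
  by (auto simp: top_rows_def less_Suc_eq)

lemma card_top_rows: "card (top_rows \<mu> k) = sum_list (take k \<mu>)"
  unfolding top_rows_def sum_list_take
  by (subst card_UN_disjoint) (auto simp: card_young_row dest: young_row_disjoint)

text \<open>Double counting of the boxes in the first k rows. Columns j < q suffice since no row is
  longer than q.\<close>

lemma sum_min_col_height:
  assumes "\<mu> \<in> young_diagrams q"
  shows "(\<Sum>j<q. min k (col_height \<mu> j)) = sum_list (take k \<mu>)"
proof -
  have "(\<Sum>j<q. min k (col_height \<mu> j)) = (\<Sum>j<q. \<Sum>i<k. of_bool ((i, j) \<in> boxes \<mu>))"
  proof (rule sum.cong)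
    fix j
    have "(\<Sum>i<k. of_bool ((i, j) \<in> boxes \<mu>) :: nat) = card ({..<k} \<inter> {i. (i, j) \<in> boxes \<mu>})"
      by simp
    also have "{..<k} \<inter> {i. (i, j) \<in> boxes \<mu>} = {..<min k (col_height \<mu> j)}"
      by (auto simp: boxes_iff_col_height[OF assms])
    finally show "min k (col_height \<mu> j) = (\<Sum>i<k. of_bool ((i, j) \<in> boxes \<mu>))" by simp
  qed simp
  also have "\<dots> = (\<Sum>i<k. \<Sum>j<q. of_bool ((i, j) \<in> boxes \<mu>))" by (rule sum.swap)
  also have "\<dots> = (\<Sum>i<k. if i < length \<mu> then \<mu> ! i else 0)"
  proof (rule sum.cong)
    fix i
    show "(\<Sum>j<q. of_bool ((i, j) \<in> boxes \<mu>)) = (if i < length \<mu> then \<mu> ! i else 0)"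
    proof (cases "i < length \<mu>")
      case True
      then have "\<mu> ! i \<le> q"
        using member_le_sum_list[of "\<mu> ! i" \<mu>] assms by (simp add: young_diagrams_def)
      then have "{..<q} \<inter> {j. (i, j) \<in> boxes \<mu>} = {..<\<mu> ! i}" using True by (auto simp: boxes_def)
      then show ?thesis using True by simp
    qed (simp add: boxes_def)
  qed simp
  finally show ?thesis by (simp add: sum_list_take)
qed

text \<open>The hypothesis of von Neumann's lemma for the tableau of \<mu> and the g-translate of
  the tableau of \<nu>. Its failure produces a transposition that kills every row invariant, column
  alternating function at g.\<close>

definition row_col_separated :: "nat list \<Rightarrow> nat list \<Rightarrow> perm \<Rightarrow> bool" where
  "row_col_separated \<mu> \<nu> g \<longleftrightarrow> (\<forall>i j x y. x \<in> young_row \<mu> i \<longrightarrow> y \<in> young_row \<mu> i \<longrightarrow>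
     x \<in> g ` young_col \<nu> j \<longrightarrow> y \<in> g ` young_col \<nu> j \<longrightarrow> x = y)"

lemma card_row_col_separated:
  assumes "row_col_separated \<mu> \<nu> g"
  shows "card (young_row \<mu> i \<inter> g ` young_col \<nu> j) \<le> 1"
proof (rule ccontr)
  assume "\<not> ?thesis"
  then have "\<exists>x y. x \<in> young_row \<mu> i \<inter> g ` young_col \<nu> j \<and> y \<in> young_row \<mu> i \<inter> g ` young_col \<nu> j \<and> x \<noteq> y"
    by (metis One_nat_def card_le_Suc0_iff_eq finite_Int finite_young_row)
  with assms show False unfolding row_col_separated_def by blast
qed

text \<open>Separation allows one point from each of the k rows, and the column has only
  \<open>col_height\<close> points in all.\<close>

lemma card_top_rows_col_le:
  assumes "row_col_separated \<mu> \<nu> g"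
  shows "card (top_rows \<mu> k \<inter> g ` young_col \<nu> j) \<le> min k (col_height \<nu> j)"
proof -
  have "card (top_rows \<mu> k \<inter> g ` young_col \<nu> j) = card (\<Union>i<k. young_row \<mu> i \<inter> g ` young_col \<nu> j)"
    by (simp add: top_rows_def)
  also have "\<dots> \<le> (\<Sum>i<k. card (young_row \<mu> i \<inter> g ` young_col \<nu> j))" by (rule card_UN_le) simp
  also have "\<dots> \<le> (\<Sum>i<k. 1)" by (intro sum_mono card_row_col_separated[OF assms])
  finally have 1: "card (top_rows \<mu> k \<inter> g ` young_col \<nu> j) \<le> k" by simp
  have "card (top_rows \<mu> k \<inter> g ` young_col \<nu> j) \<le> card (g ` young_col \<nu> j)"
    by (intro card_mono) auto
  also have "\<dots> \<le> col_height \<nu> j"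
    using card_image_le[OF finite_young_col] by (simp add: card_young_col)
  finally show ?thesis using 1 by simp
qed

text \<open>The translated columns partition {1..q}, so counting the top rows column by column loses
  nothing.\<close>

lemma sum_card_top_rows_col:
  assumes "\<mu> \<in> young_diagrams q" "\<nu> \<in> young_diagrams q" "g \<in> Sym q"
  shows "(\<Sum>j<q. card (top_rows \<mu> k \<inter> g ` young_col \<nu> j)) = sum_list (take k \<mu>)"
proof -
  have inj: "inj g" using assms(3) Sym_permutes permutes_inj by blast
  have "(\<Sum>j<q. card (top_rows \<mu> k \<inter> g ` young_col \<nu> j))
      = card (\<Union>j<q. top_rows \<mu> k \<inter> g ` young_col \<nu> j)"
  proof (rule card_UN_disjoint[symmetric])
    have "\<forall>x. \<not> (x \<in> g ` young_col \<nu> j \<and> x \<in> g ` young_col \<nu> j')" if "j \<noteq> j'" for j j'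
      using young_col_disjoint that injD[OF inj] by (metis imageE)
    then show "\<forall>i\<in>{..<q}. \<forall>j\<in>{..<q}. i \<noteq> j \<longrightarrow>
        top_rows \<mu> k \<inter> g ` young_col \<nu> i \<inter> (top_rows \<mu> k \<inter> g ` young_col \<nu> j) = {}"
      by blast
  qed auto
  also have "(\<Union>j<q. top_rows \<mu> k \<inter> g ` young_col \<nu> j) = top_rows \<mu> k"
  proof
    show "top_rows \<mu> k \<subseteq> (\<Union>j<q. top_rows \<mu> k \<inter> g ` young_col \<nu> j)"
    proof
      fix x assume x: "x \<in> top_rows \<mu> k"
      then have "x \<in> {1..q}" using top_rows_subset[of \<mu> k] assms(1) by (auto simp: sum_list_young_diagram)
      then have "x \<in> g ` {1..q}"
        using assms(3) Sym_permutes permutes_image by metis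
      then obtain y where y: "y \<in> {1..q}" "x = g y" by blast
      then have "y \<in> {1..sum_list \<nu>}" using assms(2) by (simp add: sum_list_young_diagram)
      then obtain i j where ij: "(i, j) \<in> boxes \<nu>" "y \<in> young_col \<nu> j" by (rule young_row_col_ex)
      then have "j < q"
        using member_le_sum_list[of "\<nu> ! i" \<nu>] assms(2) by (auto simp: young_diagrams_def boxes_def)
      then show "x \<in> (\<Union>j<q. top_rows \<mu> k \<inter> g ` young_col \<nu> j)" using x y ij by blast
    qed
  qed blast
  finally show ?thesis by (simp add: card_top_rows)
qed

text \<open>Dominance order. \<open>take k\<close> past the end of a list returns the whole list, so
  diagrams with different numbers of rows are compared without padding.\<close>

definition dominated :: "nat list \<Rightarrow> nat list \<Rightarrow> bool" where
  "dominated \<mu> \<nu> \<longleftrightarrow> (\<forall>k. sum_list (take k \<mu>) \<le> sum_list (take k \<nu>))"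

text \<open>Equal partial sums give equal parts; parts 0 are excluded because trailing zeros would
  be invisible to partial sums.\<close>

lemma dominated_antisym:
  assumes "0 \<notin> set \<mu>" "0 \<notin> set \<nu>" "dominated \<mu> \<nu>" "dominated \<nu> \<mu>"
  shows "\<mu> = \<nu>"
proof -
  have "\<forall>k. sum_list (take k \<mu>) = sum_list (take k \<nu>)"
    using assms(3,4) by (auto simp: dominated_def intro: antisym)
  then show ?thesis using assms(1,2)
  proof (induction \<mu> arbitrary: \<nu>)
    case Nil
    have "sum_list \<nu> = 0" using Nil(1)[rule_format, of "length \<nu>"] by simp
    then show ?case using Nil(3) by (cases \<nu>) auto
  next
    case (Cons m \<mu>)
    obtain n \<nu>' where \<nu>: "\<nu> = n # \<nu>'"
      using Cons.prems(1)[rule_format, of "1"] Cons.prems(2) by (cases \<nu>) auto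
    have "m = n" using Cons.prems(1)[rule_format, of "1"] \<nu> by simp
    moreover have "\<forall>k. sum_list (take k \<mu>) = sum_list (take k \<nu>')"
    proof
      fix k
      show "sum_list (take k \<mu>) = sum_list (take k \<nu>')"
        using Cons.prems(1)[rule_format, of "Suc k"] \<nu> \<open>m = n\<close> by simp
    qed
    ultimately show ?case using Cons.IH[of \<nu>'] Cons.prems \<nu> by simp
  qed
qed

text \<open>Count the first k rows of \<mu> along the translated columns of \<nu>: column j holds at
  most min k (height) of these points, and the bounds add up to the size of the first k rows of
  \<nu>.\<close>

lemma row_col_separated_dominated:
  assumes "\<mu> \<in> young_diagrams q" "\<nu> \<in> young_diagrams q" "g \<in> Sym q"
    and "row_col_separated \<mu> \<nu> g"
  shows "dominated \<mu> \<nu>"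
  unfolding dominated_def
proof
  fix k
  show "sum_list (take k \<mu>) \<le> sum_list (take k \<nu>)"
    using sum_mono[of "{..<q}" "\<lambda>j. card (top_rows \<mu> k \<inter> g ` young_col \<nu> j)" "\<lambda>j. min k (col_height \<nu> j)"]
      card_top_rows_col_le[OF assms(4)] sum_card_top_rows_col[OF assms(1-3)]
      sum_min_col_height[OF assms(2)] by simp
qed

text \<open>For a single diagram the counting bound is an equality in every column, so row i meets
  the translated column j in exactly one point for each box (i, j). Sending box (i, j) to that point
  defines the row element p. It carries column j onto its g-translate, hence
  \<open>inv p \<circ> g\<close> preserves columns.\<close>

lemma row_col_separated_decomp:
  assumes \<mu>: "\<mu> \<in> young_diagrams q" and g: "g \<in> Sym q" and sep: "row_col_separated \<mu> \<mu> g"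
  obtains p k where "p \<in> row_group \<mu>" "k \<in> col_group \<mu>" "g = p \<circ> k"
proof -
  have [simp]: "sum_list \<mu> = q" using \<mu> by (rule sum_list_young_diagram)
  have inj: "inj g" using g Sym_permutes permutes_inj by blast
  \<comment> \<open>Termwise bounds with equal totals over all columns are equalities.\<close>
  have eq: "card (top_rows \<mu> k \<inter> g ` young_col \<mu> j) = min k (col_height \<mu> j)" if "j < q" for k j
    using that card_top_rows_col_le[OF sep]
    by (intro sum_mono_inv[of "\<lambda>j. card (top_rows \<mu> k \<inter> g ` young_col \<mu> j)" "{..<q}"])
       (auto simp: sum_card_top_rows_col[OF \<mu> \<mu> g] sum_min_col_height[OF \<mu>])
  \<comment> \<open>If row i missed the translated column j, adding row i would not raise the count
    from min i h to min (i + 1) h, although the height h exceeds i.\<close>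
  have meet: "\<exists>y. y \<in> young_row \<mu> i \<inter> g ` young_col \<mu> j" if "(i, j) \<in> boxes \<mu>" for i j
  proof (rule ccontr)
    assume "\<nexists>y. y \<in> young_row \<mu> i \<inter> g ` young_col \<mu> j"
    then have "top_rows \<mu> (Suc i) \<inter> g ` young_col \<mu> j = top_rows \<mu> i \<inter> g ` young_col \<mu> j"
      by (auto simp: top_rows_Suc)
    moreover have "j < q"
      using member_le_sum_list[of "\<mu> ! i" \<mu>] that by (auto simp: boxes_def)
    moreover have "i < col_height \<mu> j" using that by (simp add: boxes_iff_col_height[OF \<mu>])
    ultimately show False using eq[of j i] eq[of j "Suc i"] by simp
  qed
  have ex: "\<exists>y. \<forall>i j. x \<in> young_row \<mu> i \<longrightarrow> x \<in> young_col \<mu> j \<longrightarrow> y \<in> young_row \<mu> i \<inter> g ` young_col \<mu> j"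
    if "x \<in> {1..q}" for x
  proof -
    have "x \<in> {1..sum_list \<mu>}" using that by simp
    then obtain i j where ij: "(i, j) \<in> boxes \<mu>" "x \<in> young_row \<mu> i" "x \<in> young_col \<mu> j"
      by (rule young_row_col_ex)
    obtain y where "y \<in> young_row \<mu> i \<inter> g ` young_col \<mu> j" using meet[OF ij(1)] by blast
    then show ?thesis
      using young_row_disjoint[OF ij(2)] young_col_disjoint[OF ij(3)] by (intro exI[of _ y]) blast
  qed
  then obtain f where f: "\<And>x i j. x \<in> {1..q} \<Longrightarrow> x \<in> young_row \<mu> i \<Longrightarrow> x \<in> young_col \<mu> j \<Longrightarrow>
      f x \<in> young_row \<mu> i \<inter> g ` young_col \<mu> j"
    by metis
  define p where "p x = (if x \<in> {1..q} then f x else x)" for x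
  have p1: "p x \<in> young_row \<mu> i \<inter> g ` young_col \<mu> j" if "x \<in> young_row \<mu> i" "x \<in> young_col \<mu> j" for x i j
    using f that young_row_subset[of \<mu> i] by (auto simp: p_def)
  \<comment> \<open>A common value of p lies in one row and one translated column, so both arguments
    lie in the same row and the same column.\<close>
  have inj_p: "inj_on p {1..q}"
  proof
    fix x y assume xy: "x \<in> {1..q}" "y \<in> {1..q}" "p x = p y"
    then have "x \<in> {1..sum_list \<mu>}" "y \<in> {1..sum_list \<mu>}" by simp_all
    obtain i j where x: "x \<in> young_row \<mu> i" "x \<in> young_col \<mu> j"
      using \<open>x \<in> {1..sum_list \<mu>}\<close> by (rule young_row_col_ex)
    obtain i' j' where y: "y \<in> young_row \<mu> i'" "y \<in> young_col \<mu> j'"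
      using \<open>y \<in> {1..sum_list \<mu>}\<close> by (rule young_row_col_ex)
    have "p x \<in> young_row \<mu> i" "p x \<in> g ` young_col \<mu> j" "p x \<in> young_row \<mu> i'" "p x \<in> g ` young_col \<mu> j'"
      using p1[OF x] p1[OF y] xy(3) by auto
    moreover obtain u v where "u \<in> young_col \<mu> j" "p x = g u" "v \<in> young_col \<mu> j'" "p x = g v"
      using calculation(2,4) by (elim imageE)
    moreover from this have "u = v" using injD[OF inj] by metis
    ultimately have "i = i'" "j = j'"
      using young_row_disjoint[of "p x" \<mu> i i'] young_col_disjoint[of u \<mu> j j'] by auto
    then show "x = y"
      using young_row_col_label(2)[OF x] young_row_col_label(2)[OF y] by simp
  qed
  have "p ` {1..q} \<subseteq> {1..q}"
  proof
    fix z assume "z \<in> p ` {1..q}"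
    then obtain x where x: "x \<in> {1..sum_list \<mu>}" "z = p x" by auto
    from x(1) obtain i j where "x \<in> young_row \<mu> i" "x \<in> young_col \<mu> j" by (rule young_row_col_ex)
    then have "z \<in> young_row \<mu> i" using p1 x by blast
    then have "z \<in> {1..sum_list \<mu>}" using young_row_subset by blast
    then show "z \<in> {1..q}" by simp
  qed
  then have "bij_betw p {1..q} {1..q}"
    using inj_p by (simp add: bij_betw_def endo_inj_surj)
  then have "p permutes {1..q}" by (rule bij_imp_permutes) (auto simp: p_def)
  then have pS: "p \<in> Sym q" by (simp add: Sym_def)
  then have pinj: "inj p" using Sym_permutes permutes_inj by blast
  have "p ` young_row \<mu> i = young_row \<mu> i" for i
  proof (rule card_subset_eq)
    show "p ` young_row \<mu> i \<subseteq> young_row \<mu> i"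
    proof
      fix z assume "z \<in> p ` young_row \<mu> i"
      then obtain x where x: "x \<in> young_row \<mu> i" "z = p x" by auto
      then have "x \<in> {1..sum_list \<mu>}" using young_row_subset by blast
      then obtain i' j where "x \<in> young_row \<mu> i'" "x \<in> young_col \<mu> j" by (rule young_row_col_ex)
      then show "z \<in> young_row \<mu> i" using p1 x by blast
    qed
    show "card (p ` young_row \<mu> i) = card (young_row \<mu> i)"
      using pinj by (intro card_image) (simp add: inj_on_def)
  qed simp
  then have P: "p \<in> row_group \<mu>" using pS by (simp add: row_group_def)
  have pg: "p ` young_col \<mu> j = g ` young_col \<mu> j" for j
  proof (rule card_subset_eq)
    show "p ` young_col \<mu> j \<subseteq> g ` young_col \<mu> j"
    proof
      fix z assume "z \<in> p ` young_col \<mu> j"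
      then obtain x where x: "x \<in> young_col \<mu> j" "z = p x" by auto
      then have "x \<in> {1..sum_list \<mu>}" using young_col_subset by blast
      then obtain i j' where "x \<in> young_row \<mu> i" "x \<in> young_col \<mu> j'" by (rule young_row_col_ex)
      then show "z \<in> g ` young_col \<mu> j" using p1 x by blast
    qed
    show "card (p ` young_col \<mu> j) = card (g ` young_col \<mu> j)"
      by (simp add: card_image inj_on_subset[OF pinj] inj_on_subset[OF inj])
  qed simp
  have "(inv p \<circ> g) ` young_col \<mu> j = young_col \<mu> j" for j
    using arg_cong[OF pg[of j], of "image (inv p)"] Sym_comp_inv(1)[OF pS] by (simp add: image_comp)
  then have "inv p \<circ> g \<in> col_group \<mu>" using pS g by (simp add: col_group_def)
  moreover have "g = p \<circ> (inv p \<circ> g)" by (rule Sym_comp_inv(5)[OF pS, symmetric])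
  ultimately show thesis using that P by blast
qed

section \<open>Young symmetrizers and normalized characters\<close>

text \<open>The two symmetries of a row sum multiplied from the right by an alternating column sum;
  together they determine a function on the group up to a scalar.\<close>

definition row_invariant :: "nat list \<Rightarrow> (perm \<Rightarrow> complex) \<Rightarrow> bool" where
  "row_invariant \<mu> x \<longleftrightarrow> (\<forall>p\<in>row_group \<mu>. \<forall>\<rho>\<in>Sym (sum_list \<mu>). x (p \<circ> \<rho>) = x \<rho>)"

definition col_alternating :: "nat list \<Rightarrow> (perm \<Rightarrow> complex) \<Rightarrow> bool" where
  "col_alternating \<mu> x \<longleftrightarrow>
     (\<forall>k\<in>col_group \<mu>. \<forall>\<rho>\<in>Sym (sum_list \<mu>). x (\<rho> \<circ> k) = of_int (sign k) * x \<rho>)"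

lemma Sym_permutation: "\<pi> \<in> Sym q \<Longrightarrow> permutation \<pi>"
  using Sym_permutes by (auto simp: permutation_permutes)

lemma transpose_image_comp:
  assumes "inj g"
  shows "Transposition.transpose (g u) (g v) \<circ> g = g \<circ> Transposition.transpose u v"
proof
  fix x
  show "(Transposition.transpose (g u) (g v) \<circ> g) x = (g \<circ> Transposition.transpose u v) x"
    using injD[OF assms] by (cases "x = u \<or> x = v") (auto simp: Transposition.transpose_def)
qed

text \<open>Without separation there are u, v in one column of \<nu> whose images g u, g v share a
  row of \<mu>. Multiplying g on the left by the transposition of g u, g v is the same as
  multiplying it on the right by that of u, v. The first leaves x g unchanged, the second changes
  its sign.\<close>

lemma vanish_not_separated:
  assumes \<mu>: "\<mu> \<in> young_diagrams q" and \<nu>: "\<nu> \<in> young_diagrams q" and g: "g \<in> Sym q"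
    and x: "row_invariant \<mu> x" "col_alternating \<nu> x" and sep: "\<not> row_col_separated \<mu> \<nu> g"
  shows "x g = 0"
proof -
  have [simp]: "sum_list \<mu> = q" "sum_list \<nu> = q" using \<mu> \<nu> by (simp_all add: sum_list_young_diagram)
  from sep obtain i j y z where yz: "y \<in> young_row \<mu> i" "z \<in> young_row \<mu> i"
      "y \<in> g ` young_col \<nu> j" "z \<in> g ` young_col \<nu> j" "y \<noteq> z"
    unfolding row_col_separated_def not_all not_imp by (elim exE conjE)
  from yz(3) obtain u where u: "y = g u" "u \<in> young_col \<nu> j" by (rule imageE)
  from yz(4) obtain v where v: "z = g v" "v \<in> young_col \<nu> j" by (rule imageE)
  from yz u v have uv: "g u \<in> young_row \<mu> i" "g v \<in> young_row \<mu> i"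
      "u \<in> young_col \<nu> j" "v \<in> young_col \<nu> j" "g u \<noteq> g v"
    by simp_all
  have "inj g" using g Sym_permutes permutes_inj by blast
  have "x g = x (Transposition.transpose (g u) (g v) \<circ> g)"
    using x(1) transpose_in_row_group[OF uv(1,2)] g unfolding row_invariant_def by simp
  also have "\<dots> = x (g \<circ> Transposition.transpose u v)"
    by (simp only: transpose_image_comp[OF \<open>inj g\<close>])
  also have "\<dots> = - x g"
    using x(2) transpose_in_col_group[OF uv(3,4)] g uv(5) unfolding col_alternating_def
    by (auto simp: sign_swap_id)
  finally show ?thesis by simp
qed

lemma row_invariant_col_alternating_eq_0:
  assumes "\<mu> \<in> young_diagrams q" "\<nu> \<in> young_diagrams q" "g \<in> Sym q"
    and "row_invariant \<mu> x" "col_alternating \<nu> x" "\<not> dominated \<mu> \<nu>"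
  shows "x g = 0"
  using assms row_col_separated_dominated vanish_not_separated by blast

lemma young_symmetrizer_eq:
  assumes "\<mu> \<in> young_diagrams q"
  shows "young_symmetrizer \<mu> \<rho>
    = (\<Sum>\<pi>\<in>Sym q. row_symmetrizer \<mu> \<pi> * col_antisymmetrizer \<mu> (inv \<pi> \<circ> \<rho>))"
  using assms by (simp add: young_symmetrizer_def convolve_def sum_list_young_diagram)

lemma row_symmetrizer_comp:
  assumes "p \<in> row_group \<mu>" "\<pi> \<in> Sym (sum_list \<mu>)"
  shows "row_symmetrizer \<mu> (p \<circ> \<pi>) = row_symmetrizer \<mu> \<pi>"
proof -
  have "\<pi> \<in> row_group \<mu>" if "p \<circ> \<pi> \<in> row_group \<mu>"
    using row_group_comp[OF row_group_inv[OF assms(1)] that] row_group_Sym[OF assms(1)]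
    by (simp add: Sym_simps)
  then show ?thesis using row_group_comp[OF assms(1), of \<pi>] unfolding row_symmetrizer_def by auto
qed

lemma col_antisymmetrizer_comp:
  assumes "k \<in> col_group \<mu>" "\<pi> \<in> Sym (sum_list \<mu>)"
  shows "col_antisymmetrizer \<mu> (\<pi> \<circ> k) = of_int (sign k) * col_antisymmetrizer \<mu> \<pi>"
proof -
  have "\<pi> \<in> col_group \<mu>" if "\<pi> \<circ> k \<in> col_group \<mu>"
    using col_group_comp[OF that col_group_inv[OF assms(1)]] col_group_Sym[OF assms(1)]
    by (simp add: Sym_simps)
  moreover have "sign (\<pi> \<circ> k) = sign k * sign \<pi>"
    using sign_compose[OF Sym_permutation[OF assms(2)] Sym_permutation[OF col_group_Sym[OF assms(1)]]] by simp
  moreover have "\<pi> \<circ> k \<in> col_group \<mu>" if "\<pi> \<in> col_group \<mu>"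
    using that assms(1) by (rule col_group_comp)
  ultimately show ?thesis
    by (cases "\<pi> \<in> col_group \<mu>"; cases "\<pi> \<circ> k \<in> col_group \<mu>") (simp_all add: col_antisymmetrizer_def)
qed

lemma row_symmetrizer_inv:
  assumes "\<pi> \<in> Sym (sum_list \<mu>)"
  shows "row_symmetrizer \<mu> (inv \<pi>) = row_symmetrizer \<mu> \<pi>"
  using row_group_inv[of \<pi> \<mu>] row_group_inv[of "inv \<pi>" \<mu>] Sym_comp_inv(3)[OF assms]
  unfolding row_symmetrizer_def by auto

lemma col_antisymmetrizer_inv:
  assumes "\<pi> \<in> Sym (sum_list \<mu>)"
  shows "col_antisymmetrizer \<mu> (inv \<pi>) = col_antisymmetrizer \<mu> \<pi>"
  using col_group_inv[of \<pi> \<mu>] col_group_inv[of "inv \<pi>" \<mu>] Sym_comp_inv(3)[OF assms]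
    sign_inverse[OF Sym_permutation[OF assms]]
  unfolding col_antisymmetrizer_def by auto

lemma row_invariant_young_symmetrizer:
  assumes "\<mu> \<in> young_diagrams q"
  shows "row_invariant \<mu> (young_symmetrizer \<mu>)"
  unfolding row_invariant_def
proof (intro ballI)
  fix p \<rho> assume p: "p \<in> row_group \<mu>" and \<rho>: "\<rho> \<in> Sym (sum_list \<mu>)"
  have [simp]: "sum_list \<mu> = q" using assms by (rule sum_list_young_diagram)
  have pS: "p \<in> Sym q" using row_group_Sym[OF p] by simp
  have "young_symmetrizer \<mu> (p \<circ> \<rho>) = (\<Sum>\<pi>\<in>Sym q. row_symmetrizer \<mu> (p \<circ> \<pi>) * col_antisymmetrizer \<mu> (inv (p \<circ> \<pi>) \<circ> (p \<circ> \<rho>)))"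
    unfolding young_symmetrizer_eq[OF assms]
    by (rule sum_Sym_comp_left[OF pS, symmetric, where f = "\<lambda>\<pi>. row_symmetrizer \<mu> \<pi> * col_antisymmetrizer \<mu> (inv \<pi> \<circ> (p \<circ> \<rho>))"])
  also have "\<dots> = young_symmetrizer \<mu> \<rho>"
    unfolding young_symmetrizer_eq[OF assms]
    using pS row_symmetrizer_comp[OF p] by (intro sum.cong) (auto simp: Sym_simps)
  finally show "young_symmetrizer \<mu> (p \<circ> \<rho>) = young_symmetrizer \<mu> \<rho>" .
qed

lemma col_alternating_young_symmetrizer:
  assumes "\<mu> \<in> young_diagrams q"
  shows "col_alternating \<mu> (young_symmetrizer \<mu>)"
  unfolding col_alternating_def
proof (intro ballI)
  fix k \<rho> assume k: "k \<in> col_group \<mu>" and \<rho>: "\<rho> \<in> Sym (sum_list \<mu>)"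
  have [simp]: "sum_list \<mu> = q" using assms by (rule sum_list_young_diagram)
  have "col_antisymmetrizer \<mu> (inv \<pi> \<circ> (\<rho> \<circ> k)) = of_int (sign k) * col_antisymmetrizer \<mu> (inv \<pi> \<circ> \<rho>)"
    if "\<pi> \<in> Sym q" for \<pi>
    using col_antisymmetrizer_comp[OF k, of "inv \<pi> \<circ> \<rho>"] that \<rho> by (simp add: comp_assoc)
  then show "young_symmetrizer \<mu> (\<rho> \<circ> k) = of_int (sign k) * young_symmetrizer \<mu> \<rho>"
    by (simp add: young_symmetrizer_eq[OF assms] sum_distrib_left mult_ac)
qed

text \<open>Only \<pi> = id contributes, because the row and column groups meet trivially.\<close>

lemma young_symmetrizer_id:
  assumes "\<mu> \<in> young_diagrams q"
  shows "young_symmetrizer \<mu> id = 1"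
proof -
  have [simp]: "sum_list \<mu> = q" using assms by (rule sum_list_young_diagram)
  have 1: "row_symmetrizer \<mu> \<pi> * col_antisymmetrizer \<mu> (inv \<pi> \<circ> id) = (if \<pi> = id then 1 else 0)"
    if "\<pi> \<in> Sym q" for \<pi>
  proof (cases "\<pi> = id")
    case True
    have "row_symmetrizer \<mu> id = 1" by (simp add: row_symmetrizer_def)
    moreover have "col_antisymmetrizer \<mu> id = 1" by (simp add: col_antisymmetrizer_def)
    ultimately show ?thesis using True by (simp add: inv_id)
  next
    case False
    then have "\<not> (\<pi> \<in> row_group \<mu> \<and> inv \<pi> \<in> col_group \<mu>)"
      using col_group_inv[of "inv \<pi>" \<mu>] Sym_comp_inv(3)[OF that] row_col_group_trivial[of \<pi> \<mu>] by auto
    then have "row_symmetrizer \<mu> \<pi> = 0 \<or> col_antisymmetrizer \<mu> (inv \<pi>) = 0"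
      unfolding row_symmetrizer_def col_antisymmetrizer_def by auto
    then show ?thesis using False by auto
  qed
  show ?thesis
    unfolding young_symmetrizer_eq[OF assms] by (simp only: 1 cong: sum.cong) simp
qed

lemma young_symmetrizer_outside:
  assumes "\<mu> \<in> young_diagrams q" "\<rho> \<notin> Sym q"
  shows "young_symmetrizer \<mu> \<rho> = 0"
proof -
  have [simp]: "sum_list \<mu> = q" using assms(1) by (rule sum_list_young_diagram)
  have "col_antisymmetrizer \<mu> (inv \<pi> \<circ> \<rho>) = 0" if "\<pi> \<in> Sym q" for \<pi>
  proof -
    have "inv \<pi> \<circ> \<rho> \<notin> Sym q"
    proof
      assume "inv \<pi> \<circ> \<rho> \<in> Sym q"
      with that have "\<pi> \<circ> (inv \<pi> \<circ> \<rho>) \<in> Sym q" by (rule comp_in_Sym)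
      then show False using assms(2) that by (simp add: Sym_simps)
    qed
    then show ?thesis using col_group_Sym[of "inv \<pi> \<circ> \<rho>" \<mu>] by (auto simp: col_antisymmetrizer_def)
  qed
  then show ?thesis by (simp add: young_symmetrizer_eq[OF assms(1)])
qed

lemma young_symmetrizer_Reals: "young_symmetrizer \<mu> \<rho> \<in> \<real>"
  unfolding young_symmetrizer_def convolve_def row_symmetrizer_def col_antisymmetrizer_def
  by (intro sum_in_Reals Reals_mult) auto

text \<open>On separated permutations g = p \<circ> k the symmetries give x g = sign k * x id, and
  elsewhere x vanishes, so the value at the identity determines x. The product formulas for
  symmetrizers below all rest on this one-dimensionality.\<close>

lemma row_invariant_col_alternating_unique:
  assumes \<mu>: "\<mu> \<in> young_diagrams q" and g: "g \<in> Sym q"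
    and x: "row_invariant \<mu> x" "col_alternating \<mu> x"
  shows "x g = x id * young_symmetrizer \<mu> g"
proof (cases "row_col_separated \<mu> \<mu> g")
  case True
  have [simp]: "sum_list \<mu> = q" using \<mu> by (rule sum_list_young_diagram)
  obtain p k where pk: "p \<in> row_group \<mu>" "k \<in> col_group \<mu>" "g = p \<circ> k"
    using row_col_separated_decomp[OF \<mu> g True] .
  have "k \<in> Sym q" using col_group_Sym[OF pk(2)] by simp
  then have *: "y g = of_int (sign k) * y id" if "row_invariant \<mu> y" "col_alternating \<mu> y" for y
    using that pk unfolding row_invariant_def col_alternating_def
    by (metis \<open>sum_list \<mu> = q\<close> id_comp id_in_Sym(1))
  show ?thesis
    using *[OF x] *[OF row_invariant_young_symmetrizer[OF \<mu>] col_alternating_young_symmetrizer[OF \<mu>]]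
    by (simp add: young_symmetrizer_id[OF \<mu>])
next
  case False
  then show ?thesis
    using vanish_not_separated[OF \<mu> \<mu> g x]
      vanish_not_separated[OF \<mu> \<mu> g row_invariant_young_symmetrizer[OF \<mu>] col_alternating_young_symmetrizer[OF \<mu>]]
    by simp
qed

text \<open>The closed formula in which the later work is done;
  \<open>norm_char_eq_young_char\<close> identifies it with the normalized trace on
  \<open>Sym q\<close>.\<close>

definition young_char :: "nat list \<Rightarrow> perm \<Rightarrow> complex" where
  "young_char \<mu> = conj_avg (sum_list \<mu>) (young_symmetrizer \<mu>)"

lemma young_char_eq:
  "\<mu> \<in> young_diagrams q \<Longrightarrow> young_char \<mu> = conj_avg q (young_symmetrizer \<mu>)"
  by (simp add: young_char_def sum_list_young_diagram)

lemma young_char_conj: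
  "\<mu> \<in> young_diagrams q \<Longrightarrow> \<tau> \<in> Sym q \<Longrightarrow> \<rho> \<in> Sym q \<Longrightarrow> young_char \<mu> (\<tau> \<circ> \<rho> \<circ> inv \<tau>) = young_char \<mu> \<rho>"
  by (simp add: young_char_eq conj_avg_conj)

lemma young_char_Reals: "young_char \<mu> \<rho> \<in> \<real>"
proof -
  have "(fact n :: complex) \<in> \<real>" for n
    by (metis Reals_of_nat of_nat_fact)
  then show ?thesis
    unfolding young_char_def conj_avg_def
    by (intro Reals_divide sum_in_Reals young_symmetrizer_Reals)
qed

lemma young_char_id: "\<mu> \<in> young_diagrams q \<Longrightarrow> young_char \<mu> id = 1"
  by (simp add: young_char_eq conj_avg_def Sym_simps young_symmetrizer_id card_Sym cong: sum.cong)

text \<open>Class sums act on the ideal of the Young symmetrizer by the scalar \<^term>\<open>young_char \<mu>\<close>.\<close>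

lemma class_sum_young_symmetrizer:
  assumes \<mu>: "\<mu> \<in> young_diagrams q" and \<sigma>: "\<sigma> \<in> Sym q" and \<kappa>: "\<kappa> \<in> Sym q"
  shows "(\<Sum>\<pi>\<in>Sym q. young_symmetrizer \<mu> (\<pi> \<circ> \<sigma> \<circ> inv \<pi> \<circ> \<kappa>))
    = fact q * young_char \<mu> \<sigma> * young_symmetrizer \<mu> \<kappa>"
proof -
  have [simp]: "sum_list \<mu> = q" using \<mu> by (rule sum_list_young_diagram)
  let ?y = "\<lambda>\<kappa>. \<Sum>\<pi>\<in>Sym q. young_symmetrizer \<mu> (\<pi> \<circ> \<sigma> \<circ> inv \<pi> \<circ> \<kappa>)"
  have "row_invariant \<mu> ?y"
    unfolding row_invariant_def
  proof (intro ballI)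
    fix p \<rho> assume p: "p \<in> row_group \<mu>" and \<rho>: "\<rho> \<in> Sym (sum_list \<mu>)"
    have pS: "p \<in> Sym q" using row_group_Sym[OF p] by simp
    \<comment> \<open>The reindexing of \<pi> by p \<circ> \<pi> brings p to the front: a class sum
      commutes with p.\<close>
    have "?y (p \<circ> \<rho>) = (\<Sum>\<pi>\<in>Sym q. young_symmetrizer \<mu> ((p \<circ> \<pi>) \<circ> \<sigma> \<circ> inv (p \<circ> \<pi>) \<circ> (p \<circ> \<rho>)))"
      by (rule sum_Sym_comp_left[OF pS, symmetric, where f = "\<lambda>\<pi>. young_symmetrizer \<mu> (\<pi> \<circ> \<sigma> \<circ> inv \<pi> \<circ> (p \<circ> \<rho>))"])
    also have "\<dots> = (\<Sum>\<pi>\<in>Sym q. young_symmetrizer \<mu> (p \<circ> (\<pi> \<circ> \<sigma> \<circ> inv \<pi> \<circ> \<rho>)))"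
      using pS by (intro sum.cong) (auto simp: Sym_simps)
    also have "\<dots> = ?y \<rho>"
      using row_invariant_young_symmetrizer[OF \<mu>] p \<rho> \<sigma> unfolding row_invariant_def
      by (intro sum.cong) auto
    finally show "?y (p \<circ> \<rho>) = ?y \<rho>" .
  qed
  moreover have "col_alternating \<mu> ?y"
    unfolding col_alternating_def
  proof (intro ballI)
    fix k \<rho> assume k: "k \<in> col_group \<mu>" and \<rho>: "\<rho> \<in> Sym (sum_list \<mu>)"
    have "young_symmetrizer \<mu> (\<pi> \<circ> \<sigma> \<circ> inv \<pi> \<circ> (\<rho> \<circ> k)) = of_int (sign k) * young_symmetrizer \<mu> (\<pi> \<circ> \<sigma> \<circ> inv \<pi> \<circ> \<rho>)"
      if "\<pi> \<in> Sym q" for \<pi>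
    proof -
      have "\<pi> \<circ> \<sigma> \<circ> inv \<pi> \<circ> \<rho> \<in> Sym (sum_list \<mu>)" using that \<rho> \<sigma> by simp
      then have "young_symmetrizer \<mu> (\<pi> \<circ> \<sigma> \<circ> inv \<pi> \<circ> \<rho> \<circ> k) = of_int (sign k) * young_symmetrizer \<mu> (\<pi> \<circ> \<sigma> \<circ> inv \<pi> \<circ> \<rho>)"
        using col_alternating_young_symmetrizer[OF \<mu>] k unfolding col_alternating_def by blast
      then show ?thesis by (simp add: comp_assoc)
    qed
    then show "?y (\<rho> \<circ> k) = of_int (sign k) * ?y \<rho>"
      unfolding sum_distrib_left by (intro sum.cong) auto
  qed
  ultimately have "?y \<kappa> = ?y id * young_symmetrizer \<mu> \<kappa>"
    by (rule row_invariant_col_alternating_unique[OF \<mu> \<kappa>])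
  moreover have "?y id = fact q * young_char \<mu> \<sigma>"
    by (simp add: young_char_eq[OF \<mu>] conj_avg_def)
  ultimately show ?thesis by simp
qed

text \<open>Average \<open>class_sum_young_symmetrizer\<close> over the conjugates of \<kappa>. This
  is the functional equation of normalized characters; for \<sigma> = \<kappa> it makes the square
  of a character linear in the character, so that second moments can be computed from
  \<psi>.\<close>

lemma young_char_mult:
  assumes \<mu>: "\<mu> \<in> young_diagrams q" and \<sigma>: "\<sigma> \<in> Sym q" and \<kappa>: "\<kappa> \<in> Sym q"
  shows "(\<Sum>\<pi>\<in>Sym q. young_char \<mu> (\<pi> \<circ> \<sigma> \<circ> inv \<pi> \<circ> \<kappa>)) = fact q * (young_char \<mu> \<sigma> * young_char \<mu> \<kappa>)"
proof -
  let ?c = "young_symmetrizer \<mu>"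
  have "fact q * (\<Sum>\<pi>\<in>Sym q. young_char \<mu> (\<pi> \<circ> \<sigma> \<circ> inv \<pi> \<circ> \<kappa>))
     = (\<Sum>\<pi>\<in>Sym q. \<Sum>\<theta>\<in>Sym q. ?c (\<theta> \<circ> (\<pi> \<circ> \<sigma> \<circ> inv \<pi> \<circ> \<kappa>) \<circ> inv \<theta>))"
    by (simp add: young_char_eq[OF \<mu>] conj_avg_def flip: sum_divide_distrib)
  also have "\<dots> = (\<Sum>\<theta>\<in>Sym q. \<Sum>\<pi>\<in>Sym q. ?c (\<theta> \<circ> (\<pi> \<circ> \<sigma> \<circ> inv \<pi> \<circ> \<kappa>) \<circ> inv \<theta>))"
    by (rule sum.swap)
  also have "\<dots> = (\<Sum>\<theta>\<in>Sym q. \<Sum>\<pi>\<in>Sym q. ?c ((\<theta> \<circ> \<pi>) \<circ> \<sigma> \<circ> inv (\<theta> \<circ> \<pi>) \<circ> (\<theta> \<circ> \<kappa> \<circ> inv \<theta>)))"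
    by (intro sum.cong) (auto simp: Sym_simps)
  also have "\<dots> = (\<Sum>\<theta>\<in>Sym q. \<Sum>\<pi>\<in>Sym q. ?c (\<pi> \<circ> \<sigma> \<circ> inv \<pi> \<circ> (\<theta> \<circ> \<kappa> \<circ> inv \<theta>)))"
    by (rule sum.cong[OF refl])
       (rule sum_Sym_comp_left[where f = "\<lambda>\<pi>. ?c (\<pi> \<circ> \<sigma> \<circ> inv \<pi> \<circ> (_ \<circ> \<kappa> \<circ> inv _))"])
  also have "\<dots> = (\<Sum>\<theta>\<in>Sym q. fact q * young_char \<mu> \<sigma> * ?c (\<theta> \<circ> \<kappa> \<circ> inv \<theta>))"
    using class_sum_young_symmetrizer[OF \<mu> \<sigma>] \<kappa> by (intro sum.cong) auto
  also have "\<dots> = fact q * (fact q * (young_char \<mu> \<sigma> * young_char \<mu> \<kappa>))"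
    by (simp add: young_char_eq[OF \<mu>] conj_avg_def flip: sum_distrib_left)
  finally show ?thesis by simp
qed

text \<open>Inversion preserves both factors of the symmetrizer and swaps their order; the average
  over conjugates does not see the order of a product of two factors.\<close>

lemma young_char_inv:
  assumes \<mu>: "\<mu> \<in> young_diagrams q" and \<rho>: "\<rho> \<in> Sym q"
  shows "young_char \<mu> (inv \<rho>) = young_char \<mu> \<rho>"
proof -
  have [simp]: "sum_list \<mu> = q" using \<mu> by (rule sum_list_young_diagram)
  let ?a = "row_symmetrizer \<mu>" and ?b = "col_antisymmetrizer \<mu>"
  have "(\<Sum>\<theta>\<in>Sym q. young_symmetrizer \<mu> (\<theta> \<circ> inv \<rho> \<circ> inv \<theta>))
      = (\<Sum>\<theta>\<in>Sym q. \<Sum>\<pi>\<in>Sym q. ?a (inv \<pi>) * ?b (inv (inv \<pi>) \<circ> (\<theta> \<circ> inv \<rho> \<circ> inv \<theta>)))"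
    unfolding young_symmetrizer_eq[OF \<mu>]
    by (rule sum.cong[OF refl],
        rule sum_Sym_inv[symmetric, where f = "\<lambda>\<pi>. ?a \<pi> * ?b (inv \<pi> \<circ> (_ \<circ> inv \<rho> \<circ> inv _))"])
  also have "\<dots> = (\<Sum>\<theta>\<in>Sym q. \<Sum>\<pi>\<in>Sym q. ?a \<pi> * ?b (\<theta> \<circ> \<rho> \<circ> inv \<theta> \<circ> inv \<pi>))"
  proof (intro sum.cong refl)
    fix \<theta> \<pi> assume S: "\<theta> \<in> Sym q" "\<pi> \<in> Sym q"
    have "inv (\<theta> \<circ> \<rho> \<circ> inv \<theta> \<circ> inv \<pi>) = inv (inv \<pi>) \<circ> (\<theta> \<circ> inv \<rho> \<circ> inv \<theta>)"
      using S \<rho> by (simp add: Sym_simps Sym_inv_comp[where q = q])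
    then show "?a (inv \<pi>) * ?b (inv (inv \<pi>) \<circ> (\<theta> \<circ> inv \<rho> \<circ> inv \<theta>)) = ?a \<pi> * ?b (\<theta> \<circ> \<rho> \<circ> inv \<theta> \<circ> inv \<pi>)"
      using row_symmetrizer_inv[of \<pi> \<mu>] col_antisymmetrizer_inv[of "\<theta> \<circ> \<rho> \<circ> inv \<theta> \<circ> inv \<pi>" \<mu>] S \<rho> by simp
  qed
  also have "\<dots> = (\<Sum>\<pi>\<in>Sym q. \<Sum>\<theta>\<in>Sym q. ?a \<pi> * ?b (\<theta> \<circ> \<rho> \<circ> inv \<theta> \<circ> inv \<pi>))"
    by (rule sum.swap)
  also have "\<dots> = (\<Sum>\<pi>\<in>Sym q. \<Sum>\<theta>\<in>Sym q. ?a \<pi> * ?b (inv \<pi> \<circ> (\<theta> \<circ> \<rho> \<circ> inv \<theta>)))"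
  proof (rule sum.cong[OF refl])
    fix \<pi> assume \<pi>: "\<pi> \<in> Sym q"
    \<comment> \<open>Shifting \<theta> by inv \<pi> conjugates the argument of \<open>?b\<close>
      and so moves inv \<pi> from its right end to its left end.\<close>
    have "(\<Sum>\<theta>\<in>Sym q. ?a \<pi> * ?b (\<theta> \<circ> \<rho> \<circ> inv \<theta> \<circ> inv \<pi>))
       = (\<Sum>\<theta>\<in>Sym q. ?a \<pi> * ?b (inv \<pi> \<circ> \<theta> \<circ> \<rho> \<circ> inv (inv \<pi> \<circ> \<theta>) \<circ> inv \<pi>))"
      using \<pi> by (intro sum_Sym_comp_left[symmetric, where f = "\<lambda>\<theta>. ?a \<pi> * ?b (\<theta> \<circ> \<rho> \<circ> inv \<theta> \<circ> inv \<pi>)"]) simp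
    also have "\<dots> = (\<Sum>\<theta>\<in>Sym q. ?a \<pi> * ?b (inv \<pi> \<circ> (\<theta> \<circ> \<rho> \<circ> inv \<theta>)))"
      using \<pi> by (intro sum.cong refl) (simp add: Sym_simps Sym_inv_comp[where q = q])
    finally show "(\<Sum>\<theta>\<in>Sym q. ?a \<pi> * ?b (\<theta> \<circ> \<rho> \<circ> inv \<theta> \<circ> inv \<pi>))
      = (\<Sum>\<theta>\<in>Sym q. ?a \<pi> * ?b (inv \<pi> \<circ> (\<theta> \<circ> \<rho> \<circ> inv \<theta>)))" .
  qed
  also have "\<dots> = (\<Sum>\<theta>\<in>Sym q. young_symmetrizer \<mu> (\<theta> \<circ> \<rho> \<circ> inv \<theta>))"
    unfolding young_symmetrizer_eq[OF \<mu>] by (rule sum.swap)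
  finally show ?thesis by (simp add: young_char_eq[OF \<mu>] conj_avg_def)
qed

text \<open>Unfolding both averages leaves, for each \<pi>, the value at \<pi> of the product
  \<open>c\<^sub>\<mu> \<pi> c\<^sub>\<nu>\<close>. That product is row invariant for \<mu> and
  column alternating for \<nu>, so vanishing and uniqueness apply to it.\<close>

lemma young_char_inner:
  assumes \<mu>: "\<mu> \<in> young_diagrams q" and \<nu>: "\<nu> \<in> young_diagrams q"
  shows "(\<Sum>\<sigma>\<in>Sym q. young_char \<mu> \<sigma> * young_char \<nu> \<sigma>)
    = (\<Sum>\<pi>\<in>Sym q. \<Sum>\<tau>\<in>Sym q. young_symmetrizer \<mu> \<tau> * young_symmetrizer \<nu> (inv \<pi> \<circ> (inv \<tau> \<circ> \<pi>))) / fact q"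
proof -
  let ?m = "young_symmetrizer \<mu>" and ?n = "young_symmetrizer \<nu>"
  have "(\<Sum>\<sigma>\<in>Sym q. young_char \<mu> \<sigma> * young_char \<nu> \<sigma>)
      = (\<Sum>\<sigma>\<in>Sym q. young_char \<mu> \<sigma> * young_char \<nu> (inv \<sigma>))"
    using young_char_inv[OF \<nu>] by (intro sum.cong) auto
  also have "\<dots> = (\<Sum>\<sigma>\<in>Sym q. \<Sum>\<pi>\<in>Sym q. young_char \<mu> \<sigma> * ?n (\<pi> \<circ> inv \<sigma> \<circ> inv \<pi>)) / fact q"
    by (simp add: young_char_eq[OF \<nu>] conj_avg_def sum_distrib_left sum_divide_distrib)
  also have "(\<Sum>\<sigma>\<in>Sym q. \<Sum>\<pi>\<in>Sym q. young_char \<mu> \<sigma> * ?n (\<pi> \<circ> inv \<sigma> \<circ> inv \<pi>))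
      = (\<Sum>\<pi>\<in>Sym q. \<Sum>\<sigma>\<in>Sym q. young_char \<mu> \<sigma> * ?n (\<pi> \<circ> inv \<sigma> \<circ> inv \<pi>))"
    by (rule sum.swap)
  also have "\<dots> = (\<Sum>\<pi>\<in>Sym q. \<Sum>\<sigma>\<in>Sym q. young_char \<mu> (\<pi> \<circ> \<sigma> \<circ> inv \<pi>) * ?n (inv (\<pi> \<circ> \<sigma> \<circ> inv \<pi>)))"
    using young_char_conj[OF \<mu>] by (intro sum.cong refl) (simp add: Sym_simps)
  also have "\<dots> = (\<Sum>\<pi>\<in>Sym q. \<Sum>\<sigma>\<in>Sym q. young_char \<mu> \<sigma> * ?n (inv \<sigma>))"
    by (rule sum.cong[OF refl]) (rule sum_Sym_conj[where f = "\<lambda>\<sigma>. young_char \<mu> \<sigma> * ?n (inv \<sigma>)"])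
  also have "\<dots> = fact q * (\<Sum>\<sigma>\<in>Sym q. young_char \<mu> \<sigma> * ?n (inv \<sigma>))"
    by (simp add: card_Sym)
  also have "\<dots> = (\<Sum>\<sigma>\<in>Sym q. \<Sum>\<pi>\<in>Sym q. ?m (\<pi> \<circ> \<sigma> \<circ> inv \<pi>) * ?n (inv \<sigma>))"
    by (simp add: young_char_eq[OF \<mu>] conj_avg_def sum_distrib_left sum_divide_distrib sum_distrib_right)
  also have "\<dots> = (\<Sum>\<pi>\<in>Sym q. \<Sum>\<sigma>\<in>Sym q. ?m (\<pi> \<circ> \<sigma> \<circ> inv \<pi>) * ?n (inv \<sigma>))"
    by (rule sum.swap)
  also have "\<dots> = (\<Sum>\<pi>\<in>Sym q. \<Sum>\<sigma>\<in>Sym q. ?m (\<pi> \<circ> \<sigma> \<circ> inv \<pi>) * ?n (inv \<pi> \<circ> (inv (\<pi> \<circ> \<sigma> \<circ> inv \<pi>) \<circ> \<pi>)))"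
    by (intro sum.cong refl) (simp add: Sym_simps)
  also have "\<dots> = (\<Sum>\<pi>\<in>Sym q. \<Sum>\<tau>\<in>Sym q. ?m \<tau> * ?n (inv \<pi> \<circ> (inv \<tau> \<circ> \<pi>)))"
  proof (rule sum.cong[OF refl])
    fix \<pi> assume "\<pi> \<in> Sym q"
    then show "(\<Sum>\<sigma>\<in>Sym q. ?m (\<pi> \<circ> \<sigma> \<circ> inv \<pi>) * ?n (inv \<pi> \<circ> (inv (\<pi> \<circ> \<sigma> \<circ> inv \<pi>) \<circ> \<pi>)))
      = (\<Sum>\<tau>\<in>Sym q. ?m \<tau> * ?n (inv \<pi> \<circ> (inv \<tau> \<circ> \<pi>)))"
      by (rule sum_Sym_conj[where f = "\<lambda>\<tau>. ?m \<tau> * ?n (inv \<pi> \<circ> (inv \<tau> \<circ> \<pi>))"])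
  qed
  finally show ?thesis .
qed

text \<open>The product \<open>c\<^sub>\<mu> \<pi> c\<^sub>\<nu>\<close> in the group algebra.\<close>

definition sandwich :: "nat list \<Rightarrow> perm \<Rightarrow> nat list \<Rightarrow> perm \<Rightarrow> complex" where
  "sandwich \<mu> \<pi> \<nu> \<kappa> =
     (\<Sum>\<tau>\<in>Sym (sum_list \<mu>). young_symmetrizer \<mu> \<tau> * young_symmetrizer \<nu> (inv \<pi> \<circ> (inv \<tau> \<circ> \<kappa>)))"

lemma row_invariant_sandwich:
  assumes \<mu>: "\<mu> \<in> young_diagrams q" and \<pi>: "\<pi> \<in> Sym q"
  shows "row_invariant \<mu> (sandwich \<mu> \<pi> \<nu>)"
  unfolding row_invariant_def
proof (intro ballI)
  have [simp]: "sum_list \<mu> = q" using \<mu> by (rule sum_list_young_diagram)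
  let ?m = "young_symmetrizer \<mu>" and ?n = "young_symmetrizer \<nu>"
  fix p \<rho> assume p: "p \<in> row_group \<mu>" and \<rho>: "\<rho> \<in> Sym (sum_list \<mu>)"
  have pS: "p \<in> Sym q" using row_group_Sym[OF p] by simp
  have "sandwich \<mu> \<pi> \<nu> (p \<circ> \<rho>) = (\<Sum>\<tau>\<in>Sym q. ?m (p \<circ> \<tau>) * ?n (inv \<pi> \<circ> (inv (p \<circ> \<tau>) \<circ> (p \<circ> \<rho>))))"
    unfolding sandwich_def \<open>sum_list \<mu> = q\<close>
    by (rule sum_Sym_comp_left[OF pS, symmetric, where f = "\<lambda>\<tau>. ?m \<tau> * ?n (inv \<pi> \<circ> (inv \<tau> \<circ> (p \<circ> \<rho>)))"])
  also have "\<dots> = sandwich \<mu> \<pi> \<nu> \<rho>"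
    unfolding sandwich_def \<open>sum_list \<mu> = q\<close>
    using row_invariant_young_symmetrizer[OF \<mu>] p pS unfolding row_invariant_def
    by (intro sum.cong refl) (simp add: Sym_simps)
  finally show "sandwich \<mu> \<pi> \<nu> (p \<circ> \<rho>) = sandwich \<mu> \<pi> \<nu> \<rho>" .
qed

lemma col_alternating_sandwich:
  assumes \<mu>: "\<mu> \<in> young_diagrams q" and \<nu>: "\<nu> \<in> young_diagrams q" and \<pi>: "\<pi> \<in> Sym q"
  shows "col_alternating \<nu> (sandwich \<mu> \<pi> \<nu>)"
  unfolding col_alternating_def
proof (intro ballI)
  have [simp]: "sum_list \<mu> = q" "sum_list \<nu> = q" using \<mu> \<nu> by (simp_all add: sum_list_young_diagram)
  fix k \<rho> assume k: "k \<in> col_group \<nu>" and \<rho>: "\<rho> \<in> Sym (sum_list \<nu>)"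
  have "young_symmetrizer \<nu> (inv \<pi> \<circ> (inv \<tau> \<circ> (\<rho> \<circ> k))) = of_int (sign k) * young_symmetrizer \<nu> (inv \<pi> \<circ> (inv \<tau> \<circ> \<rho>))"
    if "\<tau> \<in> Sym q" for \<tau>
  proof -
    have "inv \<pi> \<circ> (inv \<tau> \<circ> \<rho>) \<in> Sym (sum_list \<nu>)" using that \<rho> \<pi> by simp
    then have "young_symmetrizer \<nu> (inv \<pi> \<circ> (inv \<tau> \<circ> \<rho>) \<circ> k) = of_int (sign k) * young_symmetrizer \<nu> (inv \<pi> \<circ> (inv \<tau> \<circ> \<rho>))"
      using col_alternating_young_symmetrizer[OF \<nu>] k unfolding col_alternating_def by blast
    then show ?thesis by (simp add: comp_assoc)
  qed
  then show "sandwich \<mu> \<pi> \<nu> (\<rho> \<circ> k) = of_int (sign k) * sandwich \<mu> \<pi> \<nu> \<rho>"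
    unfolding sandwich_def \<open>sum_list \<mu> = q\<close> sum_distrib_left
    by (intro sum.cong refl) (simp add: mult_ac)
qed

text \<open>Two different diagrams cannot dominate each other, and the sum is symmetric in them. If
  \<mu> is not dominated by \<nu>, all products \<open>c\<^sub>\<mu> \<pi> c\<^sub>\<nu>\<close>
  vanish.\<close>

lemma young_char_orthogonal:
  assumes \<mu>: "\<mu> \<in> young_diagrams q" and \<nu>: "\<nu> \<in> young_diagrams q" and ne: "\<mu> \<noteq> \<nu>"
  shows "(\<Sum>\<sigma>\<in>Sym q. young_char \<mu> \<sigma> * young_char \<nu> \<sigma>) = 0"
proof -
  have *: "(\<Sum>\<sigma>\<in>Sym q. young_char \<mu> \<sigma> * young_char \<nu> \<sigma>) = 0"
    if \<mu>: "\<mu> \<in> young_diagrams q" and \<nu>: "\<nu> \<in> young_diagrams q" and nd: "\<not> dominated \<mu> \<nu>" for \<mu> \<nu>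
  proof -
    have "sandwich \<mu> \<pi> \<nu> \<pi> = 0" if "\<pi> \<in> Sym q" for \<pi>
      by (rule row_invariant_col_alternating_eq_0[OF \<mu> \<nu> that row_invariant_sandwich[OF \<mu> that]
          col_alternating_sandwich[OF \<mu> \<nu> that] nd])
    then show ?thesis
      by (simp add: young_char_inner[OF \<mu> \<nu>] sandwich_def sum_list_young_diagram[OF \<mu>])
  qed
  have "0 \<notin> set \<mu>" "0 \<notin> set \<nu>" using \<mu> \<nu> by (simp_all add: young_diagrams_def)
  with ne have "\<not> dominated \<mu> \<nu> \<or> \<not> dominated \<nu> \<mu>"
    using dominated_antisym by metis
  then show ?thesis
    using *[OF \<mu> \<nu>] *[OF \<nu> \<mu>] by (metis (no_types, lifting) mult.commute sum.cong)
qed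

text \<open>In classical terms, the group order divided by the square of the dimension.\<close>

definition young_norm :: "nat list \<Rightarrow> real" where
  "young_norm \<mu> = (\<Sum>\<sigma>\<in>Sym (sum_list \<mu>). (Re (young_char \<mu> \<sigma>))\<^sup>2)"

lemma young_char_of_Re: "of_real (Re (young_char \<mu> \<rho>)) = young_char \<mu> \<rho>"
  using young_char_Reals by (simp add: of_real_Re)

lemma young_norm:
  assumes "\<mu> \<in> young_diagrams q"
  shows "(\<Sum>\<sigma>\<in>Sym q. young_char \<mu> \<sigma> * young_char \<mu> \<sigma>) = of_real (young_norm \<mu>)"
  unfolding young_norm_def by (simp add: sum_list_young_diagram[OF assms] power2_eq_square young_char_of_Re)

lemma young_norm_pos:
  assumes "\<mu> \<in> young_diagrams q"
  shows "young_norm \<mu> > 0"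
  unfolding young_norm_def
  by (rule sum_pos2[of _ id]) (auto simp: young_char_id[OF assms])

text \<open>The scalar h with c * c = h c, read off at the identity; classically the product of the
  hook lengths.\<close>

definition young_hook :: "nat list \<Rightarrow> complex" where
  "young_hook \<mu> = (\<Sum>\<tau>\<in>Sym (sum_list \<mu>). young_symmetrizer \<mu> \<tau> * young_symmetrizer \<mu> (inv \<tau>))"

lemma young_symmetrizer_square:
  assumes \<mu>: "\<mu> \<in> young_diagrams q" and \<kappa>: "\<kappa> \<in> Sym q"
  shows "(\<Sum>\<tau>\<in>Sym q. young_symmetrizer \<mu> \<tau> * young_symmetrizer \<mu> (inv \<tau> \<circ> \<kappa>))
    = young_hook \<mu> * young_symmetrizer \<mu> \<kappa>"
  using row_invariant_col_alternating_unique[OF \<mu> \<kappa> row_invariant_sandwich[OF \<mu> id_in_Sym(1)]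
      col_alternating_sandwich[OF \<mu> \<mu> id_in_Sym(1)]]
  by (simp add: sandwich_def sum_list_young_diagram[OF \<mu>] young_hook_def inv_id)

text \<open>Each c \<pi> c is c times its value at the identity, and that value is (c * c)(inv
  \<pi>). If c * c vanished, so would every summand of \<open>young_norm\<close>, against its
  positivity.\<close>

lemma young_hook_nonzero:
  assumes \<mu>: "\<mu> \<in> young_diagrams q"
  shows "young_hook \<mu> \<noteq> 0"
proof
  assume h: "young_hook \<mu> = 0"
  have "sandwich \<mu> \<pi> \<mu> \<pi> = 0" if "\<pi> \<in> Sym q" for \<pi>
  proof -
    have "sandwich \<mu> \<pi> \<mu> \<pi> = sandwich \<mu> \<pi> \<mu> id * young_symmetrizer \<mu> \<pi>"
      by (rule row_invariant_col_alternating_unique[OF \<mu> that row_invariant_sandwich[OF \<mu> that]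
          col_alternating_sandwich[OF \<mu> \<mu> that]])
    \<comment> \<open>The value of a product at the identity is cyclic: replacing \<tau> by inv
      \<tau> and then by \<pi> \<circ> \<tau> turns it into c * c at inv \<pi>.\<close>
    also have "sandwich \<mu> \<pi> \<mu> id
        = (\<Sum>\<tau>\<in>Sym q. young_symmetrizer \<mu> (inv \<tau>) * young_symmetrizer \<mu> (inv \<pi> \<circ> (inv (inv \<tau>) \<circ> id)))"
      unfolding sandwich_def sum_list_young_diagram[OF \<mu>]
      by (rule sum_Sym_inv[symmetric, where f = "\<lambda>\<tau>. young_symmetrizer \<mu> \<tau> * young_symmetrizer \<mu> (inv \<pi> \<circ> (inv \<tau> \<circ> id))"])
    also have "\<dots> = (\<Sum>\<tau>\<in>Sym q. young_symmetrizer \<mu> (inv \<tau>) * young_symmetrizer \<mu> (inv \<pi> \<circ> \<tau>))"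
      by (intro sum.cong refl) (simp add: Sym_comp_inv(3))
    also have "\<dots> = (\<Sum>\<tau>\<in>Sym q. young_symmetrizer \<mu> (inv (\<pi> \<circ> \<tau>)) * young_symmetrizer \<mu> (inv \<pi> \<circ> (\<pi> \<circ> \<tau>)))"
      by (rule sum_Sym_comp_left[OF that, symmetric, where f = "\<lambda>\<tau>. young_symmetrizer \<mu> (inv \<tau>) * young_symmetrizer \<mu> (inv \<pi> \<circ> \<tau>)"])
    also have "\<dots> = (\<Sum>\<tau>\<in>Sym q. young_symmetrizer \<mu> \<tau> * young_symmetrizer \<mu> (inv \<tau> \<circ> inv \<pi>))"
      using that by (intro sum.cong refl) (simp add: Sym_simps)
    also have "\<dots> = 0"
      using young_symmetrizer_square[OF \<mu> inv_in_Sym[OF that]] h by simp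
    finally show ?thesis by simp
  qed
  then have "young_norm \<mu> = 0"
    using young_norm[OF \<mu>] by (simp add: young_char_inner[OF \<mu> \<mu>] sandwich_def sum_list_young_diagram[OF \<mu>])
  then show False using young_norm_pos[OF \<mu>] by simp
qed

section \<open>The character of the Specht module\<close>

lemma sum_apply: "(\<Sum>i\<in>I. F i) x = (\<Sum>i\<in>I. F i x)" for F :: "'i \<Rightarrow> 'a \<Rightarrow> 'b::comm_monoid_add"
  by (induction I rule: infinite_finite_induct) auto

lemma convolve_young_symmetrizer:
  assumes "\<mu> \<in> young_diagrams q"
  shows "convolve q f (young_symmetrizer \<mu>)
    = (\<Sum>\<pi>\<in>Sym q. fun_scale (f \<pi>) (left_mult \<pi> (young_symmetrizer \<mu>)))"
  by (rule ext) (simp add: convolve_def sum_apply fun_scale_def left_mult_def)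

lemma specht_module_eq:
  "\<mu> \<in> young_diagrams q \<Longrightarrow> specht_module \<mu> = (\<lambda>f. convolve q f (young_symmetrizer \<mu>)) ` group_algebra q"
  by (simp add: specht_module_def sum_list_young_diagram)

lemma left_mult_in_specht_module:
  assumes \<mu>: "\<mu> \<in> young_diagrams q" and \<rho>: "\<rho> \<in> Sym q" and b: "b \<in> specht_module \<mu>"
  shows "left_mult \<rho> b \<in> specht_module \<mu>"
proof -
  obtain f where f: "f \<in> group_algebra q" "b = convolve q f (young_symmetrizer \<mu>)"
    using b unfolding specht_module_eq[OF \<mu>] by (rule imageE) simp
  have "left_mult \<rho> b = convolve q (left_mult \<rho> f) (young_symmetrizer \<mu>)"
  proof
    fix \<kappa>
    let ?F = "\<lambda>\<pi>. f (inv \<rho> \<circ> \<pi>) * young_symmetrizer \<mu> (inv \<pi> \<circ> \<kappa>)"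
    have "left_mult \<rho> b \<kappa> = (\<Sum>\<pi>\<in>Sym q. f \<pi> * young_symmetrizer \<mu> (inv \<pi> \<circ> (inv \<rho> \<circ> \<kappa>)))"
      by (simp add: f left_mult_def convolve_def)
    also have "\<dots> = (\<Sum>\<pi>\<in>Sym q. ?F (\<rho> \<circ> \<pi>))"
      using \<rho> by (intro sum.cong refl) (simp add: Sym_simps Sym_inv_comp[where q = q])
    also have "\<dots> = (\<Sum>\<pi>\<in>Sym q. ?F \<pi>)" by (rule sum_Sym_comp_left[OF \<rho>])
    finally show "left_mult \<rho> b \<kappa> = convolve q (left_mult \<rho> f) (young_symmetrizer \<mu>) \<kappa>"
      by (simp add: left_mult_def convolve_def)
  qed
  moreover have "left_mult \<rho> f \<in> group_algebra q"
    unfolding group_algebra_def left_mult_def mem_Collect_eq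
  proof (intro allI impI)
    fix \<pi> assume "\<pi> \<notin> Sym q"
    moreover have "\<rho> \<circ> (inv \<rho> \<circ> \<pi>) = \<pi>" using \<rho> by (rule Sym_comp_inv)
    ultimately have "inv \<rho> \<circ> \<pi> \<notin> Sym q" using comp_in_Sym[OF \<rho>, of "inv \<rho> \<circ> \<pi>"] by auto
    then show "f (inv \<rho> \<circ> \<pi>) = 0" using f(1) by (simp add: group_algebra_def)
  qed
  ultimately show ?thesis unfolding specht_module_eq[OF \<mu>] by simp
qed

text \<open>The spanning form makes the ideal a finite-dimensional subspace, so that the basis
  chosen in \<open>trace_on\<close> exists and is finite.\<close>

lemma specht_module_span:
  assumes \<mu>: "\<mu> \<in> young_diagrams q"
  shows "specht_module \<mu> = cfun.span ((\<lambda>\<pi>. left_mult \<pi> (young_symmetrizer \<mu>)) ` Sym q)"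
proof
  show "specht_module \<mu> \<subseteq> cfun.span ((\<lambda>\<pi>. left_mult \<pi> (young_symmetrizer \<mu>)) ` Sym q)"
    unfolding specht_module_eq[OF \<mu>] convolve_young_symmetrizer[OF \<mu>]
    by (intro image_subsetI cfun.span_sum cfun.span_scale cfun.span_base imageI)
  show "cfun.span ((\<lambda>\<pi>. left_mult \<pi> (young_symmetrizer \<mu>)) ` Sym q) \<subseteq> specht_module \<mu>"
  proof
    fix v assume "v \<in> cfun.span ((\<lambda>\<pi>. left_mult \<pi> (young_symmetrizer \<mu>)) ` Sym q)"
    then show "v \<in> specht_module \<mu>"
    proof (induction rule: cfun.span_induct_alt)
      case base
      have "0 = convolve q 0 (young_symmetrizer \<mu>)" by (rule ext) (simp add: convolve_def)
      moreover have "0 \<in> group_algebra q" by (simp add: group_algebra_def)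
      ultimately show ?case unfolding specht_module_eq[OF \<mu>] by (rule image_eqI)
    next
      case (step a x y)
      from step(1) obtain \<pi> where \<pi>: "x = left_mult \<pi> (young_symmetrizer \<mu>)" "\<pi> \<in> Sym q"
        by (rule imageE)
      from step(2) obtain f where f: "y = convolve q f (young_symmetrizer \<mu>)" "f \<in> group_algebra q"
        unfolding specht_module_eq[OF \<mu>] by (rule imageE)
      have "fun_scale a x + y = convolve q (\<lambda>\<sigma>. (if \<sigma> = \<pi> then a else 0) + f \<sigma>) (young_symmetrizer \<mu>)"
        unfolding \<pi> f
        by (rule ext) (simp add: convolve_def fun_scale_def left_mult_def distrib_right sum.distrib
            if_distrib[where f = "\<lambda>x. x * _"] \<pi>(2) cong: if_cong)
      moreover have "(\<lambda>\<sigma>. (if \<sigma> = \<pi> then a else 0) + f \<sigma>) \<in> group_algebra q"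
        using f(2) \<pi>(2) by (auto simp: group_algebra_def)
      ultimately show ?case unfolding specht_module_eq[OF \<mu>] by (rule image_eqI)
    qed
  qed
qed

text \<open>The left-hand side is the product of \<open>b\<close> with the symmetrizer.\<close>

lemma specht_module_reproducing:
  assumes \<mu>: "\<mu> \<in> young_diagrams q" and b: "b \<in> specht_module \<mu>"
  shows "(\<Sum>\<pi>\<in>Sym q. fun_scale (b \<pi>) (left_mult \<pi> (young_symmetrizer \<mu>))) = fun_scale (young_hook \<mu>) b"
proof
  fix \<kappa>
  let ?c = "young_symmetrizer \<mu>"
  obtain f where f: "f \<in> group_algebra q" "b = convolve q f ?c"
    using b unfolding specht_module_eq[OF \<mu>] by (rule imageE) simp
  have b_eq: "b \<kappa> = (\<Sum>\<sigma>\<in>Sym q. f \<sigma> * ?c (inv \<sigma> \<circ> \<kappa>))" for \<kappa>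
    by (simp add: f convolve_def)
  show "(\<Sum>\<pi>\<in>Sym q. fun_scale (b \<pi>) (left_mult \<pi> ?c)) \<kappa> = fun_scale (young_hook \<mu>) b \<kappa>"
  proof (cases "\<kappa> \<in> Sym q")
    case True
    have "(\<Sum>\<pi>\<in>Sym q. fun_scale (b \<pi>) (left_mult \<pi> ?c)) \<kappa>
       = (\<Sum>\<pi>\<in>Sym q. \<Sum>\<sigma>\<in>Sym q. f \<sigma> * (?c (inv \<sigma> \<circ> \<pi>) * ?c (inv \<pi> \<circ> \<kappa>)))"
      by (simp add: sum_apply fun_scale_def left_mult_def b_eq sum_distrib_right mult.assoc)
    also have "\<dots> = (\<Sum>\<sigma>\<in>Sym q. \<Sum>\<pi>\<in>Sym q. f \<sigma> * (?c (inv \<sigma> \<circ> \<pi>) * ?c (inv \<pi> \<circ> \<kappa>)))"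
      by (rule sum.swap)
    also have "\<dots> = (\<Sum>\<sigma>\<in>Sym q. f \<sigma> * (young_hook \<mu> * ?c (inv \<sigma> \<circ> \<kappa>)))"
    proof (rule sum.cong[OF refl])
      fix \<sigma> assume \<sigma>: "\<sigma> \<in> Sym q"
      have "(\<Sum>\<pi>\<in>Sym q. ?c (inv \<sigma> \<circ> \<pi>) * ?c (inv \<pi> \<circ> \<kappa>))
          = (\<Sum>\<pi>\<in>Sym q. ?c (inv \<sigma> \<circ> (\<sigma> \<circ> \<pi>)) * ?c (inv (\<sigma> \<circ> \<pi>) \<circ> \<kappa>))"
        by (rule sum_Sym_comp_left[OF \<sigma>, symmetric, where f = "\<lambda>\<pi>. ?c (inv \<sigma> \<circ> \<pi>) * ?c (inv \<pi> \<circ> \<kappa>)"])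
      also have "\<dots> = (\<Sum>\<pi>\<in>Sym q. ?c \<pi> * ?c (inv \<pi> \<circ> (inv \<sigma> \<circ> \<kappa>)))"
        using \<sigma> by (intro sum.cong refl) (simp add: Sym_simps Sym_inv_comp[where q = q])
      also have "\<dots> = young_hook \<mu> * ?c (inv \<sigma> \<circ> \<kappa>)"
        using \<sigma> True by (intro young_symmetrizer_square[OF \<mu>]) simp
      finally show "(\<Sum>\<pi>\<in>Sym q. f \<sigma> * (?c (inv \<sigma> \<circ> \<pi>) * ?c (inv \<pi> \<circ> \<kappa>))) = f \<sigma> * (young_hook \<mu> * ?c (inv \<sigma> \<circ> \<kappa>))"
        by (simp flip: sum_distrib_left)
    qed
    also have "\<dots> = fun_scale (young_hook \<mu>) b \<kappa>"
      by (simp add: fun_scale_def b_eq sum_distrib_left mult_ac)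
    finally show ?thesis .
  next
    case False
    have "?c (inv \<sigma> \<circ> \<kappa>) = 0" if \<sigma>: "\<sigma> \<in> Sym q" for \<sigma>
    proof (rule young_symmetrizer_outside[OF \<mu>])
      have "\<sigma> \<circ> (inv \<sigma> \<circ> \<kappa>) = \<kappa>" using \<sigma> by (rule Sym_comp_inv)
      then show "inv \<sigma> \<circ> \<kappa> \<notin> Sym q" using comp_in_Sym[OF \<sigma>, of "inv \<sigma> \<circ> \<kappa>"] False by auto
    qed
    then show ?thesis by (simp add: sum_apply fun_scale_def left_mult_def b_eq)
  qed
qed

lemma left_mult_sum:
  "left_mult \<rho> (\<Sum>i\<in>I. fun_scale (a i) (F i)) = (\<Sum>i\<in>I. fun_scale (a i) (left_mult \<rho> (F i)))"
  by (rule ext) (simp add: left_mult_def sum_apply fun_scale_def)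

text \<open>The right-hand side is the trace of f \<mapsto> \<rho> f c on the whole group algebra,
  in the basis of permutations. This operator maps into the ideal and acts there as h times left
  multiplication by \<rho>, since v c = h v on the ideal; its trace is therefore h times the trace
  on the ideal.\<close>

lemma trace_on_specht_module:
  assumes \<mu>: "\<mu> \<in> young_diagrams q" and \<rho>: "\<rho> \<in> Sym q"
  shows "young_hook \<mu> * trace_on (specht_module \<mu>) (left_mult \<rho>)
    = (\<Sum>\<pi>\<in>Sym q. left_mult \<rho> (left_mult \<pi> (young_symmetrizer \<mu>)) \<pi>)"
proof -
  let ?c = "young_symmetrizer \<mu>"
  define V where "V = specht_module \<mu>"
  define B where "B = (SOME B. cfun.independent B \<and> cfun.span B = V)"
  have ex: "\<exists>B. cfun.independent B \<and> cfun.span B = V"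
  proof -
    obtain B where B: "B \<subseteq> V" "cfun.independent B" "V \<subseteq> cfun.span B"
      by (rule cfun.maximal_independent_subset)
    have "cfun.span B \<subseteq> cfun.span V" using B(1) by (rule cfun.span_mono)
    also have "cfun.span V = V" unfolding V_def specht_module_span[OF \<mu>] by (rule cfun.span_span)
    finally show ?thesis using B by blast
  qed
  have "cfun.independent B \<and> cfun.span B = V"
    unfolding B_def by (rule someI_ex[OF ex])
  then have B: "cfun.independent B" "cfun.span B = V" by simp_all
  have BV: "b \<in> V" if "b \<in> B" for b using cfun.span_base[OF that] B(2) by simp
  have finB: "finite B"
  proof -
    have "B \<subseteq> cfun.span ((\<lambda>\<pi>. left_mult \<pi> ?c) ` Sym q)"
      using BV unfolding V_def specht_module_span[OF \<mu>] by blast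
    from cfun.independent_span_bound[OF _ B(1) this] show ?thesis by simp
  qed
  define \<alpha> where "\<alpha> \<pi> b = cfun.representation B (left_mult \<pi> ?c) b" for \<pi> b
  have genV: "left_mult \<pi> ?c \<in> cfun.span B" if "\<pi> \<in> Sym q" for \<pi>
    unfolding B(2) V_def specht_module_span[OF \<mu>] using that by (intro cfun.span_base) simp
  have gen: "left_mult \<pi> ?c = (\<Sum>b\<in>B. fun_scale (\<alpha> \<pi> b) b)" if "\<pi> \<in> Sym q" for \<pi>
    unfolding \<alpha>_def by (rule cfun.sum_representation_eq[OF B(1) genV[OF that] finB order_refl, symmetric])
  define M where "M b b' = cfun.representation B (left_mult \<rho> b) b'" for b b'
  have M: "left_mult \<rho> b = (\<Sum>b'\<in>B. fun_scale (M b b') b')" if "b \<in> B" for b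
  proof -
    have "left_mult \<rho> b \<in> cfun.span B"
      unfolding B(2) V_def using BV[OF that] V_def by (intro left_mult_in_specht_module[OF \<mu> \<rho>]) simp
    then show ?thesis
      unfolding M_def by (rule cfun.sum_representation_eq[OF B(1) _ finB order_refl, symmetric])
  qed
  \<comment> \<open>Coordinate b of the reproducing identity for b': pairing with the coefficients
    \<alpha> is h times the dual basis of B.\<close>
  have dual: "(\<Sum>\<pi>\<in>Sym q. b' \<pi> * \<alpha> \<pi> b) = young_hook \<mu> * (if b = b' then 1 else 0)"
    if "b \<in> B" "b' \<in> B" for b b'
  proof -
    have "cfun.representation B (\<Sum>\<pi>\<in>Sym q. fun_scale (b' \<pi>) (left_mult \<pi> ?c)) b
        = (\<Sum>\<pi>\<in>Sym q. cfun.representation B (fun_scale (b' \<pi>) (left_mult \<pi> ?c)) b)"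
      using genV by (subst cfun.representation_sum[OF B(1)]) (auto intro: cfun.span_scale)
    also have "\<dots> = (\<Sum>\<pi>\<in>Sym q. b' \<pi> * \<alpha> \<pi> b)"
      using genV by (intro sum.cong refl) (simp add: cfun.representation_scale[OF B(1)] \<alpha>_def)
    also have "cfun.representation B (\<Sum>\<pi>\<in>Sym q. fun_scale (b' \<pi>) (left_mult \<pi> ?c)) b
        = cfun.representation B (fun_scale (young_hook \<mu>) b') b"
      using specht_module_reproducing[OF \<mu>, of b'] BV[OF that(2)] V_def by simp
    also have "\<dots> = young_hook \<mu> * cfun.representation B b' b"
      by (simp add: cfun.representation_scale[OF B(1) cfun.span_base[OF that(2)]])
    also have "cfun.representation B b' b = (if b = b' then 1 else 0)"
      by (simp add: cfun.representation_basis[OF B(1) that(2)])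
    finally show ?thesis by simp
  qed
  have "(\<Sum>\<pi>\<in>Sym q. left_mult \<rho> (left_mult \<pi> ?c) \<pi>)
      = (\<Sum>\<pi>\<in>Sym q. \<Sum>b\<in>B. \<Sum>b'\<in>B. M b b' * (b' \<pi> * \<alpha> \<pi> b))"
  proof (rule sum.cong[OF refl])
    fix \<pi> assume \<pi>: "\<pi> \<in> Sym q"
    have "left_mult \<rho> (left_mult \<pi> ?c) = (\<Sum>b\<in>B. fun_scale (\<alpha> \<pi> b) (left_mult \<rho> b))"
      unfolding gen[OF \<pi>] by (rule left_mult_sum)
    also have "\<dots> = (\<Sum>b\<in>B. fun_scale (\<alpha> \<pi> b) (\<Sum>b'\<in>B. fun_scale (M b b') b'))"
      using M by (intro sum.cong refl) simp
    finally show "left_mult \<rho> (left_mult \<pi> ?c) \<pi> = (\<Sum>b\<in>B. \<Sum>b'\<in>B. M b b' * (b' \<pi> * \<alpha> \<pi> b))"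
      by (simp add: sum_apply fun_scale_def sum_distrib_left mult_ac)
  qed
  also have "\<dots> = (\<Sum>b\<in>B. \<Sum>\<pi>\<in>Sym q. \<Sum>b'\<in>B. M b b' * (b' \<pi> * \<alpha> \<pi> b))"
    by (rule sum.swap)
  also have "\<dots> = (\<Sum>b\<in>B. \<Sum>b'\<in>B. \<Sum>\<pi>\<in>Sym q. M b b' * (b' \<pi> * \<alpha> \<pi> b))"
    by (rule sum.cong[OF refl], rule sum.swap)
  also have "\<dots> = (\<Sum>b\<in>B. \<Sum>b'\<in>B. M b b' * (young_hook \<mu> * (if b = b' then 1 else 0)))"
    by (intro sum.cong refl) (simp only: sum_distrib_left[symmetric] dual)
  also have "\<dots> = (\<Sum>b\<in>B. young_hook \<mu> * M b b)"
    using finB by (intro sum.cong refl) (simp add: if_distrib cong: if_cong)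
  also have "\<dots> = young_hook \<mu> * trace_on (specht_module \<mu>) (left_mult \<rho>)"
    unfolding trace_on_def Let_def M_def B_def V_def by (simp add: sum_distrib_left)
  finally show ?thesis by simp
qed

text \<open>The trace formula yields h times the character as q! times the averaged symmetrizer;
  dividing by the case of the identity cancels both h and q!.\<close>

lemma norm_char_eq_young_char:
  assumes \<mu>: "\<mu> \<in> young_diagrams q" and \<rho>: "\<rho> \<in> Sym q"
  shows "norm_char \<mu> \<rho> = young_char \<mu> \<rho>"
proof -
  have *: "young_hook \<mu> * irr_char \<mu> \<rho> = fact q * young_char \<mu> \<rho>" if \<rho>: "\<rho> \<in> Sym q" for \<rho>
  proof -
    have "(\<Sum>\<pi>\<in>Sym q. left_mult \<rho> (left_mult \<pi> (young_symmetrizer \<mu>)) \<pi>)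
        = (\<Sum>\<pi>\<in>Sym q. young_symmetrizer \<mu> (inv \<pi> \<circ> inv \<rho> \<circ> inv (inv \<pi>)))"
      by (intro sum.cong refl) (simp add: left_mult_def Sym_simps)
    also have "\<dots> = (\<Sum>\<pi>\<in>Sym q. young_symmetrizer \<mu> (\<pi> \<circ> inv \<rho> \<circ> inv \<pi>))"
      by (rule sum_Sym_inv[where f = "\<lambda>\<pi>. young_symmetrizer \<mu> (\<pi> \<circ> inv \<rho> \<circ> inv \<pi>)"])
    also have "\<dots> = fact q * young_char \<mu> (inv \<rho>)"
      by (simp add: young_char_eq[OF \<mu>] conj_avg_def)
    finally show ?thesis
      unfolding irr_char_def trace_on_specht_module[OF \<mu> \<rho>] young_char_inv[OF \<mu> \<rho>] .
  qed
  have "young_hook \<mu> \<noteq> 0" by (rule young_hook_nonzero[OF \<mu>])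
  moreover have "young_hook \<mu> * irr_char \<mu> id = fact q" using *[OF id_in_Sym(1)] by (simp add: young_char_id[OF \<mu>])
  ultimately have "irr_char \<mu> id = fact q / young_hook \<mu>" by (simp add: field_simps)
  moreover have "irr_char \<mu> \<rho> = fact q * young_char \<mu> \<rho> / young_hook \<mu>"
    using *[OF \<rho>] \<open>young_hook \<mu> \<noteq> 0\<close> by (simp add: field_simps)
  ultimately show ?thesis using \<open>young_hook \<mu> \<noteq> 0\<close> by (simp add: norm_char_def)
qed

section \<open>Cycle types and conjugacy\<close>

text \<open>The powers of f at x repeat exactly with the length of the cycle of x. This makes the
  transport of powers between cycles of equal length well defined.\<close>

lemma funpow_eq_iff_mod_card_orbit:
  assumes "permutation f"
  shows "(f ^^ n) x = (f ^^ m) x \<longleftrightarrow> n mod card (orbit f x) = m mod card (orbit f x)"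
proof -
  define p where "p = funpow_dist1 f x x"
  have x: "x \<in> orbit f x" using assms by (rule permutation_self_in_orbit)
  have inj: "inj_on (\<lambda>n. (f ^^ n) x) {0..<p}"
    unfolding p_def using x by (rule inj_on_funpow_dist1)
  have "orbit f x = (\<lambda>n. (f ^^ n) x) ` {0..<p}"
    unfolding p_def using x by (rule orbit_conv_funpow_dist1)
  then have card: "card (orbit f x) = p" using inj by (simp add: card_image)
  have "(f ^^ p) x = x" unfolding p_def using x by (rule funpow_dist1_prop)
  then have mod: "(f ^^ (n mod p)) x = (f ^^ n) x" for n by (rule funpow_mod_eq)
  have "p > 0" unfolding p_def by simp
  have "(f ^^ n) x = (f ^^ m) x \<longleftrightarrow> (f ^^ (n mod p)) x = (f ^^ (m mod p)) x"
    by (simp only: mod)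
  also have "\<dots> \<longleftrightarrow> n mod p = m mod p"
    using inj_on_eq_iff[OF inj] \<open>p > 0\<close> by simp
  finally show ?thesis by (simp only: card)
qed

lemma orbit_eq_of_mem:
  assumes "permutation f" "y \<in> orbit f x"
  shows "orbit f y = orbit f x"
proof
  show "orbit f y \<subseteq> orbit f x" using assms(2) by (auto intro: orbit_trans)
  have "x \<in> orbit f y"
    using orbit_swap[OF permutation_self_in_orbit[OF assms(1)] assms(2)] .
  then show "orbit f x \<subseteq> orbit f y" by (auto intro: orbit_trans)
qed

text \<open>Fix a base point in every cycle and send \<sigma>^n of a base point to \<tau>^n of the
  base point of the matched cycle. Equal cycle lengths make this well defined, and the map
  intertwines \<sigma> with \<tau>.\<close>

lemma conjugate_if_orbit_bij:
  assumes S: "\<sigma> permutes S" "\<tau> permutes S" "finite S"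
    and g: "bij_betw g (orbit \<sigma> ` S) (orbit \<tau> ` S)"
    and card: "\<And>X. X \<in> orbit \<sigma> ` S \<Longrightarrow> card (g X) = card X"
  obtains \<pi> where "\<pi> permutes S" "\<tau> = \<pi> \<circ> \<sigma> \<circ> inv \<pi>"
proof -
  have perm: "permutation \<sigma>" "permutation \<tau>" using S by (auto simp: permutation_permutes)
  define r where "r f X = (SOME x. x \<in> S \<and> orbit f x = X)" for f :: "'a \<Rightarrow> 'a" and X
  have r: "r f X \<in> S \<and> orbit f (r f X) = X" if "X \<in> orbit f ` S" for f X
    unfolding r_def by (rule someI_ex) (use that in blast)
  \<comment> \<open>Any exponent reaching x from its base point; only its residue modulo the cycle
    length matters.\<close>
  define N where "N x = (SOME n. (\<sigma> ^^ n) (r \<sigma> (orbit \<sigma> x)) = x)" for x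
  define h where "h x = (\<tau> ^^ N x) (r \<tau> (g (orbit \<sigma> x)))" for x
  have gX: "g X \<in> orbit \<tau> ` S" if "X \<in> orbit \<sigma> ` S" for X
    using g that by (rule bij_betw_apply)
  have h_eq: "h ((\<sigma> ^^ n) (r \<sigma> X)) = (\<tau> ^^ n) (r \<tau> (g X))" if X: "X \<in> orbit \<sigma> ` S" for n X
  proof -
    let ?x = "(\<sigma> ^^ n) (r \<sigma> X)"
    have "?x \<in> orbit \<sigma> (r \<sigma> X)" unfolding orbit_altdef_permutation[OF perm(1)] by blast
    then have o: "orbit \<sigma> ?x = X" using orbit_eq_of_mem[OF perm(1)] r[OF X] by blast
    have "(\<sigma> ^^ N ?x) (r \<sigma> X) = ?x"
      unfolding N_def o by (rule someI[of "\<lambda>k. (\<sigma> ^^ k) (r \<sigma> X) = ?x" n]) simp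
    then have "N ?x mod card X = n mod card X"
      using funpow_eq_iff_mod_card_orbit[OF perm(1), of "N ?x" "r \<sigma> X" n] r[OF X] by simp
    then have "(\<tau> ^^ N ?x) (r \<tau> (g X)) = (\<tau> ^^ n) (r \<tau> (g X))"
      using funpow_eq_iff_mod_card_orbit[OF perm(2), of "N ?x" "r \<tau> (g X)" n] r[OF gX[OF X]] card[OF X]
      by simp
    then show ?thesis unfolding h_def o .
  qed
  have rep: "\<exists>n. x = (\<sigma> ^^ n) (r \<sigma> (orbit \<sigma> x))" if "x \<in> S" for x
  proof -
    have "orbit \<sigma> (r \<sigma> (orbit \<sigma> x)) = orbit \<sigma> x" using r[of "orbit \<sigma> x" \<sigma>] that by blast
    moreover have "x \<in> orbit \<sigma> x" using perm(1) by (rule permutation_self_in_orbit)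
    ultimately have "x \<in> orbit \<sigma> (r \<sigma> (orbit \<sigma> x))" by simp
    then show ?thesis unfolding orbit_altdef_permutation[OF perm(1)] by blast
  qed
  have comm: "h (\<sigma> x) = \<tau> (h x)" if "x \<in> S" for x
  proof -
    from rep[OF that] obtain n where n: "x = (\<sigma> ^^ n) (r \<sigma> (orbit \<sigma> x))" by blast
    have X: "orbit \<sigma> x \<in> orbit \<sigma> ` S" using that by blast
    have "\<sigma> x = (\<sigma> ^^ Suc n) (r \<sigma> (orbit \<sigma> x))" using arg_cong[OF n, of \<sigma>] by simp
    then have "h (\<sigma> x) = (\<tau> ^^ Suc n) (r \<tau> (g (orbit \<sigma> x)))" using h_eq[OF X] by metis
    moreover have "h x = (\<tau> ^^ n) (r \<tau> (g (orbit \<sigma> x)))" using h_eq[OF X, of n] n by metis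
    ultimately show ?thesis by simp
  qed
  have funpow_in: "(f ^^ n) y \<in> S" if "f permutes S" "y \<in> S" for f n y
    using that by (induction n) (auto simp: permutes_in_image)
  have surj: "h ` S = S"
  proof
    show "h ` S \<subseteq> S"
    proof
      fix y assume "y \<in> h ` S"
      then obtain x where x: "x \<in> S" "y = h x" by blast
      then have "r \<tau> (g (orbit \<sigma> x)) \<in> S" using r[OF gX] by blast
      then show "y \<in> S" unfolding x(2) h_def by (rule funpow_in[OF S(2)])
    qed
    show "S \<subseteq> h ` S"
    proof
      fix y assume y: "y \<in> S"
      then have "orbit \<tau> y \<in> g ` (orbit \<sigma> ` S)" using g by (simp add: bij_betw_def)
      then obtain X where X: "X \<in> orbit \<sigma> ` S" "orbit \<tau> y = g X" by blast
      have "y \<in> orbit \<tau> (r \<tau> (g X))"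
        using r[OF gX[OF X(1)]] permutation_self_in_orbit[OF perm(2), of y] X(2) by simp
      then obtain n where "y = (\<tau> ^^ n) (r \<tau> (g X))"
        unfolding orbit_altdef_permutation[OF perm(2)] by blast
      then have "y = h ((\<sigma> ^^ n) (r \<sigma> X))" using h_eq[OF X(1)] by simp
      moreover have "(\<sigma> ^^ n) (r \<sigma> X) \<in> S" using r[OF X(1)] funpow_in[OF S(1)] by blast
      ultimately show "y \<in> h ` S" by blast
    qed
  qed
  define \<pi> where "\<pi> x = (if x \<in> S then h x else x)" for x
  have "\<pi> ` S = S" using surj by (simp add: \<pi>_def)
  then have "bij_betw \<pi> S S"
    using S(3) by (simp add: bij_betw_def finite_surj_inj)
  then have \<pi>: "\<pi> permutes S" by (rule bij_imp_permutes) (simp add: \<pi>_def)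
  have "\<pi> \<circ> \<sigma> = \<tau> \<circ> \<pi>"
  proof
    fix x
    show "(\<pi> \<circ> \<sigma>) x = (\<tau> \<circ> \<pi>) x"
    proof (cases "x \<in> S")
      case True
      then have "\<sigma> x \<in> S" using S(1) by (simp add: permutes_in_image)
      then show ?thesis using comm[OF True] True by (simp add: \<pi>_def)
    next
      case False
      then have "\<sigma> x = x" "\<tau> x = x" using S by (simp_all add: permutes_not_in)
      then show ?thesis using False by (simp add: \<pi>_def)
    qed
  qed
  then have "\<pi> \<circ> \<sigma> \<circ> inv \<pi> = \<tau> \<circ> (\<pi> \<circ> inv \<pi>)" by (simp add: comp_assoc)
  also have "\<dots> = \<tau>" using permutes_inv_o(1)[OF \<pi>] by simp
  finally show thesis using that[OF \<pi>] by simp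
qed

lemma image_mset_eq_bij:
  assumes "finite A" "finite B" "image_mset f (mset_set A) = image_mset g (mset_set B)"
  shows "\<exists>h. bij_betw h A B \<and> (\<forall>a\<in>A. g (h a) = f a)"
  using assms
proof (induction A arbitrary: B rule: finite_induct)
  case empty
  then have "mset_set B = {#}" by simp
  then have "B = {}" using empty(1) by (simp add: mset_set_empty_iff)
  then show ?case by (simp add: bij_betw_def)
next
  case (insert a A)
  have "f a \<in># image_mset g (mset_set B)"
    using insert.hyps by (simp flip: insert.prems(2))
  then obtain b where b: "b \<in> B" "g b = f a" using insert.prems(1) by auto
  have "mset_set B = add_mset b (mset_set (B - {b}))"
    using b(1) insert.prems(1) by (simp add: mset_set.remove)
  then have "image_mset f (mset_set A) = image_mset g (mset_set (B - {b}))"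
    using insert.prems(2) insert.hyps b(2) by simp
  then obtain h where h: "bij_betw h A (B - {b})" "\<forall>x\<in>A. g (h x) = f x"
    using insert.IH[of "B - {b}"] insert.prems(1) by auto
  have "bij_betw (h(a := b)) A (B - {b})"
    using h(1) insert.hyps(2) by (subst bij_betw_cong[of A "h(a := b)" h]) auto
  then have "bij_betw (h(a := b)) (insert a A) (insert b (B - {b}))"
    using bij_betw_combine[of "h(a := b)" A "B - {b}" "{a}" "{b}"] by (simp add: bij_betw_def)
  moreover have "insert b (B - {b}) = B" using b(1) by blast
  moreover have "\<forall>x\<in>insert a A. g ((h(a := b)) x) = f x" using h(2) b(2) insert.hyps(2) by auto
  ultimately show ?case by auto
qed

text \<open>A decreasing list, so that cycle types are themselves members of
  \<open>young_diagrams q\<close> and there are at most as many of them as diagrams.\<close>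

definition cycle_type :: "nat \<Rightarrow> perm \<Rightarrow> nat list" where
  "cycle_type q \<rho> = rev (sorted_list_of_multiset (image_mset card (mset_set (orbit \<rho> ` {1..q}))))"

lemma conjugate_if_cycle_type_eq:
  assumes "\<sigma> \<in> Sym q" "\<tau> \<in> Sym q" "cycle_type q \<sigma> = cycle_type q \<tau>"
  obtains \<pi> where "\<pi> \<in> Sym q" "\<tau> = \<pi> \<circ> \<sigma> \<circ> inv \<pi>"
proof -
  have "image_mset card (mset_set (orbit \<sigma> ` {1..q})) = image_mset card (mset_set (orbit \<tau> ` {1..q}))"
    using assms(3) unfolding cycle_type_def rev_is_rev_conv by (metis mset_sorted_list_of_multiset)
  then obtain h where h: "bij_betw h (orbit \<sigma> ` {1..q}) (orbit \<tau> ` {1..q})"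
      "\<forall>X\<in>orbit \<sigma> ` {1..q}. card (h X) = card X"
    using image_mset_eq_bij[of "orbit \<sigma> ` {1..q}" "orbit \<tau> ` {1..q}" card card] by auto
  obtain \<pi> where "\<pi> permutes {1..q}" "\<tau> = \<pi> \<circ> \<sigma> \<circ> inv \<pi>"
    using conjugate_if_orbit_bij[OF Sym_permutes[OF assms(1)] Sym_permutes[OF assms(2)] _ h(1)] h(2) by auto
  then show thesis using that by (simp add: Sym_def)
qed

lemma orbit_subset_Sym: "\<rho> \<in> Sym q \<Longrightarrow> x \<in> {1..q} \<Longrightarrow> orbit \<rho> x \<subseteq> {1..q}"
  by (rule permutes_orbit_subset[OF Sym_permutes])

lemma sum_card_orbits:
  assumes "\<rho> \<in> Sym q"
  shows "(\<Sum>X\<in>orbit \<rho> ` {1..q}. card X) = q"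
proof -
  have perm: "permutation \<rho>" using assms by (rule Sym_permutation)
  have "\<Union> (orbit \<rho> ` {1..q}) = {1..q}"
    using orbit_subset_Sym[OF assms] permutation_self_in_orbit[OF perm] by blast
  moreover have "card (\<Union> (orbit \<rho> ` {1..q})) = (\<Sum>X\<in>orbit \<rho> ` {1..q}. card X)"
  proof (rule card_Union_disjoint)
    show "pairwise disjnt (orbit \<rho> ` {1..q})"
    proof (rule pairwiseI)
      fix X Y assume "X \<in> orbit \<rho> ` {1..q}" "Y \<in> orbit \<rho> ` {1..q}" "X \<noteq> Y"
      then obtain x y where "X = orbit \<rho> x" "Y = orbit \<rho> y" by blast
      then show "disjnt X Y"
        using orbit_eq_of_mem[OF perm, of _ x] orbit_eq_of_mem[OF perm, of _ y] \<open>X \<noteq> Y\<close>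
        unfolding disjnt_iff by metis
    qed
    show "finite X" if "X \<in> orbit \<rho> ` {1..q}" for X
      using that orbit_subset_Sym[OF assms] finite_subset[of X "{1..q}"] by auto
  qed
  ultimately show ?thesis by simp
qed

lemma cycle_type_young_diagram:
  assumes "\<rho> \<in> Sym q"
  shows "cycle_type q \<rho> \<in> young_diagrams q"
proof -
  have perm: "permutation \<rho>" using assms by (rule Sym_permutation)
  let ?M = "image_mset card (mset_set (orbit \<rho> ` {1..q}))"
  have "sum_list (cycle_type q \<rho>) = sum_mset ?M"
    unfolding cycle_type_def sum_list_rev by (metis mset_sorted_list_of_multiset sum_mset_sum_list)
  also have "\<dots> = q" using sum_card_orbits[OF assms] by (simp add: sum_unfold_sum_mset)
  finally have 1: "sum_list (cycle_type q \<rho>) = q" .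
  have "card (orbit \<rho> x) \<noteq> 0" if "x \<in> {1..q}" for x
    using orbit_subset_Sym[OF assms that] permutation_self_in_orbit[OF perm, of x]
      finite_subset[of "orbit \<rho> x" "{1..q}"] by auto
  then have 2: "0 \<notin> set (cycle_type q \<rho>)" by (fastforce simp: cycle_type_def)
  have 3: "sorted_wrt (\<ge>) (cycle_type q \<rho>)"
    unfolding cycle_type_def sorted_wrt_rev by simp
  from 1 2 3 show ?thesis by (simp add: young_diagrams_def)
qed

section \<open>Expansion of central functions\<close>

lemma finite_young_diagrams [simp]: "finite (young_diagrams q)"
proof (rule finite_subset)
  show "young_diagrams q \<subseteq> {xs. set xs \<subseteq> {..q} \<and> length xs \<le> q}"
  proof
    fix \<mu> assume \<mu>: "\<mu> \<in> young_diagrams q"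
    have len: "length xs \<le> sum_list xs" if "0 \<notin> set xs" for xs :: "nat list"
      using that by (induction xs) auto
    show "\<mu> \<in> {xs. set xs \<subseteq> {..q} \<and> length xs \<le> q}"
      using \<mu> len[of \<mu>] member_le_sum_list[of _ \<mu>] by (auto simp: young_diagrams_def)
  qed
qed (simp add: finite_lists_length_le)

text \<open>Linear algebra takes place among all functions of type
  \<open>perm \<Rightarrow> complex\<close>, while class functions are controlled only on
  \<open>Sym q\<close>. Cutting off to 0 turns equality on \<open>Sym q\<close> into equality of
  vectors.\<close>

definition restrict_Sym :: "nat \<Rightarrow> (perm \<Rightarrow> complex) \<Rightarrow> perm \<Rightarrow> complex" where
  "restrict_Sym q f = (\<lambda>\<rho>. if \<rho> \<in> Sym q then f \<rho> else 0)"

definition type_indicator :: "nat \<Rightarrow> nat list \<Rightarrow> perm \<Rightarrow> complex" where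
  "type_indicator q t = (\<lambda>\<rho>. if \<rho> \<in> Sym q \<and> cycle_type q \<rho> = t then 1 else 0)"

lemma central_in_span_type_indicator:
  assumes "central_fun q f"
  shows "restrict_Sym q f \<in> cfun.span (type_indicator q ` young_diagrams q)"
proof -
  \<comment> \<open>For a type without a permutation this would be an arbitrary value, multiplied
    below by an indicator that is identically 0.\<close>
  define v where "v t = f (SOME \<rho>. \<rho> \<in> Sym q \<and> cycle_type q \<rho> = t)" for t
  have v: "v (cycle_type q \<rho>) = f \<rho>" if \<rho>: "\<rho> \<in> Sym q" for \<rho>
  proof -
    let ?\<sigma> = "SOME \<sigma>. \<sigma> \<in> Sym q \<and> cycle_type q \<sigma> = cycle_type q \<rho>"
    have \<sigma>: "?\<sigma> \<in> Sym q \<and> cycle_type q ?\<sigma> = cycle_type q \<rho>"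
      by (rule someI[of _ \<rho>]) (simp add: \<rho>)
    then obtain \<pi> where "\<pi> \<in> Sym q" "\<rho> = \<pi> \<circ> ?\<sigma> \<circ> inv \<pi>"
      using conjugate_if_cycle_type_eq[of ?\<sigma> q \<rho>] \<rho> by blast
    then show ?thesis using assms \<sigma> unfolding central_fun_def v_def by metis
  qed
  have "restrict_Sym q f = (\<Sum>t\<in>young_diagrams q. fun_scale (v t) (type_indicator q t))"
  proof
    fix \<rho>
    show "restrict_Sym q f \<rho> = (\<Sum>t\<in>young_diagrams q. fun_scale (v t) (type_indicator q t)) \<rho>"
    proof (cases "\<rho> \<in> Sym q")
      case True
      have "(\<Sum>t\<in>young_diagrams q. fun_scale (v t) (type_indicator q t)) \<rho>
          = (\<Sum>t\<in>young_diagrams q. if cycle_type q \<rho> = t then v t else 0)"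
        by (simp add: True sum_apply fun_scale_def type_indicator_def if_distrib[where f = "\<lambda>x. _ * x"] cong: if_cong)
      also have "\<dots> = v (cycle_type q \<rho>)"
        using cycle_type_young_diagram[OF True] by simp
      finally show ?thesis using v[OF True] True by (simp add: restrict_Sym_def)
    qed (simp add: sum_apply fun_scale_def type_indicator_def restrict_Sym_def)
  qed
  then show ?thesis by (simp only:) (intro cfun.span_sum cfun.span_scale cfun.span_base imageI)
qed

text \<open>Orthogonality isolates the coefficient of \<nu>. This serves both the independence of
  the characters and the uniqueness of the measure.\<close>

lemma sum_young_char_times:
  assumes "\<nu> \<in> young_diagrams q"
  shows "(\<Sum>\<rho>\<in>Sym q. (\<Sum>\<mu>\<in>young_diagrams q. p \<mu> * young_char \<mu> \<rho>) * young_char \<nu> \<rho>)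
    = p \<nu> * of_real (young_norm \<nu>)"
proof -
  have "(\<Sum>\<rho>\<in>Sym q. (\<Sum>\<mu>\<in>young_diagrams q. p \<mu> * young_char \<mu> \<rho>) * young_char \<nu> \<rho>)
     = (\<Sum>\<rho>\<in>Sym q. \<Sum>\<mu>\<in>young_diagrams q. p \<mu> * (young_char \<mu> \<rho> * young_char \<nu> \<rho>))"
    by (simp add: sum_distrib_right mult.assoc)
  also have "\<dots> = (\<Sum>\<mu>\<in>young_diagrams q. p \<mu> * (\<Sum>\<rho>\<in>Sym q. young_char \<mu> \<rho> * young_char \<nu> \<rho>))"
    by (subst sum.swap) (simp add: sum_distrib_left)
  also have "\<dots> = (\<Sum>\<mu>\<in>young_diagrams q. if \<mu> = \<nu> then p \<nu> * of_real (young_norm \<nu>) else 0)"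
    using young_char_orthogonal[OF _ assms] young_norm[OF assms] by (intro sum.cong) auto
  also have "\<dots> = p \<nu> * of_real (young_norm \<nu>)" using assms by simp
  finally show ?thesis .
qed

text \<open>
  The characters are independent and as many as the Young diagrams, while the cycle types, hence
  the conjugacy classes, are at most as many.
\<close>

lemma central_fun_expansion:
  assumes "central_fun q f"
  obtains p where "\<forall>\<rho>\<in>Sym q. f \<rho> = (\<Sum>\<mu>\<in>young_diagrams q. p \<mu> * young_char \<mu> \<rho>)"
proof -
  let ?Y = "young_diagrams q"
  define X where "X \<mu> = restrict_Sym q (young_char \<mu>)" for \<mu>
  have X_apply: "X \<mu> \<rho> = young_char \<mu> \<rho>" if "\<rho> \<in> Sym q" for \<mu> \<rho>
    using that by (simp add: X_def restrict_Sym_def)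
  have norm0: "complex_of_real (young_norm \<mu>) \<noteq> 0" if "\<mu> \<in> ?Y" for \<mu>
    using young_norm_pos[OF that] by simp
  have zero: "p \<nu> = 0" if "(\<Sum>\<mu>\<in>?Y. fun_scale (p \<mu>) (X \<mu>)) = 0" "\<nu> \<in> ?Y" for p \<nu>
  proof -
    have "(\<Sum>\<mu>\<in>?Y. p \<mu> * young_char \<mu> \<rho>) = 0" if "\<rho> \<in> Sym q" for \<rho>
      using fun_cong[OF \<open>(\<Sum>\<mu>\<in>?Y. fun_scale (p \<mu>) (X \<mu>)) = 0\<close>, of \<rho>] that
      by (simp add: sum_apply fun_scale_def X_def restrict_Sym_def)
    then have "p \<nu> * of_real (young_norm \<nu>) = 0"
      using sum_young_char_times[OF that(2), of p] by simp
    then show ?thesis using norm0[OF that(2)] by simp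
  qed
  have inj: "inj_on X ?Y"
  proof (rule inj_onI, rule ccontr)
    fix \<mu> \<nu> assume *: "\<mu> \<in> ?Y" "\<nu> \<in> ?Y" "X \<mu> = X \<nu>" "\<mu> \<noteq> \<nu>"
    \<comment> \<open>Equal characters of different diagrams would satisfy the relation with
      coefficients 1 and -1, which \<open>zero\<close> excludes.\<close>
    have "(\<Sum>\<kappa>\<in>?Y. fun_scale ((if \<kappa> = \<mu> then 1 else 0) - (if \<kappa> = \<nu> then 1 else 0)) (X \<kappa>)) = 0"
    proof
      fix \<rho>
      show "(\<Sum>\<kappa>\<in>?Y. fun_scale ((if \<kappa> = \<mu> then 1 else 0) - (if \<kappa> = \<nu> then 1 else 0)) (X \<kappa>)) \<rho> = 0 \<rho>"
        using * by (simp add: sum_apply fun_scale_def left_diff_distrib sum_subtractf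
            if_distrib[where f = "\<lambda>x. x * _"] cong: if_cong)
    qed
    from zero[OF this *(1)] *(4) show False by simp
  qed
  have indep: "cfun.independent (X ` ?Y)"
  proof (rule cfun.independent_if_scalars_zero)
    fix u x assume "(\<Sum>x\<in>X ` ?Y. fun_scale (u x) x) = 0" "x \<in> X ` ?Y"
    then show "u x = 0" using zero[of "\<lambda>\<mu>. u (X \<mu>)"] by (auto simp: sum.reindex[OF inj])
  qed simp
  have sub: "X ` ?Y \<subseteq> cfun.span (type_indicator q ` ?Y)"
    using central_in_span_type_indicator central_conj_avg unfolding X_def
    by (auto simp: young_char_eq)
  have "restrict_Sym q f \<in> cfun.span (X ` ?Y)"
  proof (rule ccontr)
    assume n: "restrict_Sym q f \<notin> cfun.span (X ` ?Y)"
    then have i: "cfun.independent (insert (restrict_Sym q f) (X ` ?Y))"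
      using indep by (rule cfun.independent_insertI)
    have "insert (restrict_Sym q f) (X ` ?Y) \<subseteq> cfun.span (type_indicator q ` ?Y)"
      using sub central_in_span_type_indicator[OF assms] by simp
    then have "card (insert (restrict_Sym q f) (X ` ?Y)) \<le> card (type_indicator q ` ?Y)"
      using cfun.independent_span_bound[OF _ i] by simp
    also have "\<dots> \<le> card ?Y" by (rule card_image_le) simp
    also have "\<dots> = card (X ` ?Y)" using inj by (simp add: card_image)
    finally have "restrict_Sym q f \<in> X ` ?Y" by (simp add: card_insert_if split: if_splits)
    then show False using n cfun.span_base[of "restrict_Sym q f" "X ` ?Y"] by simp
  qed
  then obtain u where u: "restrict_Sym q f = (\<Sum>x\<in>X ` ?Y. fun_scale (u x) x)"
    by (subst (asm) cfun.span_finite) auto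
  have u': "restrict_Sym q f = (\<Sum>\<mu>\<in>?Y. fun_scale (u (X \<mu>)) (X \<mu>))"
    unfolding u sum.reindex[OF inj] by (simp only: o_def)
  show thesis
  proof (rule that[of "\<lambda>\<mu>. u (X \<mu>)"], rule ballI)
    fix \<rho> assume \<rho>: "\<rho> \<in> Sym q"
    show "f \<rho> = (\<Sum>\<mu>\<in>?Y. u (X \<mu>) * young_char \<mu> \<rho>)"
      using fun_cong[OF u', of \<rho>] X_apply[OF \<rho>] \<rho>
      by (simp add: sum_apply fun_scale_def restrict_Sym_def)
  qed
qed

section \<open>Positive definiteness and the measure on Young diagrams\<close>

lemma young_char_convolution:
  assumes \<mu>: "\<mu> \<in> young_diagrams q" and \<nu>: "\<nu> \<in> young_diagrams q" and \<sigma>: "\<sigma> \<in> Sym q"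
  shows "(\<Sum>\<rho>\<in>Sym q. young_char \<mu> \<rho> * young_char \<nu> (inv \<sigma> \<circ> \<rho>))
    = young_char \<nu> \<sigma> * (\<Sum>\<rho>\<in>Sym q. young_char \<mu> \<rho> * young_char \<nu> \<rho>)"
proof -
  \<comment> \<open>Averaging over conjugations of the summation variable creates the sum of
    \<open>young_char_mult\<close>, with inv \<sigma> as its second argument.\<close>
  have "fact q * (\<Sum>\<rho>\<in>Sym q. young_char \<mu> \<rho> * young_char \<nu> (inv \<sigma> \<circ> \<rho>))
      = (\<Sum>\<pi>\<in>Sym q. \<Sum>\<rho>\<in>Sym q. young_char \<mu> \<rho> * young_char \<nu> (inv \<sigma> \<circ> \<rho>))"
    by (simp add: card_Sym)
  also have "\<dots> = (\<Sum>\<pi>\<in>Sym q. \<Sum>\<rho>\<in>Sym q. young_char \<mu> (\<pi> \<circ> \<rho> \<circ> inv \<pi>) * young_char \<nu> (inv \<sigma> \<circ> (\<pi> \<circ> \<rho> \<circ> inv \<pi>)))"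
    by (rule sum.cong[OF refl], rule sum_Sym_conj[symmetric, where f = "\<lambda>\<rho>. young_char \<mu> \<rho> * young_char \<nu> (inv \<sigma> \<circ> \<rho>)"])
  also have "\<dots> = (\<Sum>\<pi>\<in>Sym q. \<Sum>\<rho>\<in>Sym q. young_char \<mu> \<rho> * young_char \<nu> (\<pi> \<circ> \<rho> \<circ> inv \<pi> \<circ> inv \<sigma>))"
  proof (intro sum.cong refl)
    fix \<pi> \<rho> assume S: "\<pi> \<in> Sym q" "\<rho> \<in> Sym q"
    have "inv \<sigma> \<circ> (\<pi> \<circ> \<rho> \<circ> inv \<pi>) = inv \<sigma> \<circ> (\<pi> \<circ> \<rho> \<circ> inv \<pi> \<circ> inv \<sigma>) \<circ> inv (inv \<sigma>)"
      using \<sigma> by (simp add: Sym_simps)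
    then have "young_char \<nu> (inv \<sigma> \<circ> (\<pi> \<circ> \<rho> \<circ> inv \<pi>)) = young_char \<nu> (\<pi> \<circ> \<rho> \<circ> inv \<pi> \<circ> inv \<sigma>)"
      using young_char_conj[OF \<nu>, of "inv \<sigma>" "\<pi> \<circ> \<rho> \<circ> inv \<pi> \<circ> inv \<sigma>"] S \<sigma> by simp
    then show "young_char \<mu> (\<pi> \<circ> \<rho> \<circ> inv \<pi>) * young_char \<nu> (inv \<sigma> \<circ> (\<pi> \<circ> \<rho> \<circ> inv \<pi>))
       = young_char \<mu> \<rho> * young_char \<nu> (\<pi> \<circ> \<rho> \<circ> inv \<pi> \<circ> inv \<sigma>)"
      using young_char_conj[OF \<mu> S] by simp
  qed
  also have "\<dots> = (\<Sum>\<rho>\<in>Sym q. young_char \<mu> \<rho> * (\<Sum>\<pi>\<in>Sym q. young_char \<nu> (\<pi> \<circ> \<rho> \<circ> inv \<pi> \<circ> inv \<sigma>)))"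
    by (subst sum.swap) (simp add: sum_distrib_left)
  also have "\<dots> = (\<Sum>\<rho>\<in>Sym q. young_char \<mu> \<rho> * (fact q * (young_char \<nu> \<rho> * young_char \<nu> \<sigma>)))"
    using \<sigma> by (intro sum.cong refl) (simp add: young_char_mult[OF \<nu>] young_char_inv[OF \<nu>])
  also have "\<dots> = fact q * (young_char \<nu> \<sigma> * (\<Sum>\<rho>\<in>Sym q. young_char \<mu> \<rho> * young_char \<nu> \<rho>))"
    by (simp add: sum_distrib_left mult_ac)
  finally show ?thesis by simp
qed

text \<open>Test positive definiteness with the character itself: by convolution and orthogonality
  the quadratic form collapses to p \<mu> times the square of
  \<open>young_norm \<mu>\<close>.\<close>

lemma pos_def_coefficient_nonneg:
  assumes pd: "pos_def_fun q \<psi>" and \<mu>: "\<mu> \<in> young_diagrams q"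
    and p: "\<And>\<rho>. \<rho> \<in> Sym q \<Longrightarrow> \<psi> \<rho> = (\<Sum>\<mu>\<in>young_diagrams q. p \<mu> * young_char \<mu> \<rho>)"
  shows "p \<mu> \<in> \<real>\<^sub>\<ge>\<^sub>0"
proof -
  let ?Y = "young_diagrams q" and ?\<chi> = "young_char \<mu>"
  have cnj: "cnj (?\<chi> \<sigma>) = ?\<chi> \<sigma>" for \<sigma> using young_char_Reals by (simp add: Reals_cnj_iff)
  have "(\<Sum>\<rho>\<in>Sym q. \<Sum>\<sigma>\<in>Sym q. ?\<chi> \<rho> * cnj (?\<chi> \<sigma>) * \<psi> (inv \<sigma> \<circ> \<rho>))
      = (\<Sum>\<sigma>\<in>Sym q. \<Sum>\<rho>\<in>Sym q. ?\<chi> \<rho> * ?\<chi> \<sigma> * \<psi> (inv \<sigma> \<circ> \<rho>))"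
    unfolding cnj by (rule sum.swap)
  also have "\<dots> = (\<Sum>\<sigma>\<in>Sym q. \<Sum>\<rho>\<in>Sym q. \<Sum>\<nu>\<in>?Y. p \<nu> * ?\<chi> \<sigma> * (?\<chi> \<rho> * young_char \<nu> (inv \<sigma> \<circ> \<rho>)))"
    by (intro sum.cong refl) (simp add: p sum_distrib_left mult_ac)
  also have "\<dots> = (\<Sum>\<sigma>\<in>Sym q. \<Sum>\<nu>\<in>?Y. p \<nu> * ?\<chi> \<sigma> * (\<Sum>\<rho>\<in>Sym q. ?\<chi> \<rho> * young_char \<nu> (inv \<sigma> \<circ> \<rho>)))"
    by (rule sum.cong[OF refl], subst sum.swap) (simp add: sum_distrib_left)
  also have "\<dots> = (\<Sum>\<sigma>\<in>Sym q. \<Sum>\<nu>\<in>?Y. p \<nu> * ?\<chi> \<sigma> * (young_char \<nu> \<sigma> * (if \<nu> = \<mu> then of_real (young_norm \<mu>) else 0)))"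
    by (intro sum.cong refl) (auto simp: young_char_convolution[OF \<mu>] young_norm[OF \<mu>] young_char_orthogonal[OF \<mu>])
  also have "\<dots> = (\<Sum>\<sigma>\<in>Sym q. p \<mu> * of_real (young_norm \<mu>) * (?\<chi> \<sigma> * ?\<chi> \<sigma>))"
    using \<mu> by (intro sum.cong refl) (simp add: if_distrib mult_ac cong: if_cong)
  also have "\<dots> = p \<mu> * of_real ((young_norm \<mu>)\<^sup>2)"
    by (simp flip: sum_distrib_left add: young_norm[OF \<mu>] power2_eq_square)
  finally have "p \<mu> * of_real ((young_norm \<mu>)\<^sup>2) \<in> \<real>\<^sub>\<ge>\<^sub>0"
    using pd[unfolded pos_def_fun_def, rule_format, of "young_char \<mu>"] by simp
  then have *: "p \<mu> * of_real ((young_norm \<mu>)\<^sup>2) * of_real (1 / (young_norm \<mu>)\<^sup>2) \<in> \<real>\<^sub>\<ge>\<^sub>0"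
    by (rule nonneg_Reals_mult_I) (simp only: nonneg_Reals_of_real_iff, simp)
  have "p \<mu> * of_real ((young_norm \<mu>)\<^sup>2) * of_real (1 / (young_norm \<mu>)\<^sup>2) = p \<mu>"
    using young_norm_pos[OF \<mu>] by simp
  with * show ?thesis by simp
qed

text \<open>\<open>young_measure\<close> is a definite description, so its properties become
  available only after existence and uniqueness of the weights.\<close>

lemma young_measure_expansion:
  assumes cen: "central_fun q \<psi>" and pd: "pos_def_fun q \<psi>" and one: "\<psi> id = 1"
  shows "set_pmf (young_measure q \<psi>) \<subseteq> young_diagrams q"
    and "\<And>\<rho>. \<rho> \<in> Sym q \<Longrightarrow>
      \<psi> \<rho> = (\<Sum>\<mu>\<in>young_diagrams q. of_real (pmf (young_measure q \<psi>) \<mu>) * young_char \<mu> \<rho>)"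
proof -
  let ?Y = "young_diagrams q"
  let ?P = "\<lambda>M. set_pmf M \<subseteq> ?Y \<and> (\<forall>\<rho>\<in>Sym q. \<psi> \<rho> = (\<Sum>\<mu>\<in>?Y. of_real (pmf M \<mu>) * norm_char \<mu> \<rho>))"
  have P_iff: "?P M \<longleftrightarrow> set_pmf M \<subseteq> ?Y \<and> (\<forall>\<rho>\<in>Sym q. \<psi> \<rho> = (\<Sum>\<mu>\<in>?Y. of_real (pmf M \<mu>) * young_char \<mu> \<rho>))" for M
    by (simp add: norm_char_eq_young_char cong: sum.cong)
  obtain p where "\<forall>\<rho>\<in>Sym q. \<psi> \<rho> = (\<Sum>\<mu>\<in>?Y. p \<mu> * young_char \<mu> \<rho>)"
    using cen by (rule central_fun_expansion)
  then have p: "\<psi> \<rho> = (\<Sum>\<mu>\<in>?Y. p \<mu> * young_char \<mu> \<rho>)" if "\<rho> \<in> Sym q" for \<rho>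
    using that by blast
  have nonneg: "p \<mu> \<in> \<real>\<^sub>\<ge>\<^sub>0" if "\<mu> \<in> ?Y" for \<mu>
    using pos_def_coefficient_nonneg[OF pd that p] .
  \<comment> \<open>Extended by 0, because \<open>embed_pmf\<close> takes weights on all
    lists.\<close>
  define w where "w \<mu> = (if \<mu> \<in> ?Y then Re (p \<mu>) else 0)" for \<mu>
  have w0: "w \<mu> \<ge> 0" for \<mu>
    using nonneg[of \<mu>] by (auto simp: w_def complex_nonneg_Reals_iff)
  have wp: "of_real (w \<mu>) = p \<mu>" if "\<mu> \<in> ?Y" for \<mu>
    using nonneg[OF that] that by (auto simp: w_def complex_nonneg_Reals_iff complex_eq_iff)
  have "(\<Sum>\<mu>\<in>?Y. p \<mu>) = 1" using p[OF id_in_Sym(1)] one by (simp add: young_char_id)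
  then have "complex_of_real (\<Sum>\<mu>\<in>?Y. w \<mu>) = 1" by (simp add: wp)
  then have w1: "(\<Sum>\<mu>\<in>?Y. w \<mu>) = 1" by (simp only: of_real_eq_1_iff)
  have "(\<integral>\<^sup>+\<mu>. ennreal (w \<mu>) \<partial>count_space UNIV) = (\<Sum>\<mu>\<in>?Y. ennreal (w \<mu>))"
    by (rule nn_integral_count_space'[OF finite_young_diagrams]) (auto simp: w_def)
  also have "\<dots> = 1" using w0 w1 by (simp add: sum_ennreal)
  finally have w: "pmf (embed_pmf w) \<mu> = w \<mu>" for \<mu> by (intro pmf_embed_pmf w0)
  have Pw: "?P (embed_pmf w)"
    unfolding P_iff
  proof (intro conjI ballI)
    show "set_pmf (embed_pmf w) \<subseteq> ?Y" by (auto simp: set_pmf_eq w w_def split: if_splits)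
    fix \<rho> assume "\<rho> \<in> Sym q"
    then show "\<psi> \<rho> = (\<Sum>\<mu>\<in>?Y. of_real (pmf (embed_pmf w) \<mu>) * young_char \<mu> \<rho>)"
      by (simp add: p w wp)
  qed
  \<comment> \<open>Pairing the expansion with the character of \<nu> recovers the weight of
    \<nu>.\<close>
  have unique: "M = N" if "?P M" "?P N" for M N
  proof (rule pmf_eqI)
    fix \<nu>
    show "pmf M \<nu> = pmf N \<nu>"
    proof (cases "\<nu> \<in> ?Y")
      case True
      have *: "(\<Sum>\<rho>\<in>Sym q. \<psi> \<rho> * young_char \<nu> \<rho>) = of_real (pmf K \<nu>) * of_real (young_norm \<nu>)" if "?P K" for K
        using that sum_young_char_times[OF True, of "\<lambda>\<mu>. of_real (pmf K \<mu>)"] unfolding P_iff by simp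
      have "complex_of_real (pmf M \<nu> * young_norm \<nu>) = of_real (pmf N \<nu> * young_norm \<nu>)"
        unfolding of_real_mult *[OF that(1), symmetric] *[OF that(2), symmetric] by (rule refl)
      then have "pmf M \<nu> * young_norm \<nu> = pmf N \<nu> * young_norm \<nu>" by (simp only: of_real_eq_iff)
      then show ?thesis using young_norm_pos[OF True] by simp
    next
      case False
      then have "\<nu> \<notin> set_pmf M" "\<nu> \<notin> set_pmf N" using that by auto
      then show ?thesis by (simp add: set_pmf_iff)
    qed
  qed
  have "?P (young_measure q \<psi>)"
    unfolding young_measure_def by (rule theI[where P = ?P, OF Pw]) (rule unique[OF _ Pw])
  then show "set_pmf (young_measure q \<psi>) \<subseteq> ?Y"
    "\<And>\<rho>. \<rho> \<in> Sym q \<Longrightarrow> \<psi> \<rho> = (\<Sum>\<mu>\<in>?Y. of_real (pmf (young_measure q \<psi>) \<mu>) * young_char \<mu> \<rho>)"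
    unfolding P_iff by simp_all
qed

section \<open>Lengths of products of permutations\<close>

lemma num_cycles_le: "num_cycles q \<rho> \<le> q"
  unfolding num_cycles_def using card_image_le[of "{1..q}" "orbit \<rho>"] by simp

text \<open>Cycles of \<rho> avoiding x and y remain cycles of the product. At most two cycles are
  lost, and the product has the cycle of x in addition to the surviving ones.\<close>

lemma num_cycles_transpose_comp_ge:
  assumes \<rho>: "\<rho> \<in> Sym q" and xy: "x \<in> {1..q}" "y \<in> {1..q}"
  shows "num_cycles q \<rho> \<le> num_cycles q (Transposition.transpose x y \<circ> \<rho>) + 1"
proof -
  let ?t = "Transposition.transpose x y"
  let ?\<rho>' = "?t \<circ> \<rho>"
  have perm: "permutation \<rho>" "permutation ?\<rho>'"
    using Sym_permutation[OF \<rho>] Sym_permutation[OF comp_in_Sym[OF transpose_in_Sym[OF xy] \<rho>]] .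
  let ?R = "orbit ?\<rho>' ` {1..q} - {orbit ?\<rho>' x}"
  have "orbit \<rho> ` {1..q} \<subseteq> {orbit \<rho> x, orbit \<rho> y} \<union> ?R"
  proof
    fix X assume "X \<in> orbit \<rho> ` {1..q}"
    then obtain z where z: "z \<in> {1..q}" "X = orbit \<rho> z" by blast
    show "X \<in> {orbit \<rho> x, orbit \<rho> y} \<union> ?R"
    proof (cases "x \<in> X \<or> y \<in> X")
      case True
      then show ?thesis using orbit_eq_of_mem[OF perm(1)] z(2) by blast
    next
      case False
      have "orbit ?\<rho>' z = orbit \<rho> z"
      proof (rule orbit_cong)
        fix w assume "w \<in> orbit \<rho> z"
        then have "\<rho> w \<in> X" using z(2) by (simp add: orbit.step)
        then have "\<rho> w \<noteq> x" "\<rho> w \<noteq> y" using False by auto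
        then show "?\<rho>' w = \<rho> w" by simp
      qed (rule permutation_self_in_orbit[OF perm(1)])
      moreover have "orbit ?\<rho>' x \<noteq> X" using False permutation_self_in_orbit[OF perm(2), of x] by auto
      ultimately show ?thesis using z by auto
    qed
  qed
  then have "num_cycles q \<rho> \<le> card ({orbit \<rho> x, orbit \<rho> y} \<union> ?R)"
    unfolding num_cycles_def by (intro card_mono) auto
  also have "\<dots> \<le> card {orbit \<rho> x, orbit \<rho> y} + card ?R" by (rule card_Un_le)
  also have "card {orbit \<rho> x, orbit \<rho> y} \<le> 2" by (simp add: card_insert_if)
  also have "card ?R = num_cycles q ?\<rho>' - 1"
    unfolding num_cycles_def using xy(1) by (intro card_Diff_singleton) simp
  finally have "num_cycles q \<rho> \<le> 2 + (num_cycles q ?\<rho>' - 1)" by simp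
  moreover have "num_cycles q ?\<rho>' > 0"
    unfolding num_cycles_def using xy(1) by (subst card_gt_0_iff) auto
  ultimately show ?thesis by simp
qed

text \<open>The cycle {y} is absorbed into the cycle of x. Every other cycle of the product is a
  cycle of \<rho> different from those of x and y.\<close>

lemma num_cycles_transpose_comp_fixed:
  assumes \<rho>: "\<rho> \<in> Sym q" and xy: "x \<in> {1..q}" "y \<in> {1..q}" "x \<noteq> y" and fix_y: "\<rho> y = y"
  shows "num_cycles q (Transposition.transpose x y \<circ> \<rho>) + 1 \<le> num_cycles q \<rho>"
proof -
  let ?t = "Transposition.transpose x y"
  let ?\<rho>' = "?t \<circ> \<rho>"
  have perm: "permutation \<rho>" "permutation ?\<rho>'"
    using Sym_permutation[OF \<rho>] Sym_permutation[OF comp_in_Sym[OF transpose_in_Sym[OF xy(1,2)] \<rho>]] .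
  have "x \<in> orbit ?\<rho>' y" using orbit.base[of ?\<rho>' y] fix_y by simp
  then have same: "orbit ?\<rho>' x = orbit ?\<rho>' y" by (rule orbit_eq_of_mem[OF perm(2)])
  let ?R = "orbit \<rho> ` {1..q} - {orbit \<rho> x, orbit \<rho> y}"
  have "orbit \<rho> y = {y}" using fix_y by (simp add: orbit_eq_singleton_iff)
  then have ne: "orbit \<rho> x \<noteq> orbit \<rho> y"
    using permutation_self_in_orbit[OF perm(1), of x] xy(3) by auto
  have "orbit ?\<rho>' ` {1..q} \<subseteq> insert (orbit ?\<rho>' x) ?R"
  proof
    fix X assume "X \<in> orbit ?\<rho>' ` {1..q}"
    then obtain z where z: "z \<in> {1..q}" "X = orbit ?\<rho>' z" by blast
    show "X \<in> insert (orbit ?\<rho>' x) ?R"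
    proof (cases "x \<in> X \<or> y \<in> X")
      case True
      then show ?thesis using orbit_eq_of_mem[OF perm(2)] z(2) same by blast
    next
      case False
      have "orbit \<rho> z = orbit ?\<rho>' z"
      proof (rule orbit_cong)
        fix w assume "w \<in> orbit ?\<rho>' z"
        then have "?\<rho>' w \<in> X" using orbit.step[of w ?\<rho>' z] z(2) by simp
        then have "?t (\<rho> w) \<noteq> x" "?t (\<rho> w) \<noteq> y" using False by auto
        then show "\<rho> w = ?\<rho>' w" by (auto simp: Transposition.transpose_def split: if_splits)
      qed (rule permutation_self_in_orbit[OF perm(2)])
      moreover have "orbit \<rho> x \<noteq> X" "orbit \<rho> y \<noteq> X"
        using False permutation_self_in_orbit[OF perm(1)] by blast+
      ultimately show ?thesis using z by auto
    qed
  qed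
  then have "num_cycles q ?\<rho>' \<le> card (insert (orbit ?\<rho>' x) ?R)"
    unfolding num_cycles_def by (intro card_mono) auto
  also have "\<dots> \<le> Suc (card ?R)" by (rule card_insert_le_m1) auto
  also have "card ?R = num_cycles q \<rho> - 2"
    unfolding num_cycles_def using xy(1,2) ne by (subst card_Diff_subset) auto
  finally have "num_cycles q ?\<rho>' \<le> Suc (num_cycles q \<rho> - 2)" .
  \<comment> \<open>Two distinct cycles are present, so the subtraction of 2 does not
    truncate.\<close>
  moreover have "card {orbit \<rho> x, orbit \<rho> y} \<le> num_cycles q \<rho>"
    unfolding num_cycles_def using xy(1,2) by (intro card_mono) auto
  ultimately show ?thesis using ne by simp
qed

lemma perm_length_transpose_comp_le:
  assumes "\<rho> \<in> Sym q" "x \<in> {1..q}" "y \<in> {1..q}"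
  shows "perm_length q (Transposition.transpose x y \<circ> \<rho>) \<le> perm_length q \<rho> + 1"
  using num_cycles_transpose_comp_ge[OF assms] by (simp add: perm_length_def)

lemma perm_length_transpose_comp_fixed:
  assumes "\<rho> \<in> Sym q" "x \<in> {1..q}" "y \<in> {1..q}" "x \<noteq> y" "\<rho> y = y"
  shows "perm_length q (Transposition.transpose x y \<circ> \<rho>) = perm_length q \<rho> + 1"
  using num_cycles_transpose_comp_fixed[OF assms] num_cycles_transpose_comp_ge[OF assms(1-3)]
    num_cycles_le[of q \<rho>] by (simp add: perm_length_def)

section \<open>Supports, and induction by splitting off transpositions\<close>

lemma perm_support_subset: "\<rho> \<in> Sym q \<Longrightarrow> perm_support \<rho> \<subseteq> {1..q}"
  using permutes_not_in[OF Sym_permutes, of \<rho> q] unfolding perm_support_def by blast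

lemma finite_perm_support: "\<rho> \<in> Sym q \<Longrightarrow> finite (perm_support \<rho>)"
  using perm_support_subset finite_subset by blast

lemma perm_support_empty_iff: "perm_support \<rho> = {} \<longleftrightarrow> \<rho> = id"
  by (auto simp: perm_support_def)

text \<open>If \<rho> y = x, then \<rho> \<circ> (x y) fixes x and is shorter by one; pulled to the
  left, the transposition becomes (z x). The right-hand form hands the factor over to a second
  permutation, the left-hand form peels it off the front of a product.\<close>

lemma split_transposition:
  assumes \<rho>: "\<rho> \<in> Sym q" and x: "x \<in> perm_support \<rho>"
  obtains \<rho>' y z where "\<rho>' \<in> Sym q" "y \<in> {1..q}" "z \<in> {1..q}" "y \<noteq> x" "y \<in> perm_support \<rho>"
    "\<rho> = \<rho>' \<circ> Transposition.transpose x y" "\<rho> = Transposition.transpose z x \<circ> \<rho>'"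
    "perm_length q \<rho> = perm_length q \<rho>' + 1" "perm_support \<rho>' \<subseteq> perm_support \<rho> - {x}"
proof -
  have p: "\<rho> permutes {1..q}" using \<rho> by (rule Sym_permutes)
  have inj: "inj \<rho>" using p by (rule permutes_inj)
  define y where "y = inv \<rho> x"
  have y: "\<rho> y = x" unfolding y_def using p by (simp add: permutes_inverses)
  have xne: "\<rho> x \<noteq> x" using x by (simp add: perm_support_def)
  then have yx: "y \<noteq> x" using y by auto
  have ys: "y \<in> perm_support \<rho>" using y yx by (simp add: perm_support_def)
  have xq: "x \<in> {1..q}" and yq: "y \<in> {1..q}" using perm_support_subset[OF \<rho>] x ys by auto
  let ?t = "Transposition.transpose x y"
  define \<rho>' where "\<rho>' = \<rho> \<circ> ?t"
  have S: "\<rho>' \<in> Sym q" unfolding \<rho>'_def using \<rho> transpose_in_Sym[OF xq yq] by simp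
  have fx: "\<rho>' x = x" using y by (simp add: \<rho>'_def)
  have e1: "\<rho> = \<rho>' \<circ> ?t" unfolding \<rho>'_def by (simp add: comp_assoc)
  define z where "z = \<rho>' y"
  have inj': "inj \<rho>'" using permutes_inj[OF Sym_permutes[OF S]] .
  have zx: "z \<noteq> x" using injD[OF inj', of y x] fx yx by (auto simp: z_def)
  have zq: "z \<in> {1..q}" unfolding z_def using permutes_in_image[OF Sym_permutes[OF S]] yq by simp
  have "\<rho> = Transposition.transpose (\<rho>' x) (\<rho>' y) \<circ> \<rho>'"
    unfolding transpose_image_comp[OF inj'] by (rule e1)
  then have e2: "\<rho> = Transposition.transpose z x \<circ> \<rho>'"
    unfolding fx z_def[symmetric] by (simp only: transpose_commute)
  have "perm_length q \<rho> = perm_length q \<rho>' + 1"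
    by (subst e2) (rule perm_length_transpose_comp_fixed[OF S zq xq zx fx])
  moreover have "perm_support \<rho>' \<subseteq> perm_support \<rho> - {x}"
  proof
    fix w assume "w \<in> perm_support \<rho>'"
    then have w: "\<rho>' w \<noteq> w" by (simp add: perm_support_def)
    then have "w \<noteq> x" using fx by auto
    moreover have "w \<in> perm_support \<rho>"
    proof (cases "w = y")
      case False
      then have "\<rho>' w = \<rho> w" using \<open>w \<noteq> x\<close> by (simp add: \<rho>'_def)
      then show ?thesis using w by (simp add: perm_support_def)
    qed (use ys in simp)
    ultimately show "w \<in> perm_support \<rho> - {x}" by simp
  qed
  ultimately show thesis using that[OF S yq zq yx ys e1 e2] by simp
qed

lemma Sym_support_induct [consumes 1, case_names step]:
  assumes "\<rho> \<in> Sym q"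
    and "\<And>\<rho>. \<rho> \<in> Sym q \<Longrightarrow>
      (\<And>\<rho>'. \<rho>' \<in> Sym q \<Longrightarrow> card (perm_support \<rho>') < card (perm_support \<rho>) \<Longrightarrow> P \<rho>') \<Longrightarrow> P \<rho>"
  shows "P \<rho>"
  using assms(1)
proof (induction "card (perm_support \<rho>)" arbitrary: \<rho> rule: less_induct)
  case less
  show ?case by (rule assms(2)[OF less.prems]) (rule less.hyps)
qed

lemma card_perm_support_less:
  assumes "\<rho> \<in> Sym q" "x \<in> perm_support \<rho>" "perm_support \<rho>' \<subseteq> perm_support \<rho> - {x}"
  shows "card (perm_support \<rho>') < card (perm_support \<rho>)"
  using assms by (intro psubset_card_mono finite_perm_support) auto

text \<open>Each transposition split off lowers the length by one and the support by at most two
  points.\<close>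

lemma card_perm_support_le:
  assumes "\<rho> \<in> Sym q"
  shows "card (perm_support \<rho>) \<le> 2 * perm_length q \<rho>"
  using assms
proof (induction rule: Sym_support_induct)
  case (step \<rho>)
  show ?case
  proof (cases "perm_support \<rho> = {}")
    case False
    then obtain x where x: "x \<in> perm_support \<rho>" by blast
    obtain \<rho>' y z where d: "\<rho>' \<in> Sym q" "y \<in> {1..q}" "z \<in> {1..q}" "y \<noteq> x" "y \<in> perm_support \<rho>"
      "\<rho> = \<rho>' \<circ> Transposition.transpose x y" "\<rho> = Transposition.transpose z x \<circ> \<rho>'"
      "perm_length q \<rho> = perm_length q \<rho>' + 1" "perm_support \<rho>' \<subseteq> perm_support \<rho> - {x}"
      using split_transposition[OF step(1) x] .
    have "perm_support \<rho> \<subseteq> insert x (insert y (perm_support \<rho>'))"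
    proof
      fix w assume "w \<in> perm_support \<rho>"
      then have "\<rho> w \<noteq> w" by (simp add: perm_support_def)
      then show "w \<in> insert x (insert y (perm_support \<rho>'))"
        unfolding d(6) by (cases "w = x \<or> w = y") (auto simp: perm_support_def)
    qed
    then have "card (perm_support \<rho>) \<le> card (insert x (insert y (perm_support \<rho>')))"
      by (intro card_mono) (simp_all add: finite_perm_support[OF d(1)])
    also have "\<dots> \<le> card (perm_support \<rho>') + 2"
      using finite_perm_support[OF d(1)] by (simp add: card_insert_if)
    finally show ?thesis
      using step(2)[OF d(1) card_perm_support_less[OF step(1) x d(9)]] d(8) by simp
  qed simp
qed

lemma perm_length_eq_0: "\<rho> \<in> Sym q \<Longrightarrow> perm_length q \<rho> = 0 \<Longrightarrow> \<rho> = id"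
  using card_perm_support_le[of \<rho> q] finite_perm_support[of \<rho> q] perm_support_empty_iff[of \<rho>] by simp

lemma perm_length_comp_le:
  assumes "\<rho> \<in> Sym q" "\<sigma> \<in> Sym q"
  shows "perm_length q (\<rho> \<circ> \<sigma>) \<le> perm_length q \<rho> + perm_length q \<sigma>"
  using assms(1)
proof (induction rule: Sym_support_induct)
  case (step \<rho>)
  show ?case
  proof (cases "perm_support \<rho> = {}")
    case True
    then show ?thesis by (simp add: perm_support_empty_iff)
  next
    case False
    then obtain x where x: "x \<in> perm_support \<rho>" by blast
    obtain \<rho>' y z where d: "\<rho>' \<in> Sym q" "y \<in> {1..q}" "z \<in> {1..q}" "y \<noteq> x" "y \<in> perm_support \<rho>"
      "\<rho> = \<rho>' \<circ> Transposition.transpose x y" "\<rho> = Transposition.transpose z x \<circ> \<rho>'"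
      "perm_length q \<rho> = perm_length q \<rho>' + 1" "perm_support \<rho>' \<subseteq> perm_support \<rho> - {x}"
      using split_transposition[OF step(1) x] .
    have xq: "x \<in> {1..q}" using perm_support_subset[OF step(1)] x by blast
    have "perm_length q (\<rho> \<circ> \<sigma>) = perm_length q (Transposition.transpose z x \<circ> (\<rho>' \<circ> \<sigma>))"
      by (subst d(7)) (simp only: comp_assoc)
    also have "\<dots> \<le> perm_length q (\<rho>' \<circ> \<sigma>) + 1"
      by (rule perm_length_transpose_comp_le[OF comp_in_Sym[OF d(1) assms(2)] d(3) xq])
    finally show ?thesis
      using step(2)[OF d(1) card_perm_support_less[OF step(1) x d(9)]] d(8) by (simp add: comp_def)
  qed
qed

text \<open>Transpositions are moved one by one from the end of \<rho> to the front of \<sigma>.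
  Each is split at the shared point x, if there is one, so its other point y is fixed by \<sigma>
  and the second length grows by exactly one. The product does not change and the overlap stays at
  most 1.\<close>

lemma perm_length_comp_ge_overlap_1:
  assumes "\<rho> \<in> Sym q" "\<sigma> \<in> Sym q" "card (perm_support \<rho> \<inter> perm_support \<sigma>) \<le> 1"
  shows "perm_length q \<rho> + perm_length q \<sigma> \<le> perm_length q (\<rho> \<circ> \<sigma>)"
  using assms
proof (induction arbitrary: \<sigma> rule: Sym_support_induct)
  case (step \<rho>)
  show ?case
  proof (cases "perm_support \<rho> = {}")
    case True
    then have "\<rho> = id" by (simp add: perm_support_empty_iff)
    moreover have "perm_length q id = 0"
    proof -
      have "orbit id z = {z}" for z :: nat by (simp add: orbit_eq_singleton_iff)
      then have "orbit id ` {1..q} = (\<lambda>z. {z}) ` {1..q}" by simp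
      then show ?thesis by (simp add: perm_length_def num_cycles_def card_image)
    qed
    ultimately show ?thesis by (simp add: comp_def id_def)
  next
    case False
    have fin: "finite (perm_support \<rho> \<inter> perm_support \<sigma>)" using finite_perm_support[OF step(1)] by simp
    have "\<exists>x\<in>perm_support \<rho>. perm_support \<rho> \<inter> perm_support \<sigma> \<subseteq> {x}"
    proof (cases "perm_support \<rho> \<inter> perm_support \<sigma> = {}")
      case True
      then show ?thesis using False by blast
    next
      case False
      then obtain x where x: "x \<in> perm_support \<rho> \<inter> perm_support \<sigma>" by blast
      have "perm_support \<rho> \<inter> perm_support \<sigma> = {x}"
        using card_le_Suc0_iff_eq[OF fin] step.prems(2) x by auto
      then show ?thesis using x by blast
    qed
    then obtain x where x: "x \<in> perm_support \<rho>" "perm_support \<rho> \<inter> perm_support \<sigma> \<subseteq> {x}" by blast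
    obtain \<rho>' y z where d: "\<rho>' \<in> Sym q" "y \<in> {1..q}" "z \<in> {1..q}" "y \<noteq> x" "y \<in> perm_support \<rho>"
      "\<rho> = \<rho>' \<circ> Transposition.transpose x y" "\<rho> = Transposition.transpose z x \<circ> \<rho>'"
      "perm_length q \<rho> = perm_length q \<rho>' + 1" "perm_support \<rho>' \<subseteq> perm_support \<rho> - {x}"
      using split_transposition[OF step(1) x(1)] .
    have xq: "x \<in> {1..q}" using perm_support_subset[OF step(1)] x by blast
    have "y \<notin> perm_support \<sigma>" using x(2) d(4,5) by blast
    then have fy: "\<sigma> y = y" by (simp add: perm_support_def)
    define \<sigma>' where "\<sigma>' = Transposition.transpose x y \<circ> \<sigma>"
    have \<sigma>': "\<sigma>' \<in> Sym q" unfolding \<sigma>'_def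
      using transpose_in_Sym[OF xq d(2)] step.prems(1) by (rule comp_in_Sym)
    have len: "perm_length q \<sigma>' = perm_length q \<sigma> + 1"
      unfolding \<sigma>'_def using perm_length_transpose_comp_fixed[OF step.prems(1) xq d(2) _ fy] d(4) by simp
    \<comment> \<open>The possible shared point moves from x to y.\<close>
    have "perm_support \<rho>' \<inter> perm_support \<sigma>' \<subseteq> {y}"
    proof
      fix w assume w: "w \<in> perm_support \<rho>' \<inter> perm_support \<sigma>'"
      then have w1: "w \<in> perm_support \<rho>" "w \<noteq> x" using d(9) by auto
      then have "w \<notin> perm_support \<sigma>" using x(2) by blast
      then have "\<sigma> w = w" by (simp add: perm_support_def)
      moreover have "\<sigma>' w \<noteq> w" using w by (simp add: perm_support_def)
      ultimately have "w = x \<or> w = y" by (auto simp: \<sigma>'_def Transposition.transpose_def split: if_splits)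
      then show "w \<in> {y}" using w1 by simp
    qed
    then have "card (perm_support \<rho>' \<inter> perm_support \<sigma>') \<le> 1"
      using card_mono[of "{y}" "perm_support \<rho>' \<inter> perm_support \<sigma>'"] by simp
    then have "perm_length q \<rho>' + perm_length q \<sigma>' \<le> perm_length q (\<rho>' \<circ> \<sigma>')"
      by (rule step(2)[OF d(1) card_perm_support_less[OF step(1) x(1) d(9)] \<sigma>'])
    moreover have "\<rho>' \<circ> \<sigma>' = \<rho> \<circ> \<sigma>" by (subst d(6)) (simp only: \<sigma>'_def comp_assoc)
    ultimately show ?thesis using d(8) len by (simp add: comp_def)
  qed
qed

text \<open>
  The naive bound loses twice the overlap; the gain of 2 is what makes overlapping supports
  contribute only \<open>O(q\<^sup>-\<^sup>l\<^sup>-\<^sup>1)\<close> to the variance.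
\<close>

lemma perm_length_comp_ge:
  assumes "\<rho> \<in> Sym q" "\<sigma> \<in> Sym q"
  shows "perm_length q \<rho> + perm_length q \<sigma>
    \<le> perm_length q (\<rho> \<circ> \<sigma>) + 2 * (card (perm_support \<rho> \<inter> perm_support \<sigma>) - 1)"
  using assms(1)
proof (induction rule: Sym_support_induct)
  case (step \<rho>)
  show ?case
  proof (cases "card (perm_support \<rho> \<inter> perm_support \<sigma>) \<le> 1")
    case True
    then show ?thesis using perm_length_comp_ge_overlap_1[OF step(1) assms(2)] by (simp add: comp_def)
  next
    case False
    then have "perm_support \<rho> \<inter> perm_support \<sigma> \<noteq> {}" by auto
    then obtain x where x: "x \<in> perm_support \<rho>" "x \<in> perm_support \<sigma>" by blast
    obtain \<rho>' y z where d: "\<rho>' \<in> Sym q" "y \<in> {1..q}" "z \<in> {1..q}" "y \<noteq> x" "y \<in> perm_support \<rho>"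
      "\<rho> = \<rho>' \<circ> Transposition.transpose x y" "\<rho> = Transposition.transpose z x \<circ> \<rho>'"
      "perm_length q \<rho> = perm_length q \<rho>' + 1" "perm_support \<rho>' \<subseteq> perm_support \<rho> - {x}"
      using split_transposition[OF step(1) x(1)] .
    have xq: "x \<in> {1..q}" using perm_support_subset[OF step(1)] x by blast
    have fin: "finite (perm_support \<rho> \<inter> perm_support \<sigma>)" using finite_perm_support[OF step(1)] by simp
    \<comment> \<open>Splitting at a shared point lowers the overlap by one at a cost of 2 in the
      comparison of lengths; this continues down to overlap 1, where nothing is lost.\<close>
    have "card (perm_support \<rho>' \<inter> perm_support \<sigma>) \<le> card (perm_support \<rho> \<inter> perm_support \<sigma> - {x})"
      using d(9) fin by (intro card_mono) auto
    also have "\<dots> = card (perm_support \<rho> \<inter> perm_support \<sigma>) - 1"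
      using x by (intro card_Diff_singleton) simp
    finally have c: "card (perm_support \<rho>' \<inter> perm_support \<sigma>) \<le> card (perm_support \<rho> \<inter> perm_support \<sigma>) - 1" .
    have "\<rho>' \<circ> \<sigma> = Transposition.transpose z x \<circ> (\<rho> \<circ> \<sigma>)"
      by (subst d(7)) (simp add: fun_eq_iff)
    then have "perm_length q (\<rho>' \<circ> \<sigma>) \<le> perm_length q (\<rho> \<circ> \<sigma>) + 1"
      using perm_length_transpose_comp_le[OF comp_in_Sym[OF step(1) assms(2)] d(3) xq] by simp
    then show ?thesis
      using step(2)[OF d(1) card_perm_support_less[OF step(1) x(1) d(9)]] d(8) c False by (simp add: comp_def)
  qed
qed

lemma perm_support_conj:
  assumes "\<pi> \<in> Sym q"
  shows "perm_support (\<pi> \<circ> \<rho> \<circ> inv \<pi>) = \<pi> ` perm_support \<rho>"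
proof -
  have p: "\<pi> permutes {1..q}" using assms by (rule Sym_permutes)
  have "w \<in> perm_support (\<pi> \<circ> \<rho> \<circ> inv \<pi>) \<longleftrightarrow> inv \<pi> w \<in> perm_support \<rho>" for w
    using permutes_inv_eq[OF p, of "\<rho> (inv \<pi> w)" w] permutes_inverses[OF p]
    by (auto simp: perm_support_def) (metis permutes_inverses(1)[OF p])+
  moreover have "w \<in> \<pi> ` perm_support \<rho> \<longleftrightarrow> inv \<pi> w \<in> perm_support \<rho>" for w
    using permutes_inverses[OF p] by (metis imageE image_eqI)
  ultimately show ?thesis by blast
qed

lemma perm_length_conj:
  assumes \<pi>: "\<pi> \<in> Sym q" and \<rho>: "\<rho> \<in> Sym q"
  shows "perm_length q (\<pi> \<circ> \<rho> \<circ> inv \<pi>) = perm_length q \<rho>"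
proof -
  have p: "\<pi> permutes {1..q}" using \<pi> by (rule Sym_permutes)
  have pow: "((\<pi> \<circ> \<rho> \<circ> inv \<pi>) ^^ n) (\<pi> x) = \<pi> ((\<rho> ^^ n) x)" for n x
    by (induction n) (simp_all add: permutes_inverses[OF p])
  have orb: "orbit (\<pi> \<circ> \<rho> \<circ> inv \<pi>) (\<pi> x) = \<pi> ` orbit \<rho> x" for x
    unfolding orbit_altdef pow by blast
  have "orbit (\<pi> \<circ> \<rho> \<circ> inv \<pi>) ` {1..q} = orbit (\<pi> \<circ> \<rho> \<circ> inv \<pi>) ` \<pi> ` {1..q}"
    by (simp only: permutes_image[OF p])
  also have "\<dots> = image \<pi> ` orbit \<rho> ` {1..q}"
    by (simp only: image_image orb)
  finally have "num_cycles q (\<pi> \<circ> \<rho> \<circ> inv \<pi>) = card (image \<pi> ` orbit \<rho> ` {1..q})"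
    unfolding num_cycles_def by simp
  also have "\<dots> = num_cycles q \<rho>"
    unfolding num_cycles_def by (intro card_image inj_onI) (simp add: inj_image_eq_iff permutes_inj[OF p])
  finally show ?thesis by (simp add: perm_length_def)
qed

section \<open>Overlaps with a random translate\<close>

lemma ex_Sym_image:
  assumes A: "A \<subseteq> {1..q}" and B: "B \<subseteq> {1..q}" and card: "card A = card B"
  obtains \<pi> where "\<pi> \<in> Sym q" "\<pi> ` A = B"
proof -
  have fin: "finite A" "finite B" using A B finite_subset by blast+
  obtain f where f: "bij_betw f A B" using finite_same_card_bij[OF fin card] by blast
  have "card ({1..q} - A) = card ({1..q} - B)"
    using A B fin card by (simp add: card_Diff_subset)
  then obtain h where h: "bij_betw h ({1..q} - A) ({1..q} - B)"
    using finite_same_card_bij[of "{1..q} - A" "{1..q} - B"] by auto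
  define \<pi> where "\<pi> x = (if x \<in> A then f x else if x \<in> {1..q} then h x else x)" for x
  have 1: "bij_betw \<pi> A B" using f by (subst bij_betw_cong[of A \<pi> f]) (auto simp: \<pi>_def)
  have 2: "bij_betw \<pi> ({1..q} - A) ({1..q} - B)"
    using h by (subst bij_betw_cong[of "{1..q} - A" \<pi> h]) (auto simp: \<pi>_def)
  have "bij_betw \<pi> (A \<union> ({1..q} - A)) (B \<union> ({1..q} - B))"
    using 1 2 by (rule bij_betw_combine) blast
  moreover have "A \<union> ({1..q} - A) = {1..q}" "B \<union> ({1..q} - B) = {1..q}" using A B by auto
  ultimately have "bij_betw \<pi> {1..q} {1..q}" by simp
  then have "\<pi> permutes {1..q}"
    by (rule bij_imp_permutes) (use A in \<open>auto simp: \<pi>_def\<close>)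
  moreover have "\<pi> ` A = B" using 1 by (simp add: bij_betw_def)
  ultimately show thesis using that by (simp add: Sym_def)
qed

text \<open>Left multiplication by a permutation taking U to T' is a bijection between the fibres
  over U and T', so the images of T are uniformly distributed over the sets of its size.\<close>

lemma card_Sym_image:
  assumes T: "T \<subseteq> {1..q}" and T': "T' \<subseteq> {1..q}" and card: "card T = card T'"
  shows "card {\<pi> \<in> Sym q. \<pi> ` T = T'} * (q choose card T) = fact q"
proof -
  let ?N = "\<lambda>U. card {\<pi> \<in> Sym q. \<pi> ` T = U}"
  let ?S = "{U. U \<subseteq> {1..q} \<and> card U = card T}"
  have finS: "finite ?S" by (rule finite_subset[of _ "Pow {1..q}"]) auto
  have cardT: "card (\<pi> ` T) = card T" if "\<pi> \<in> Sym q" for \<pi>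
    using permutes_inj[OF Sym_permutes[OF that]] by (intro card_image) (rule inj_on_subset, auto)
  have eq: "?N U = ?N T'" if "U \<in> ?S" for U
  proof -
    have U: "U \<subseteq> {1..q}" "card U = card T'" using that card by auto
    obtain \<kappa> where \<kappa>: "\<kappa> \<in> Sym q" "\<kappa> ` U = T'"
      by (rule ex_Sym_image[OF U(1) T' U(2)])
    have "bij_betw (\<lambda>\<pi>. \<kappa> \<circ> \<pi>) {\<pi> \<in> Sym q. \<pi> ` T = U} {\<pi> \<in> Sym q. \<pi> ` T = T'}"
    proof (rule bij_betw_byWitness[where f' = "\<lambda>\<pi>. inv \<kappa> \<circ> \<pi>"])
      show "\<forall>\<pi>\<in>{\<pi> \<in> Sym q. \<pi> ` T = U}. inv \<kappa> \<circ> (\<kappa> \<circ> \<pi>) = \<pi>"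
        "\<forall>\<pi>\<in>{\<pi> \<in> Sym q. \<pi> ` T = T'}. \<kappa> \<circ> (inv \<kappa> \<circ> \<pi>) = \<pi>"
        using Sym_comp_inv(4,5)[OF \<kappa>(1)] by blast+
      show "(\<lambda>\<pi>. \<kappa> \<circ> \<pi>) ` {\<pi> \<in> Sym q. \<pi> ` T = U} \<subseteq> {\<pi> \<in> Sym q. \<pi> ` T = T'}"
        using \<kappa> by (auto simp flip: image_comp)
      have "inv \<kappa> ` T' = U"
        using image_comp[of "inv \<kappa>" \<kappa> U] \<kappa> by (simp add: Sym_comp_inv(1))
      then show "(\<lambda>\<pi>. inv \<kappa> \<circ> \<pi>) ` {\<pi> \<in> Sym q. \<pi> ` T = T'} \<subseteq> {\<pi> \<in> Sym q. \<pi> ` T = U}"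
        using \<kappa> by (auto simp flip: image_comp)
    qed
    then show ?thesis by (rule bij_betw_same_card)
  qed
  have "fact q = card (\<Union>U\<in>?S. {\<pi> \<in> Sym q. \<pi> ` T = U})"
  proof -
    have "(\<Union>U\<in>?S. {\<pi> \<in> Sym q. \<pi> ` T = U}) = Sym q"
    proof
      show "Sym q \<subseteq> (\<Union>U\<in>?S. {\<pi> \<in> Sym q. \<pi> ` T = U})"
      proof
        fix \<pi> assume \<pi>: "\<pi> \<in> Sym q"
        have "\<pi> ` T \<subseteq> {1..q}" using T permutes_image[OF Sym_permutes[OF \<pi>]] by blast
        then show "\<pi> \<in> (\<Union>U\<in>?S. {\<pi> \<in> Sym q. \<pi> ` T = U})" using \<pi> cardT by blast
      qed
    qed blast
    then show ?thesis by (simp add: card_Sym)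
  qed
  also have "\<dots> = (\<Sum>U\<in>?S. ?N U)"
    by (rule card_UN_disjoint) (use finS in auto)
  also have "\<dots> = (\<Sum>U\<in>?S. ?N T')" by (rule sum.cong[OF refl eq])
  also have "\<dots> = ?N T' * card ?S" by simp
  also have "card ?S = q choose card T" using n_subsets[of "{1..q}" "card T"] by simp
  finally show ?thesis by simp
qed

text \<open>The event has probability 1 / (q choose m), and (q / m)^m \<le> (q choose m). Enlarging
  m^m to s^s gives a constant depending on s only.\<close>

lemma power_mult_card_Sym_image_le:
  assumes T: "T \<subseteq> {1..q}" and T': "T' \<subseteq> {1..q}" and card: "card T = card T'"
    and s: "card T \<le> s" "s \<ge> 1"
  shows "real q ^ card T * card {\<pi> \<in> Sym q. \<pi> ` T = T'} \<le> real s ^ s * fact q"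
proof -
  define m where "m = card T"
  have mq: "m \<le> q" using card_mono[OF _ T] by (simp add: m_def)
  have "real q ^ m = (real q / real m) ^ m * real m ^ m"
    by (cases "m = 0") (simp_all add: power_divide)
  also have "\<dots> \<le> real (q choose m) * real s ^ s"
  proof (rule mult_mono)
    show "(real q / real m) ^ m \<le> real (q choose m)"
      using binomial_ge_n_over_k_pow_k[OF mq, where 'a = real] by simp
    have "real m ^ m \<le> real s ^ m" using s by (intro power_mono) (simp_all add: m_def)
    also have "\<dots> \<le> real s ^ s" using s by (intro power_increasing) (simp_all add: m_def)
    finally show "real m ^ m \<le> real s ^ s" .
  qed auto
  finally have "real q ^ m * card {\<pi> \<in> Sym q. \<pi> ` T = T'}
      \<le> real (q choose m) * real s ^ s * card {\<pi> \<in> Sym q. \<pi> ` T = T'}"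
    by (rule mult_right_mono) simp
  also have "\<dots> = real s ^ s * real (card {\<pi> \<in> Sym q. \<pi> ` T = T'} * (q choose m))" by simp
  also have "\<dots> = real s ^ s * fact q"
    unfolding m_def card_Sym_image[OF T T' card] by simp
  finally show ?thesis by (simp add: m_def)
qed

text \<open>An exponential moment of the overlap. The weight is dominated by a sum over pairs T, T'
  of equally large subsets of A with \<pi> T = T'. There are at most 4^s pairs, each contributing at
  most s^s on average.\<close>

lemma sum_power_overlap_le:
  assumes A: "A \<subseteq> {1..q}" and s: "card A \<le> s" "s \<ge> 1"
  shows "(\<Sum>\<pi>\<in>Sym q. real q ^ card (\<pi> ` A \<inter> A)) \<le> 4 ^ s * real s ^ s * fact q"
proof -
  have finA: "finite A" using A finite_subset by blast
  let ?P = "{(T, T'). T \<subseteq> A \<and> T' \<subseteq> A \<and> card T = card T'}"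
  have finP: "finite ?P" by (rule finite_subset[of _ "Pow A \<times> Pow A"]) (use finA in auto)
  have "real q ^ card (\<pi> ` A \<inter> A) \<le> (\<Sum>(T, T')\<in>?P. if \<pi> ` T = T' then real q ^ card T else 0)"
    if \<pi>: "\<pi> \<in> Sym q" for \<pi>
  proof -
    \<comment> \<open>The image of this set is exactly the overlap, so a single pair already
      accounts for the full weight.\<close>
    let ?T = "{x \<in> A. \<pi> x \<in> A}"
    have im: "\<pi> ` ?T = \<pi> ` A \<inter> A" by blast
    have card: "card (\<pi> ` ?T) = card ?T"
      using permutes_inj[OF Sym_permutes[OF \<pi>]] by (intro card_image) (rule inj_on_subset, auto)
    have "(?T, \<pi> ` ?T) \<in> ?P" using card by auto
    then have "(case (?T, \<pi> ` ?T) of (T, T') \<Rightarrow> if \<pi> ` T = T' then real q ^ card T else 0)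
        \<le> (\<Sum>(T, T')\<in>?P. if \<pi> ` T = T' then real q ^ card T else 0)"
      by (rule member_le_sum[OF _ _ finP]) (simp add: case_prod_unfold)
    then show ?thesis using card im by simp
  qed
  then have "(\<Sum>\<pi>\<in>Sym q. real q ^ card (\<pi> ` A \<inter> A))
      \<le> (\<Sum>\<pi>\<in>Sym q. \<Sum>(T, T')\<in>?P. if \<pi> ` T = T' then real q ^ card T else 0)"
    by (rule sum_mono)
  also have "\<dots> = (\<Sum>(T, T')\<in>?P. \<Sum>\<pi>\<in>Sym q. if \<pi> ` T = T' then real q ^ card T else 0)"
    by (subst sum.swap) (simp add: case_prod_unfold)
  also have "\<dots> = (\<Sum>(T, T')\<in>?P. real q ^ card T * card {\<pi> \<in> Sym q. \<pi> ` T = T'})"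
    by (intro sum.cong refl) (auto simp: sum.If_cases Int_def)
  also have "\<dots> \<le> (\<Sum>(T, T')\<in>?P. real s ^ s * fact q)"
  proof (rule sum_mono, clarsimp)
    fix T T' assume T: "T \<subseteq> A" "T' \<subseteq> A" "card T = card T'"
    have "card T \<le> s" using card_mono[OF finA T(1)] s(1) by simp
    then show "real q ^ card T' * real (card {\<pi> \<in> Sym q. \<pi> ` T = T'}) \<le> real s ^ s * fact q"
      using power_mult_card_Sym_image_le[of T q T' s] T A s(2) by simp
  qed
  also have "\<dots> = card ?P * (real s ^ s * fact q)" by simp
  also have "\<dots> \<le> 4 ^ s * (real s ^ s * fact q)"
  proof (rule mult_right_mono)
    have "card ?P \<le> card (Pow A \<times> Pow A)" by (rule card_mono) (use finA in auto)
    also have "\<dots> = 4 ^ card A" using finA by (simp add: card_cartesian_product card_Pow flip: power_mult_distrib)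
    also have "\<dots> \<le> 4 ^ s" using s(1) by (intro power_increasing) simp_all
    finally have "real (card ?P) \<le> real (4 ^ s)" by (simp only: of_nat_le_iff)
    then show "real (card ?P) \<le> 4 ^ s" by (simp only: of_nat_power of_nat_numeral)
  qed simp
  finally show ?thesis by (simp add: mult.assoc)
qed

section \<open>The second moment of the characters\<close>

lemma class_F_D:
  assumes "(q, \<psi>) \<in> class_F n c \<delta>"
  shows "q \<ge> 1" "central_fun q \<psi>" "pos_def_fun q \<psi>" "\<psi> id = 1"
    "\<And>\<rho>. \<rho> \<in> Sym q \<Longrightarrow> perm_length q \<rho> \<in> {1..n} \<Longrightarrow>
      norm (\<psi> \<rho>) \<le> c (perm_length q \<rho>) * real q powr (- real (perm_length q \<rho>) / 2)"
    "\<And>\<rho> \<sigma>. \<rho> \<in> Sym q \<Longrightarrow> \<sigma> \<in> Sym q \<Longrightarrow> perm_support \<rho> \<inter> perm_support \<sigma> = {} \<Longrightarrow>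
      perm_length q (\<rho> \<circ> \<sigma>) \<le> n \<Longrightarrow>
      norm (\<psi> (\<rho> \<circ> \<sigma>) - \<psi> \<rho> * \<psi> \<sigma>) \<le> \<delta> * real q powr (- real (perm_length q (\<rho> \<circ> \<sigma>)) / 2)"
  using assms unfolding class_F_def by auto

text \<open>Expand the square and linearize the squared character by \<open>young_char_mult\<close>
  with both arguments \<rho>; the weights then reassemble to \<psi>. The norm on the right prepares
  the triangle inequality over \<pi>.\<close>

lemma variance_identity:
  assumes cen: "central_fun q \<psi>" and pd: "pos_def_fun q \<psi>" and one: "\<psi> id = 1" and \<rho>: "\<rho> \<in> Sym q"
  shows "(\<Sum>\<mu>\<in>young_diagrams q. pmf (young_measure q \<psi>) \<mu> * (norm (young_char \<mu> \<rho> - \<psi> \<rho>))\<^sup>2)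
    = norm (\<Sum>\<pi>\<in>Sym q. \<psi> (\<pi> \<circ> \<rho> \<circ> inv \<pi> \<circ> \<rho>) - (\<psi> \<rho>)\<^sup>2) / fact q"
proof -
  let ?Y = "young_diagrams q"
  define p where "p \<mu> = pmf (young_measure q \<psi>) \<mu>" for \<mu>
  have \<psi>: "\<psi> \<sigma> = (\<Sum>\<mu>\<in>?Y. of_real (p \<mu>) * young_char \<mu> \<sigma>)" if "\<sigma> \<in> Sym q" for \<sigma>
    unfolding p_def using young_measure_expansion(2)[OF cen pd one that] .
  have real: "\<psi> \<rho> \<in> \<real>"
    unfolding \<psi>[OF \<rho>] by (intro sum_in_Reals Reals_mult Reals_of_real young_char_Reals)
  \<comment> \<open>All values are real, so the squared norm is the plain square and can be
    expanded.\<close>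
  have sq: "complex_of_real ((norm (young_char \<mu> \<rho> - \<psi> \<rho>))\<^sup>2) = (young_char \<mu> \<rho> - \<psi> \<rho>)\<^sup>2" for \<mu>
  proof -
    obtain x where "young_char \<mu> \<rho> - \<psi> \<rho> = of_real x"
      using real young_char_Reals by (metis Reals_cases Reals_diff)
    then show ?thesis by (simp flip: of_real_power)
  qed
  have sum1: "(\<Sum>\<mu>\<in>?Y. complex_of_real (p \<mu>)) = 1"
    using \<psi>[OF id_in_Sym(1)] one by (simp add: young_char_id)
  have "complex_of_real (\<Sum>\<mu>\<in>?Y. p \<mu> * (norm (young_char \<mu> \<rho> - \<psi> \<rho>))\<^sup>2)
      = (\<Sum>\<mu>\<in>?Y. of_real (p \<mu>) * (young_char \<mu> \<rho> - \<psi> \<rho>)\<^sup>2)"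
    by (simp only: of_real_sum of_real_mult sq)
  also have "\<dots> = (\<Sum>\<mu>\<in>?Y. of_real (p \<mu>) * (young_char \<mu> \<rho> * young_char \<mu> \<rho>)
      - 2 * \<psi> \<rho> * (of_real (p \<mu>) * young_char \<mu> \<rho>) + (\<psi> \<rho>)\<^sup>2 * of_real (p \<mu>))"
    by (intro sum.cong refl) (simp add: power2_eq_square algebra_simps)
  also have "\<dots> = (\<Sum>\<mu>\<in>?Y. of_real (p \<mu>) * (young_char \<mu> \<rho> * young_char \<mu> \<rho>))
      - 2 * \<psi> \<rho> * (\<Sum>\<mu>\<in>?Y. of_real (p \<mu>) * young_char \<mu> \<rho>) + (\<psi> \<rho>)\<^sup>2 * (\<Sum>\<mu>\<in>?Y. of_real (p \<mu>))"
    by (simp only: sum.distrib sum_subtractf sum_distrib_left)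
  also have "\<dots> = (\<Sum>\<mu>\<in>?Y. of_real (p \<mu>) * (young_char \<mu> \<rho> * young_char \<mu> \<rho>)) - (\<psi> \<rho>)\<^sup>2"
    unfolding \<psi>[OF \<rho>, symmetric] sum1 by (simp add: power2_eq_square)
  finally have 0: "complex_of_real (\<Sum>\<mu>\<in>?Y. p \<mu> * (norm (young_char \<mu> \<rho> - \<psi> \<rho>))\<^sup>2)
     = (\<Sum>\<mu>\<in>?Y. of_real (p \<mu>) * (young_char \<mu> \<rho> * young_char \<mu> \<rho>)) - (\<psi> \<rho>)\<^sup>2" .
  have "(\<Sum>\<mu>\<in>?Y. of_real (p \<mu>) * (fact q * (young_char \<mu> \<rho> * young_char \<mu> \<rho>)))
      = fact q * (\<Sum>\<mu>\<in>?Y. of_real (p \<mu>) * (young_char \<mu> \<rho> * young_char \<mu> \<rho>))"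
    by (simp add: sum_distrib_left mult_ac)
  then have 1: "complex_of_real (\<Sum>\<mu>\<in>?Y. p \<mu> * (norm (young_char \<mu> \<rho> - \<psi> \<rho>))\<^sup>2) * fact q
     = (\<Sum>\<mu>\<in>?Y. of_real (p \<mu>) * (fact q * (young_char \<mu> \<rho> * young_char \<mu> \<rho>))) - fact q * (\<psi> \<rho>)\<^sup>2"
    unfolding 0 by (simp only:) (simp add: algebra_simps)
  have "(\<Sum>\<mu>\<in>?Y. of_real (p \<mu>) * (fact q * (young_char \<mu> \<rho> * young_char \<mu> \<rho>)))
      = (\<Sum>\<mu>\<in>?Y. \<Sum>\<pi>\<in>Sym q. of_real (p \<mu>) * young_char \<mu> (\<pi> \<circ> \<rho> \<circ> inv \<pi> \<circ> \<rho>))"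
    by (intro sum.cong refl) (simp only: young_char_mult[OF _ \<rho> \<rho>, symmetric] sum_distrib_left)
  also have "\<dots> = (\<Sum>\<pi>\<in>Sym q. \<Sum>\<mu>\<in>?Y. of_real (p \<mu>) * young_char \<mu> (\<pi> \<circ> \<rho> \<circ> inv \<pi> \<circ> \<rho>))"
    by (rule sum.swap)
  also have "\<dots> = (\<Sum>\<pi>\<in>Sym q. \<psi> (\<pi> \<circ> \<rho> \<circ> inv \<pi> \<circ> \<rho>))"
    using \<rho> by (intro sum.cong refl \<psi>[symmetric]) simp
  finally have "complex_of_real (\<Sum>\<mu>\<in>?Y. p \<mu> * (norm (young_char \<mu> \<rho> - \<psi> \<rho>))\<^sup>2) * fact q
     = (\<Sum>\<pi>\<in>Sym q. \<psi> (\<pi> \<circ> \<rho> \<circ> inv \<pi> \<circ> \<rho>) - (\<psi> \<rho>)\<^sup>2)"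
    using 1 by (simp add: sum_subtractf card_Sym)
  then have "norm (complex_of_real (\<Sum>\<mu>\<in>?Y. p \<mu> * (norm (young_char \<mu> \<rho> - \<psi> \<rho>))\<^sup>2) * fact q)
     = norm (\<Sum>\<pi>\<in>Sym q. \<psi> (\<pi> \<circ> \<rho> \<circ> inv \<pi> \<circ> \<rho>) - (\<psi> \<rho>)\<^sup>2)"
    by simp
  moreover have "(\<Sum>\<mu>\<in>?Y. p \<mu> * (norm (young_char \<mu> \<rho> - \<psi> \<rho>))\<^sup>2) \<ge> 0"
    by (intro sum_nonneg) (simp add: p_def)
  ultimately have "(\<Sum>\<mu>\<in>?Y. p \<mu> * (norm (young_char \<mu> \<rho> - \<psi> \<rho>))\<^sup>2) * fact q
     = norm (\<Sum>\<pi>\<in>Sym q. \<psi> (\<pi> \<circ> \<rho> \<circ> inv \<pi> \<circ> \<rho>) - (\<psi> \<rho>)\<^sup>2)"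
    by (simp only: norm_mult norm_of_real norm_fact abs_of_nonneg)
  then show ?thesis by (simp add: p_def field_simps)
qed

text \<open>One constant for all lengths up to n: the summand 1 covers length 0, where \<psi> is 1,
  and the sum dominates each c l.\<close>

lemma class_F_bound:
  assumes F: "(q, \<psi>) \<in> class_F n c \<delta>" and c_pos: "\<And>l. l \<ge> 1 \<Longrightarrow> c l > 0"
    and \<rho>: "\<rho> \<in> Sym q" "perm_length q \<rho> \<le> n"
  shows "norm (\<psi> \<rho>) \<le> (1 + (\<Sum>l=1..n. c l)) * real q powr (- real (perm_length q \<rho>) / 2)"
proof (cases "perm_length q \<rho> = 0")
  case True
  then have "\<rho> = id" by (rule perm_length_eq_0[OF \<rho>(1)])
  moreover have "(\<Sum>l=1..n. c l) \<ge> 0" using c_pos by (intro sum_nonneg) (simp add: less_imp_le)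
  moreover have "real q powr (- real (perm_length q \<rho>) / 2) = 1"
    using True class_F_D(1)[OF F] by simp
  ultimately show ?thesis using class_F_D(4)[OF F] by simp
next
  case False
  then have l: "perm_length q \<rho> \<in> {1..n}" using \<rho>(2) by simp
  have "c (perm_length q \<rho>) \<le> (\<Sum>l=1..n. c l)"
    using l c_pos by (intro member_le_sum) (simp_all add: less_imp_le)
  then have "c (perm_length q \<rho>) \<le> 1 + (\<Sum>l=1..n. c l)" by simp
  then have "c (perm_length q \<rho>) * real q powr (- real (perm_length q \<rho>) / 2)
      \<le> (1 + (\<Sum>l=1..n. c l)) * real q powr (- real (perm_length q \<rho>) / 2)"
    by (rule mult_right_mono) simp
  with class_F_D(5)[OF F \<rho>(1) l] show ?thesis by simp
qed

text \<open>The first term comes from disjoint supports through condition (2), the second from m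
  \<ge> 1 common points through condition (1). The factor q^m is kept for the average over
  \<pi>.\<close>

lemma conj_product_deviation:
  assumes F: "(q, \<psi>) \<in> class_F n c \<delta>" and c_pos: "\<And>l. l \<ge> 1 \<Longrightarrow> c l > 0" and \<delta>: "\<delta> \<ge> 0"
    and \<rho>: "\<rho> \<in> Sym q" "perm_length q \<rho> = l" "2 * l \<le> n" and \<pi>: "\<pi> \<in> Sym q"
  defines "C \<equiv> 1 + (\<Sum>l=1..n. c l)"
  shows "norm (\<psi> (\<pi> \<circ> \<rho> \<circ> inv \<pi> \<circ> \<rho>) - (\<psi> \<rho>)\<^sup>2)
    \<le> \<delta> * real q powr (- real l)
      + 2 * C\<^sup>2 * real q powr (- real l - 1) * real q ^ card (\<pi> ` perm_support \<rho> \<inter> perm_support \<rho>)"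
proof -
  let ?\<rho>' = "\<pi> \<circ> \<rho> \<circ> inv \<pi>"
  define m where "m = card (\<pi> ` perm_support \<rho> \<inter> perm_support \<rho>)"
  have q1: "real q \<ge> 1" using class_F_D(1)[OF F] by simp
  have "(\<Sum>l=1..n. c l) \<ge> 0" using c_pos by (intro sum_nonneg) (simp add: less_imp_le)
  then have C1: "C \<ge> 1" by (simp add: C_def)
  have \<rho>': "?\<rho>' \<in> Sym q" using \<pi> \<rho>(1) by simp
  have len': "perm_length q ?\<rho>' = l" using perm_length_conj[OF \<pi> \<rho>(1)] \<rho>(2) by simp
  have supp': "perm_support ?\<rho>' = \<pi> ` perm_support \<rho>" by (rule perm_support_conj[OF \<pi>])
  have \<psi>': "\<psi> ?\<rho>' = \<psi> \<rho>" using class_F_D(2)[OF F] \<pi> \<rho>(1) unfolding central_fun_def by blast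
  define l' where "l' = perm_length q (?\<rho>' \<circ> \<rho>)"
  have l'_le: "l' \<le> 2 * l" using perm_length_comp_le[OF \<rho>' \<rho>(1)] len' \<rho>(2) by (simp add: l'_def)
  \<comment> \<open>For m = 0 the subtraction truncates and l' = 2 l follows; for m \<ge> 1 this
    says l' / 2 \<ge> l - (m - 1).\<close>
  have l'_ge: "2 * l \<le> l' + 2 * (m - 1)"
    using perm_length_comp_ge[OF \<rho>' \<rho>(1)] len' \<rho>(2) unfolding l'_def m_def supp' by simp
  have second_nonneg: "0 \<le> 2 * C\<^sup>2 * real q powr (- real l - 1) * real q ^ m" by simp
  show ?thesis
  proof (cases "m = 0")
    case True
    have "finite (\<pi> ` perm_support \<rho> \<inter> perm_support \<rho>)" using finite_perm_support[OF \<rho>(1)] by simp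
    then have "perm_support ?\<rho>' \<inter> perm_support \<rho> = {}" using True unfolding m_def supp' by simp
    then have "norm (\<psi> (?\<rho>' \<circ> \<rho>) - \<psi> ?\<rho>' * \<psi> \<rho>) \<le> \<delta> * real q powr (- real (perm_length q (?\<rho>' \<circ> \<rho>)) / 2)"
      using l'_le \<rho>(3) by (intro class_F_D(6)[OF F \<rho>' \<rho>(1)]) (simp_all only: l'_def)
    moreover have "perm_length q (?\<rho>' \<circ> \<rho>) = 2 * l" using l'_le l'_ge True by (simp add: l'_def)
    ultimately have "norm (\<psi> (?\<rho>' \<circ> \<rho>) - (\<psi> \<rho>)\<^sup>2) \<le> \<delta> * real q powr (- real l)"
      unfolding \<psi>' by (simp add: power2_eq_square)
    then show ?thesis using second_nonneg unfolding m_def by linarith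
  next
    case False
    have CC: "C \<le> C\<^sup>2" using C1 by (simp add: power2_eq_square)
    \<comment> \<open>The exponent m - l - 1 dominates -l' / 2 by \<open>l'_ge\<close>, and -l
      because m \<ge> 1; so r bounds both parts of the difference.\<close>
    define r where "r = real q powr (real m - real l - 1)"
    have r0: "r \<ge> 0" by (simp add: r_def)
    have "norm (\<psi> (?\<rho>' \<circ> \<rho>)) \<le> C * real q powr (- real l' / 2)"
      unfolding C_def l'_def using l'_le \<rho>(3) comp_in_Sym[OF \<rho>' \<rho>(1)]
      by (intro class_F_bound[OF F c_pos]) (simp_all add: l'_def)
    also have "\<dots> \<le> C * r"
      unfolding r_def using C1 q1 l'_ge False by (intro mult_left_mono powr_mono) auto
    also have "\<dots> \<le> C\<^sup>2 * r" using CC r0 by (rule mult_right_mono)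
    finally have 1: "norm (\<psi> (?\<rho>' \<circ> \<rho>)) \<le> C\<^sup>2 * r" .
    have "norm (\<psi> \<rho>) \<le> C * real q powr (- real l / 2)"
      using class_F_bound[OF F c_pos \<rho>(1)] \<rho>(2,3) unfolding C_def by simp
    then have "(norm (\<psi> \<rho>))\<^sup>2 \<le> (C * real q powr (- real l / 2))\<^sup>2"
      by (rule power_mono) simp
    also have "\<dots> = C\<^sup>2 * real q powr (- real l)"
      using q1 by (simp add: power_mult_distrib power2_eq_square flip: powr_add)
    also have "\<dots> \<le> C\<^sup>2 * r"
      unfolding r_def using q1 False by (intro mult_left_mono powr_mono) auto
    finally have 2: "norm ((\<psi> \<rho>)\<^sup>2) \<le> C\<^sup>2 * r" by (simp add: norm_power)
    have "r = real q powr (- real l - 1) * real q ^ m"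
      unfolding r_def using q1 by (simp add: powr_realpow[symmetric] flip: powr_add) (simp add: algebra_simps)
    then have "2 * C\<^sup>2 * real q powr (- real l - 1) * real q ^ m = C\<^sup>2 * r + C\<^sup>2 * r" by simp
    moreover have "0 \<le> \<delta> * real q powr (- real l)" using \<delta> by simp
    moreover have "norm (\<psi> (?\<rho>' \<circ> \<rho>) - (\<psi> \<rho>)\<^sup>2) \<le> norm (\<psi> (?\<rho>' \<circ> \<rho>)) + norm ((\<psi> \<rho>)\<^sup>2)"
      by (rule norm_triangle_ineq4)
    ultimately show ?thesis using 1 2 unfolding m_def by linarith
  qed
qed

text \<open>Average the deviation bound with \<open>sum_power_overlap_le\<close> for s = n,
  admissible because the support of \<rho> has at most 2 l \<le> n points. In E the summand 1 pays
  for \<delta>, the rest for 1/q.\<close>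

lemma second_moment_bound:
  assumes F: "(q, \<psi>) \<in> class_F n c \<delta>" and c_pos: "\<And>l. l \<ge> 1 \<Longrightarrow> c l > 0" and \<delta>: "\<delta> \<ge> 0"
    and n: "n \<ge> 1" and \<rho>: "\<rho> \<in> Sym q" "perm_length q \<rho> = l" "2 * l \<le> n"
  defines "E \<equiv> 1 + 2 * (1 + (\<Sum>l=1..n. c l))\<^sup>2 * (4 ^ n * real n ^ n)"
  shows "(\<Sum>\<mu>\<in>young_diagrams q. pmf (young_measure q \<psi>) \<mu> * (norm (young_char \<mu> \<rho> - \<psi> \<rho>))\<^sup>2)
    \<le> E * (\<delta> + 1 / real q) * real q powr (- real l)"
proof -
  define C where "C = 1 + (\<Sum>l=1..n. c l)"
  define D where "D = 4 ^ n * real n ^ n"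
  have D0: "D \<ge> 0" by (simp add: D_def)
  have q1: "real q \<ge> 1" using class_F_D(1)[OF F] by simp
  let ?m = "\<lambda>\<pi>. card (\<pi> ` perm_support \<rho> \<inter> perm_support \<rho>)"
  have "norm (\<Sum>\<pi>\<in>Sym q. \<psi> (\<pi> \<circ> \<rho> \<circ> inv \<pi> \<circ> \<rho>) - (\<psi> \<rho>)\<^sup>2)
      \<le> (\<Sum>\<pi>\<in>Sym q. \<delta> * real q powr (- real l) + 2 * C\<^sup>2 * real q powr (- real l - 1) * real q ^ ?m \<pi>)"
    unfolding C_def by (rule sum_norm_le) (rule conj_product_deviation[OF F c_pos \<delta> \<rho>])
  also have "\<dots> = fact q * (\<delta> * real q powr (- real l)) + 2 * C\<^sup>2 * real q powr (- real l - 1) * (\<Sum>\<pi>\<in>Sym q. real q ^ ?m \<pi>)"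
    by (simp add: sum.distrib card_Sym sum_distrib_left)
  also have "\<dots> \<le> fact q * (\<delta> * real q powr (- real l)) + 2 * C\<^sup>2 * real q powr (- real l - 1) * (D * fact q)"
  proof (intro add_left_mono mult_left_mono)
    have "card (perm_support \<rho>) \<le> n" using card_perm_support_le[OF \<rho>(1)] \<rho>(2,3) by simp
    then show "(\<Sum>\<pi>\<in>Sym q. real q ^ ?m \<pi>) \<le> D * fact q"
      unfolding D_def by (rule sum_power_overlap_le[OF perm_support_subset[OF \<rho>(1)] _ n])
  qed simp
  also have "\<dots> = fact q * ((\<delta> + 2 * C\<^sup>2 * D * (1 / real q)) * real q powr (- real l))"
    using q1 by (simp add: powr_diff algebra_simps)
  finally have "norm (\<Sum>\<pi>\<in>Sym q. \<psi> (\<pi> \<circ> \<rho> \<circ> inv \<pi> \<circ> \<rho>) - (\<psi> \<rho>)\<^sup>2) / fact q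
      \<le> (\<delta> + 2 * C\<^sup>2 * D * (1 / real q)) * real q powr (- real l)"
    by (simp add: divide_le_eq mult_ac)
  also have "\<dots> \<le> E * (\<delta> + 1 / real q) * real q powr (- real l)"
  proof (rule mult_right_mono)
    have "0 \<le> 2 * C\<^sup>2 * D * \<delta>" "0 \<le> 1 / real q" using D0 \<delta> by simp_all
    then show "\<delta> + 2 * C\<^sup>2 * D * (1 / real q) \<le> E * (\<delta> + 1 / real q)"
      unfolding E_def C_def[symmetric] D_def[symmetric] by (simp add: algebra_simps)
  qed simp
  finally show ?thesis
    unfolding variance_identity[OF class_F_D(2-4)[OF F] \<rho>(1)] .
qed

section \<open>Chebyshev's inequality, reduction to finitely many classes, conclusion\<close>

lemma markov_pmf_sum:
  assumes "finite A" "t > 0" "(\<Sum>x\<in>A. pmf M x * (f x)\<^sup>2) \<le> b"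
  shows "measure_pmf.prob M {x \<in> A. f x > t} \<le> b / t\<^sup>2"
proof -
  have "measure_pmf.prob M {x \<in> A. f x > t} * t\<^sup>2 = (\<Sum>x\<in>{x \<in> A. f x > t}. pmf M x * t\<^sup>2)"
    using assms(1) by (simp add: measure_measure_pmf_finite sum_distrib_right)
  also have "\<dots> \<le> (\<Sum>x\<in>{x \<in> A. f x > t}. pmf M x * (f x)\<^sup>2)"
    using assms(2) by (intro sum_mono mult_left_mono power_mono) auto
  also have "\<dots> \<le> (\<Sum>x\<in>A. pmf M x * (f x)\<^sup>2)"
    using assms(1) by (intro sum_mono2) auto
  also have "\<dots> \<le> b" by (rule assms(3))
  finally show ?thesis using assms(2) by (simp add: pos_le_divide_eq)
qed

text \<open>Relabel the support by an initial segment. The union bound can then run over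
  permutations of {1..n}, whose number does not grow with q.\<close>

lemma conjugate_into_initial_segment:
  assumes \<rho>: "\<rho> \<in> Sym q" and "card (perm_support \<rho>) \<le> n"
  obtains \<pi> where "\<pi> \<in> Sym q" "\<pi> \<circ> \<rho> \<circ> inv \<pi> permutes {1..n}"
proof -
  have sub: "perm_support \<rho> \<subseteq> {1..q}" using \<rho> by (rule perm_support_subset)
  have "card (perm_support \<rho>) \<le> q" using card_mono[OF _ sub] by simp
  then have "{1..card (perm_support \<rho>)} \<subseteq> {1..q}" by simp
  then obtain \<pi> where \<pi>: "\<pi> \<in> Sym q" "\<pi> ` perm_support \<rho> = {1..card (perm_support \<rho>)}"
    using ex_Sym_image[OF sub, of "{1..card (perm_support \<rho>)}"] by auto
  have "\<pi> \<circ> \<rho> \<circ> inv \<pi> \<in> Sym q" using \<pi>(1) \<rho> by simp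
  then have bij: "bij (\<pi> \<circ> \<rho> \<circ> inv \<pi>)" by (rule permutes_bij[OF Sym_permutes])
  have "(\<pi> \<circ> \<rho> \<circ> inv \<pi>) x = x" if "x \<notin> {1..n}" for x
  proof -
    have "x \<notin> perm_support (\<pi> \<circ> \<rho> \<circ> inv \<pi>)"
      unfolding perm_support_conj[OF \<pi>(1)] \<pi>(2) using that assms(2) by auto
    then show ?thesis unfolding perm_support_def by blast
  qed
  then have "\<pi> \<circ> \<rho> \<circ> inv \<pi> permutes {1..n}" using bij unfolding permutes_def bij_iff by blast
  with \<pi>(1) show thesis by (rule that)
qed

theorem theorem2:
  fixes c :: "nat \<Rightarrow> real" and n :: nat
  assumes c_pos: "\<And>l. l \<ge> 1 \<Longrightarrow> c l > 0"
    and n_pos: "n \<ge> 1"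
  shows "\<exists>K :: real. \<forall>\<delta> :: real. \<forall>q :: nat. \<forall>\<psi> :: perm \<Rightarrow> complex.
    \<delta> \<ge> 0 \<longrightarrow> q \<ge> 1 \<longrightarrow> (q, \<psi>) \<in> class_F n c \<delta> \<longrightarrow>
      supported_by q \<psi> ((\<delta> + 1 / real q) powr (1 / 2))
        {\<mu> \<in> young_diagrams q. \<forall>l. \<forall>\<rho> \<in> Sym q. perm_length q \<rho> = l \<and> real l \<le> real n / 2 \<longrightarrow>
           norm (norm_char \<mu> \<rho> - \<psi> \<rho>)
             \<le> K * (\<delta> + 1 / real q) powr (1 / 4) * real q powr (- real l / 2)}"
proof -
  define E where "E = 1 + 2 * (1 + (\<Sum>l=1..n. c l))\<^sup>2 * (4 ^ n * real n ^ n)"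
  have E1: "E \<ge> 1" by (simp add: E_def)
  \<comment> \<open>Dividing the second moment by the squared threshold leaves (\<delta> +
    1/q)^(1/2) / (n! + 1), so that n! exceptional events together stay strictly below (\<delta> +
    1/q)^(1/2).\<close>
  define K where "K = sqrt (E * (fact n + 1))"
  have K2: "K\<^sup>2 = E * (fact n + 1)" and K0: "K > 0"
  proof -
    have "E * (fact n + 1) > 0" using E1 by (intro mult_pos_pos) (simp_all add: add_pos_pos)
    then show "K\<^sup>2 = E * (fact n + 1)" "K > 0" unfolding K_def by simp_all
  qed
  show ?thesis
  proof (intro exI[of _ K] allI impI)
    fix \<delta> :: real and q :: nat and \<psi> :: "perm \<Rightarrow> complex"
    assume \<delta>: "\<delta> \<ge> 0" and q: "q \<ge> 1" and F: "(q, \<psi>) \<in> class_F n c \<delta>"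
    let ?Y = "young_diagrams q"
    define \<epsilon> where "\<epsilon> = \<delta> + 1 / real q"
    have \<epsilon>: "\<epsilon> > 0" using \<delta> q by (simp add: \<epsilon>_def add_nonneg_pos)
    define M where "M = young_measure q \<psi>"
    define t where "t l = K * \<epsilon> powr (1 / 4) * real q powr (- real l / 2)" for l
    define bad where "bad \<rho> = {\<mu> \<in> ?Y. norm (young_char \<mu> \<rho> - \<psi> \<rho>) > t (perm_length q \<rho>)}" for \<rho>
    \<comment> \<open>Meets every class to be controlled and has at most n! elements, whatever q
      is.\<close>
    define R where "R = {\<rho> \<in> Sym q. \<rho> permutes {1..n} \<and> 2 * perm_length q \<rho> \<le> n}"
    have R: "finite R" "card R \<le> fact n"
    proof -
      have "R \<subseteq> {\<rho>. \<rho> permutes {1..n}}" by (auto simp: R_def)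
      moreover have "finite {\<rho>. \<rho> permutes {1..n}}" by (rule finite_permutations) simp
      moreover have "card {\<rho>. \<rho> permutes {1..n}} = fact n" by (rule card_permutations) simp_all
      ultimately show "finite R" "card R \<le> fact n" using finite_subset card_mono by metis+
    qed
    have t0: "t l > 0" for l using K0 \<epsilon> q by (simp add: t_def)
    have t2: "(t l)\<^sup>2 = E * (fact n + 1) * \<epsilon> powr (1 / 2) * real q powr (- real l)" for l
      unfolding t_def using \<epsilon> q by (simp add: power_mult_distrib K2 power2_eq_square[of "_ powr _"] flip: powr_add)
    have bad: "measure_pmf.prob M (bad \<rho>) \<le> \<epsilon> powr (1 / 2) / (fact n + 1)" if "\<rho> \<in> R" for \<rho>
    proof -
      define l where "l = perm_length q \<rho>"
      have "measure_pmf.prob M (bad \<rho>) \<le> (E * \<epsilon> * real q powr (- real l)) / (t l)\<^sup>2"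
        unfolding bad_def M_def l_def[symmetric] \<epsilon>_def E_def
        using that t0 second_moment_bound[OF F c_pos \<delta> n_pos, of \<rho> l]
        by (intro markov_pmf_sum) (simp_all add: R_def l_def)
      also have "\<epsilon> = \<epsilon> powr (1 / 2) * \<epsilon> powr (1 / 2)" using \<epsilon> by (simp flip: powr_add)
      then have "(E * \<epsilon> * real q powr (- real l)) / (t l)\<^sup>2 = \<epsilon> powr (1 / 2) / (fact n + 1)"
        unfolding t2 using \<epsilon> q E1 by (simp add: divide_simps)
      finally show ?thesis .
    qed
    have "measure_pmf.prob M (\<Union>\<rho>\<in>R. bad \<rho>) \<le> (\<Sum>\<rho>\<in>R. measure_pmf.prob M (bad \<rho>))"
      using R(1) by (intro measure_pmf.finite_measure_subadditive_finite) auto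
    also have "\<dots> \<le> (\<Sum>\<rho>\<in>R. \<epsilon> powr (1 / 2) / (fact n + 1))" by (rule sum_mono) (rule bad)
    also have "\<dots> = real (card R) * (\<epsilon> powr (1 / 2) / (fact n + 1))" by simp
    also have "\<dots> \<le> fact n * (\<epsilon> powr (1 / 2) / (fact n + 1))"
    proof (rule mult_right_mono)
      have "real (card R) \<le> real (fact n)" using R(2) by (simp only: of_nat_le_iff)
      then show "real (card R) \<le> fact n" by simp
    qed (simp add: add_nonneg_nonneg)
    \<comment> \<open>The summand 1 in n! + 1 gives the strict inequality that
      \<open>supported_by\<close> demands.\<close>
    also have "\<dots> < \<epsilon> powr (1 / 2)"
      using \<epsilon> by (simp add: pos_divide_less_eq add_pos_pos)
    finally have small: "measure_pmf.prob M (\<Union>\<rho>\<in>R. bad \<rho>) < \<epsilon> powr (1 / 2)" .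
    define V where "V = {\<mu> \<in> ?Y. \<forall>l. \<forall>\<rho> \<in> Sym q. perm_length q \<rho> = l \<and> real l \<le> real n / 2 \<longrightarrow>
           norm (norm_char \<mu> \<rho> - \<psi> \<rho>) \<le> K * \<epsilon> powr (1 / 4) * real q powr (- real l / 2)}"
    \<comment> \<open>A diagram outside V fails at some \<rho>; since \<psi> and the character are
      central, it also fails at a conjugate of \<rho> lying in R.\<close>
    have cover: "\<mu> \<in> V \<union> (\<Union>\<rho>\<in>R. bad \<rho>)" if \<mu>: "\<mu> \<in> ?Y" for \<mu>
    proof (rule ccontr)
      assume n: "\<mu> \<notin> V \<union> (\<Union>\<rho>\<in>R. bad \<rho>)"
      then have "\<mu> \<notin> V" by blast
      then obtain \<rho> where \<rho>: "\<rho> \<in> Sym q" "real (perm_length q \<rho>) \<le> real n / 2"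
          "\<not> norm (norm_char \<mu> \<rho> - \<psi> \<rho>) \<le> t (perm_length q \<rho>)"
        using \<mu> unfolding V_def t_def by blast
      have l: "2 * perm_length q \<rho> \<le> n" using \<rho>(2) by linarith
      then have "card (perm_support \<rho>) \<le> n" using card_perm_support_le[OF \<rho>(1)] by simp
      then obtain \<pi> where \<pi>: "\<pi> \<in> Sym q" "\<pi> \<circ> \<rho> \<circ> inv \<pi> permutes {1..n}"
        using conjugate_into_initial_segment[OF \<rho>(1)] by blast
      let ?\<rho>' = "\<pi> \<circ> \<rho> \<circ> inv \<pi>"
      have len: "perm_length q ?\<rho>' = perm_length q \<rho>" by (rule perm_length_conj[OF \<pi>(1) \<rho>(1)])
      have "?\<rho>' \<in> R" using \<pi> \<rho>(1) l len by (simp add: R_def)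
      moreover have "\<mu> \<in> bad ?\<rho>'"
      proof -
        have "\<psi> ?\<rho>' = \<psi> \<rho>" using class_F_D(2)[OF F] \<pi>(1) \<rho>(1) unfolding central_fun_def by blast
        moreover have "young_char \<mu> ?\<rho>' = young_char \<mu> \<rho>" by (rule young_char_conj[OF \<mu> \<pi>(1) \<rho>(1)])
        ultimately show ?thesis
          using \<rho>(3) \<mu> norm_char_eq_young_char[OF \<mu> \<rho>(1)] unfolding bad_def len by simp
      qed
      ultimately show False using n by blast
    qed
    have "1 = measure_pmf.prob M ?Y"
      using young_measure_expansion(1)[OF class_F_D(2-4)[OF F]] unfolding M_def
      by (subst eq_commute, subst measure_pmf.prob_eq_1) (auto simp: AE_measure_pmf_iff)
    also have "\<dots> \<le> measure_pmf.prob M (V \<union> (\<Union>\<rho>\<in>R. bad \<rho>))"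
      using cover by (intro measure_pmf.finite_measure_mono) auto
    also have "\<dots> \<le> measure_pmf.prob M V + measure_pmf.prob M (\<Union>\<rho>\<in>R. bad \<rho>)"
      by (rule measure_Un_le) auto
    finally have "measure_pmf.prob M V > 1 - \<epsilon> powr (1 / 2)" using small by linarith
    then show "supported_by q \<psi> ((\<delta> + 1 / real q) powr (1 / 2))
        {\<mu> \<in> young_diagrams q. \<forall>l. \<forall>\<rho> \<in> Sym q. perm_length q \<rho> = l \<and> real l \<le> real n / 2 \<longrightarrow>
           norm (norm_char \<mu> \<rho> - \<psi> \<rho>)
             \<le> K * (\<delta> + 1 / real q) powr (1 / 4) * real q powr (- real l / 2)}"
      unfolding supported_by_def M_def V_def \<epsilon>_def .
  qed
qed

end
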